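(* For integers $k \geq 3$ and $s \geq 2$ we have $$\delta(C^k_s, n) = \begin{cases} \dfrac{n}{2(k-1)} + o(n) & \text{if } s \text{ is even, and}\\[2mm] \dfrac{s+1}{2s(k-1)}\,n + o(n) & \text{otherwise,}\end{cases}$$ where $k$ and $s$ are fixed and $n \to \infty$ through multiples of $s(k-1)$.
   Context: A $k$-graph ($k$-uniform hypergraph) consists of a finite vertex set and a set of edges, each edge being a set of exactly $k$ vertices. The minimum codegree $\delta(G)$ of a $k$-graph $G$ is the minimum, over all sets $S$ of $k-1$ vertices of $G$, of the number of edges of $G$ containing $S$. An $H$-packing in $G$ is a collection of vertex-disjoint copies of $H$ in $G$ (copies as not necessarily induced subgraphs); it is perfect if it covers every vertex of $G$. For a fixed $k$-graph $H$ and an integer $n$ divisible by $|V(H)|$, $\delta(H,n)$ denotes the smallest integer $\delta$ such that every $k$-graph $G$ on $n$ vertices with $\delta(G) \geq \delta$ contains a perfect $H$-packing. For $k\ge 3$ and $s > 1$, the loose cycle $C^k_s$ is the $k$-graph with $s(k-1)$ vertices $\{1,\dots,s(k-1)\}$ and the $s$ edges $\{j(k-1)+1, \dots, j(k-1)+k\}$ for $0 \leq j < s$, with addition taken modulo $s(k-1)$. The notation $o(n)$ denotes an error term $f(n)$ with $f(n)/n \to 0$ as $n \to \infty$. *)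

theory Defs
  imports Complex_Main "HOL-Library.Landau_Symbols"
begin

datatype 'a hypergraph = Hypergraph (verts: "'a set") (edges: "'a set set")

definition k_graph :: "nat \<Rightarrow> 'a hypergraph \<Rightarrow> bool" where
  "k_graph k G \<longleftrightarrow> finite (verts G) \<and> (\<forall>e\<in>edges G. e \<subseteq> verts G \<and> card e = k)"

definition codegree :: "'a hypergraph \<Rightarrow> 'a set \<Rightarrow> nat" where
  "codegree G S = card {e \<in> edges G. S \<subseteq> e}"

(* The minimum is over an empty family, hence unspecified, if card (verts G) < k - 1. *)
definition min_codegree :: "nat \<Rightarrow> 'a hypergraph \<Rightarrow> nat" where
  "min_codegree k G = Min (codegree G ` {S. S \<subseteq> verts G \<and> card S = k - 1})"

definition isomorphic :: "'a hypergraph \<Rightarrow> 'b hypergraph \<Rightarrow> bool" where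
  "isomorphic H K \<longleftrightarrow>
     (\<exists>f. bij_betw f (verts H) (verts K) \<and> edges K = (\<lambda>e. f ` e) ` edges H)"

definition subgraph :: "'a hypergraph \<Rightarrow> 'a hypergraph \<Rightarrow> bool" where
  "subgraph K G \<longleftrightarrow> verts K \<subseteq> verts G \<and> edges K \<subseteq> edges G"

definition packing :: "'a hypergraph \<Rightarrow> 'b hypergraph \<Rightarrow> 'b hypergraph set \<Rightarrow> bool" where
  "packing H G P \<longleftrightarrow>
     (\<forall>K\<in>P. isomorphic H K \<and> subgraph K G) \<and>
     pairwise (\<lambda>K L. disjnt (verts K) (verts L)) P"

definition perfect_packing :: "'a hypergraph \<Rightarrow> 'b hypergraph \<Rightarrow> 'b hypergraph set \<Rightarrow> bool" where
  "perfect_packing H G P \<longleftrightarrow> packing H G P \<and> (\<Union>K\<in>P. verts K) = verts G"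

(* Host graphs range over all finite vertex sets of natural numbers; up to isomorphism
   these are all finite k-graphs.  As codegrees are nonnegative, the smallest integer
   threshold is sought among the natural numbers. *)
definition packing_threshold :: "nat \<Rightarrow> 'a hypergraph \<Rightarrow> nat \<Rightarrow> nat" where
  "packing_threshold k H n =
     (LEAST d. \<forall>G :: nat hypergraph.
        k_graph k G \<and> card (verts G) = n \<and> d \<le> min_codegree k G
        \<longrightarrow> (\<exists>P. perfect_packing H G P))"

(* Vertices are labelled 1, ..., s(k-1); the edge with index j consists of the labels
   j(k-1)+1, ..., j(k-1)+k, each reduced modulo s(k-1) to a representative in that range. *)
definition loose_cycle :: "nat \<Rightarrow> nat \<Rightarrow> nat hypergraph" where
  "loose_cycle k s = Hypergraph {1..s * (k - 1)}
     ((\<lambda>j. (\<lambda>i. (j * (k - 1) + i - 1) mod (s * (k - 1)) + 1) ` {1..k}) ` {..<s})"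

lemma k_graph_loose_cycle:
  assumes "k \<ge> 3" "s \<ge> 2"
  shows "k_graph k (loose_cycle k s)"
proof -
  let ?m = "s * (k - 1)"
  have "2 * (k - 1) \<le> ?m"
    using assms(2) by (rule mult_le_mono1)
  then have km: "k \<le> ?m" "0 < ?m"
    using assms by linarith+
  have "inj_on (\<lambda>i. (j * (k - 1) + i - 1) mod ?m + 1) {1..k}" for j
  proof (rule linorder_inj_onI)
    fix x y assume xy: "x < y" "x \<in> {1..k}" "y \<in> {1..k}"
    show "(j * (k - 1) + x - 1) mod ?m + 1 \<noteq> (j * (k - 1) + y - 1) mod ?m + 1"
    proof
      assume "(j * (k - 1) + x - 1) mod ?m + 1 = (j * (k - 1) + y - 1) mod ?m + 1"
      then have "?m dvd (j * (k - 1) + y - 1) - (j * (k - 1) + x - 1)"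
        using xy by (intro mod_eq_dvd_iff_nat[THEN iffD1] diff_le_mono add_left_mono) simp_all
      moreover have "(j * (k - 1) + y - 1) - (j * (k - 1) + x - 1) = y - x"
        using xy by auto
      ultimately have "?m \<le> y - x"
        using xy by (auto dest: dvd_imp_le)
      with km xy show False by auto
    qed
  qed auto
  moreover have "(j * (k - 1) + i - 1) mod ?m + 1 \<in> {1..?m}" for i j
    using mod_less_divisor[OF km(2), of "j * (k - 1) + i - 1"] by auto
  ultimately show ?thesis
    by (auto simp: k_graph_def loose_cycle_def card_image simp del: mod_less_divisor)
qed

lemma packing_threshold_perfect_packing:
  fixes G :: "nat hypergraph"
  assumes "k_graph k G" "k - 1 \<le> card (verts G)"
    and "packing_threshold k H (card (verts G)) \<le> min_codegree k G"
  shows "\<exists>P. perfect_packing H G P"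
proof -
  let ?n = "card (verts G)"
  let ?Q = "\<lambda>d. \<forall>G' :: nat hypergraph.
        k_graph k G' \<and> card (verts G') = ?n \<and> d \<le> min_codegree k G'
        \<longrightarrow> (\<exists>P. perfect_packing H G' P)"
  have bound: "min_codegree k G' \<le> 2 ^ ?n"
    if G': "k_graph k G'" "card (verts G') = ?n" for G' :: "nat hypergraph"
  proof -
    have fin: "finite (verts G')" using G' by (simp add: k_graph_def)
    obtain S where S: "S \<subseteq> verts G'" "card S = k - 1"
      using assms(2) G'(2) by (metis obtain_subset_with_card_n)
    have "min_codegree k G' \<le> codegree G' S"
      unfolding min_codegree_def using S fin by (intro Min_le) auto
    also have "\<dots> \<le> card (Pow (verts G'))"
      unfolding codegree_def using G'(1) fin
      by (intro card_mono) (auto simp: k_graph_def)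
    finally show ?thesis using fin G'(2) by (simp add: card_Pow)
  qed
  have "?Q (Suc (2 ^ ?n))"
    using bound by (meson not_less_eq_eq)
  then have "?Q (packing_threshold k H ?n)"
    unfolding packing_threshold_def by (rule LeastI)
  with assms show ?thesis by blast
qed

end

theory Submission
  imports Defs "HOL-Analysis.Convex" "HOL-Library.Disjoint_Sets"
begin

text \<open>
  Put \<open>c = s * (k - 1)\<close>, the number of vertices of the loose cycle, and \<open>\<tau> = (s + 1) div 2\<close>. Every vertex
  of the cycle lies in at most two of its \<open>s\<close> edges, so a vertex set that meets all edges has at least
  \<open>\<tau>\<close> elements. In both cases of the theorem the claimed main term is \<open>\<tau> / c * n\<close>.

  The lower bound is a space barrier: if the edges of the host graph are all \<open>k\<close>-sets that meet a fixed
  set \<open>A\<close> of \<open>\<tau> * n / c - 1\<close> vertices, then the minimum codegree is at least the size of \<open>A\<close>, but each of the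
  \<open>n / c\<close> copies in a perfect packing would use \<open>\<tau>\<close> vertices of \<open>A\<close>.

  For the upper bound let the codegree be at least \<open>(\<tau> / c + \<eta>) * n\<close>. The proof is by absorption. The only
  tool from extremal hypergraph theory is \<open>blow_up\<close>: a set of \<open>k\<close>-tuples of positive density
  contains a positive density of complete \<open>k\<close>-partite patterns of any fixed size. It follows from the
  Cauchy-Schwarz inequality by duplicating one coordinate after the other, and it takes the place of the
  regularity method.

  Almost perfect packings (\<open>almost_perfect_tiling\<close>). The loose cycle has a \<open>k\<close>-colouring with exactly
  \<open>\<tau>\<close> vertices of colour \<open>0\<close>. Let a family of disjoint copies be as large as possible and suppose that linearly many
  vertices \<open>U\<close> are uncovered. The set \<open>U\<close> spans few edges, so an average \<open>(k - 1)\<close>-subset of \<open>U\<close> has more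
  than \<open>\<tau> / c * n\<close> neighbours in the at most \<open>n / c\<close> copies of the family, and hence more than \<open>\<tau>\<close> neighbours in a positive
  proportion of the copies. By \<open>blow_up\<close> there are \<open>\<tau>\<close> copies in which the same \<open>\<tau> + 1\<close> positions are completely
  joined to common parts of \<open>U\<close>. Each of these positions supplies the \<open>\<tau>\<close> vertices of colour \<open>0\<close> of one new copy whose
  other vertices come from \<open>U\<close>, so \<open>\<tau>\<close> copies can be exchanged for \<open>\<tau> + 1\<close>.

  Absorbers (\<open>many_absorbers\<close>). Two vertices \<open>x\<close> and \<open>y\<close> are reachable from each other if there are many lists \<open>zs\<close>
  of some fixed length for which both \<open>x\<close> with \<open>zs\<close> and \<open>y\<close> with \<open>zs\<close> can be tiled by copies. Vertices whose links have
  a dense intersection are reachable, and by averaging every vertex shares a dense part of its link with linearly many others.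
  Unless \<open>k = s = 3\<close>, the loose cycle has two \<open>k\<close>-colourings whose class sizes differ by one vertex moved from
  class \<open>0\<close> to class \<open>1\<close>. Inside complete \<open>k\<close>-partite patterns this makes many pairs in \<open>A \<times> B\<close>
  reachable for any two linear-sized sets \<open>A\<close> and \<open>B\<close>; taking for \<open>A\<close> and \<open>B\<close> the partners of \<open>x\<close> and \<open>y\<close> shows
  that any two vertices are reachable (\<open>all_pairs_reachable_not_triangle\<close>).

  If \<open>k = s = 3\<close>, all classes of every \<open>3\<close>-colouring have two vertices, but the codegree exceeds \<open>n / 3\<close>, so that among
  any three vertices two have links with a dense intersection. If \<open>x\<close> and \<open>y\<close> are not connected by one or two steps of this
  kind, then nearly all vertices are split into two classes \<open>A\<close> and \<open>B\<close> in each of which any two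
  vertices are reachable in one step. A short combinatorial analysis
  (\<open>consecutive_values\<close>) yields some \<open>j\<close> such that both loose triangles with \<open>j\<close> and loose triangles with \<open>j + 1\<close> vertices in \<open>A\<close>
  are frequent, and exchanging one kind for the other connects \<open>x\<close> and \<open>y\<close> (\<open>all_pairs_reachable_triangle\<close>).

  Finally, a small disjoint family of absorbers that serves every \<open>c\<close>-set many times is chosen greedily
  (\<open>select_disjoint_hitting_family\<close>), the rest is tiled almost perfectly, and the
  leftover is absorbed (\<open>perfect_tiling\<close>).
\<close>

section \<open>Blow-ups of dense sets of tuples\<close>

definition tuples :: "nat \<Rightarrow> 'a set \<Rightarrow> 'a list set" where
  "tuples q V = {xs. set xs \<subseteq> V \<and> length xs = q}"

lemma card_tuples: "finite V \<Longrightarrow> card (tuples q V) = card V ^ q"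
  unfolding tuples_def by (rule card_lists_length_eq)

lemma finite_tuples [intro, simp]: "finite V \<Longrightarrow> finite (tuples q V)"
  unfolding tuples_def by (rule finite_lists_length_eq)

lemma drop_coordinate_tuples:
  "xs \<in> tuples q V \<Longrightarrow> i < q \<Longrightarrow> take i xs @ drop (Suc i) xs \<in> tuples (q - 1) V"
  using set_take_subset[of i xs] set_drop_subset[of "Suc i" xs] by (auto simp: tuples_def)

lemma square_card_le_fibres:
  assumes "finite D" "finite R" "f ` D \<subseteq> R"
  shows "(real (card D))\<^sup>2 \<le> real (card R) * (\<Sum>r\<in>R. (real (card {x\<in>D. f x = r}))\<^sup>2)"
proof -
  have "card D = (\<Sum>r\<in>R. card {x\<in>D. f x = r})"
    using sum.group[OF assms, of "\<lambda>_. 1::nat"] by simp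
  then have "real (card D) = (\<Sum>r\<in>R. real (card {x\<in>D. f x = r}))"
    by simp
  then show ?thesis
    using sum_squared_le_sum_of_squares[of "\<lambda>r. real (card {x\<in>D. f x = r})" R]
    by (simp add: mult.commute)
qed

text \<open>
  Group the tuples by their entries outside coordinate \<open>i\<close>. A duplicated tuple amounts to an ordered pair from one
  group, and the Cauchy-Schwarz inequality bounds the number of these pairs from below. In terms of densities, duplicating
  a coordinate at worst squares the density.
\<close>
lemma card_duplicate_coordinate:
  assumes fin: "finite V" and D: "D \<subseteq> tuples q V" and i: "i < q"
  shows "(real (card D))\<^sup>2
    \<le> real (card V) ^ (q - 1) * real (card {xs @ [y] | xs y. xs \<in> D \<and> y \<in> V \<and> xs[i := y] \<in> D})"
proof -
  let ?rest = "\<lambda>xs :: 'a list. take i xs @ drop (Suc i) xs"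
  let ?R = "tuples (q - 1) V"
  let ?F = "\<lambda>r. {xs \<in> D. ?rest xs = r}"
  let ?D2 = "{xs @ [y] | xs y. xs \<in> D \<and> y \<in> V \<and> xs[i := y] \<in> D}"
  let ?g = "\<lambda>(r::'a list, xs, xs'). xs @ [xs' ! i]"
  have finD: "finite D" using D fin finite_subset by blast
  have rest: "?rest ` D \<subseteq> ?R"
    using D i drop_coordinate_tuples by blast
  have upd: "xs[i := xs' ! i] = xs'" if "xs \<in> D" "xs' \<in> D" "?rest xs = ?rest xs'" for xs xs'
  proof -
    have l: "length xs = q" "length xs' = q" using that D by (auto simp: tuples_def)
    have "take i xs = take i xs'" "drop (Suc i) xs = drop (Suc i) xs'"
      using that(3) l i by (simp_all add: append_eq_append_conv)
    then show ?thesis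
      using l i by (metis id_take_nth_drop upd_conv_take_nth_drop)
  qed
  have inj: "inj_on ?g (SIGMA r:?R. ?F r \<times> ?F r)"
  proof (rule inj_onI, clarsimp)
    fix xs xs' ys'
    assume a: "xs \<in> D" "xs' \<in> D" "ys' \<in> D" "?rest xs' = ?rest xs" "?rest ys' = ?rest xs" "xs' ! i = ys' ! i"
    show "xs' = ys'" using upd[OF a(1,2)] upd[OF a(1,3)] a by metis
  qed
  have sub: "?g ` (SIGMA r:?R. ?F r \<times> ?F r) \<subseteq> ?D2"
  proof (clarify, goal_cases)
    case (1 u r xs xs')
    then have e: "xs[i := xs' ! i] = xs'" using upd[of xs xs'] by simp
    have "xs' \<in> tuples q V" using 1 D by blast
    then have "xs' ! i \<in> V" using i nth_mem[of i xs'] unfolding tuples_def by blast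
    then have "xs \<in> D \<and> xs' ! i \<in> V \<and> xs[i := xs' ! i] \<in> D" unfolding e using 1 by blast
    then have "xs @ [xs' ! i] \<in> ?D2" by (intro CollectI exI conjI) auto
    then show ?case by simp
  qed
  have "?D2 \<subseteq> tuples (Suc q) V"
  proof clarify
    fix xs y assume "xs \<in> D" "y \<in> V"
    moreover from this have "xs \<in> tuples q V" using D by blast
    ultimately show "xs @ [y] \<in> tuples (Suc q) V" by (auto simp: tuples_def)
  qed
  then have finD2: "finite ?D2" using fin finite_subset by blast
  have "(\<Sum>r\<in>?R. (card (?F r))\<^sup>2) = card (SIGMA r:?R. ?F r \<times> ?F r)"
    using fin finD by (subst card_SigmaI) (auto simp: card_cartesian_product power2_eq_square)
  also have "\<dots> \<le> card ?D2"
    using card_inj_on_le[OF inj sub finD2] .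
  finally have "(\<Sum>r\<in>?R. (real (card (?F r)))\<^sup>2) \<le> real (card ?D2)"
    by (metis (mono_tags, lifting) of_nat_le_iff of_nat_power of_nat_sum sum.cong)
  then have "real (card ?R) * (\<Sum>r\<in>?R. (real (card (?F r)))\<^sup>2) \<le> real (card ?R) * real (card ?D2)"
    by (intro mult_left_mono) auto
  then show ?thesis
    using square_card_le_fibres[OF finD _ rest] fin card_tuples[OF fin, of "q - 1"] by auto
qed

text \<open>
  The list \<open>cs\<close> colours the positions of \<open>ys\<close>, and every choice of one position of each colour has to read off a
  tuple of \<open>D\<close>. If \<open>D\<close> is the set of ordered edges of a \<open>k\<close>-graph and \<open>ys\<close> is distinct, this says that the colour classes span a complete
  \<open>k\<close>-partite \<open>k\<close>-graph.
\<close>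
definition transversals_in :: "nat \<Rightarrow> 'a list set \<Rightarrow> nat list \<Rightarrow> 'a list \<Rightarrow> bool" where
  "transversals_in k D cs ys \<longleftrightarrow>
     (\<forall>\<sigma>. (\<forall>i<k. \<sigma> i < length cs \<and> cs ! \<sigma> i = i) \<longrightarrow> map (\<lambda>i. ys ! \<sigma> i) [0..<k] \<in> D)"

text \<open>
  The first \<open>k\<close> positions serve as one representative of each colour. Every further position of colour \<open>i\<close> duplicates the
  representative of \<open>i\<close>, which squares the density.
\<close>
lemma blow_up_aux:
  assumes fin: "finite V" "V \<noteq> {}" and D: "D \<subseteq> tuples k V" and \<theta>: "\<theta> \<ge> 0"
    "real (card D) \<ge> \<theta> * real (card V) ^ k" and cs: "set cs \<subseteq> {..<k}"
  shows "real (card {xs \<in> tuples (k + length cs) V. transversals_in k D ([0..<k] @ cs) xs})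
     \<ge> \<theta> ^ (2 ^ length cs) * real (card V) ^ (k + length cs)"
  using cs
proof (induction cs rule: rev_induct)
  case Nil
  have "D \<subseteq> {xs \<in> tuples k V. transversals_in k D [0..<k] xs}"
  proof
    fix xs assume xs: "xs \<in> D"
    have "map (\<lambda>i. xs ! \<sigma> i) [0..<k] \<in> D" if "\<forall>i<k. \<sigma> i < k \<and> [0..<k] ! \<sigma> i = i" for \<sigma>
    proof -
      have "map (\<lambda>i. xs ! \<sigma> i) [0..<k] = map (\<lambda>i. xs ! i) [0..<k]" using that by auto
      also have "\<dots> = xs" using xs D by (auto simp: tuples_def map_nth)
      finally show ?thesis using xs by simp
    qed
    then show "xs \<in> {xs \<in> tuples k V. transversals_in k D [0..<k] xs}"
      using xs D by (auto simp: transversals_in_def)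
  qed
  then have "card D \<le> card {xs \<in> tuples k V. transversals_in k D [0..<k] xs}"
    using fin by (intro card_mono) auto
  then show ?case using \<theta> by simp
next
  case (snoc i cs)
  let ?q = "k + length cs"
  let ?n = "real (card V)"
  let ?G = "{xs \<in> tuples ?q V. transversals_in k D ([0..<k] @ cs) xs}"
  let ?D2 = "{xs @ [y] | xs y. xs \<in> ?G \<and> y \<in> V \<and> xs[i := y] \<in> ?G}"
  let ?G' = "{xs \<in> tuples (k + length (cs @ [i])) V. transversals_in k D ([0..<k] @ cs @ [i]) xs}"
  have i: "i < k" using snoc.prems by auto
  have n: "?n > 0" using fin by (simp add: card_gt_0_iff)
  have IH: "\<theta> ^ (2 ^ length cs) * ?n ^ ?q \<le> real (card ?G)" using snoc by auto
  have "?D2 \<subseteq> ?G'"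
  proof
    fix zs assume "zs \<in> ?D2"
    then obtain xs y where zs: "zs = xs @ [y]" "xs \<in> ?G" "y \<in> V" "xs[i := y] \<in> ?G" by blast
    then have l: "length xs = ?q" by (auto simp: tuples_def)
    have "map (\<lambda>l. zs ! \<sigma> l) [0..<k] \<in> D"
      if \<sigma>: "\<forall>l<k. \<sigma> l < length ([0..<k] @ cs @ [i]) \<and> ([0..<k] @ cs @ [i]) ! \<sigma> l = l" for \<sigma>
    proof -
      have old: "\<sigma> l < ?q \<and> ([0..<k] @ cs) ! \<sigma> l = l" if "l < k" "\<sigma> l \<noteq> ?q" for l
        using \<sigma> that by (auto simp: nth_append less_Suc_eq split: if_splits)
      have new: "l = i" if "l < k" "\<sigma> l = ?q" for l
        using \<sigma> that by (auto simp: nth_append)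
      show ?thesis
      proof (cases "\<sigma> i = ?q")
        case False
        then have all: "\<forall>l<k. \<sigma> l < ?q \<and> ([0..<k] @ cs) ! \<sigma> l = l" using old new by blast
        then have "map (\<lambda>l. xs ! \<sigma> l) [0..<k] \<in> D"
          using zs(2) by (simp add: transversals_in_def)
        moreover have "map (\<lambda>l. xs ! \<sigma> l) [0..<k] = map (\<lambda>l. zs ! \<sigma> l) [0..<k]"
          by (rule map_cong) (use all l zs(1) in \<open>auto simp: nth_append\<close>)
        ultimately show ?thesis by (rule back_subst)
      next
        case True
        \<comment> \<open>The new position duplicates the representative of colour \<open>i\<close>, which sits at position \<open>i\<close>.\<close>
        define \<sigma>' where "\<sigma>' = \<sigma>(i := i)"
        have all: "\<forall>l<k. \<sigma>' l < ?q \<and> ([0..<k] @ cs) ! \<sigma>' l = l"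
        proof (intro allI impI)
          fix l assume "l < k"
          show "\<sigma>' l < ?q \<and> ([0..<k] @ cs) ! \<sigma>' l = l"
          proof (cases "l = i")
            case True
            then show ?thesis using i by (simp add: \<sigma>'_def nth_append)
          next
            case False
            then have "\<sigma> l \<noteq> ?q" using new \<open>l < k\<close> by blast
            then show ?thesis using old[OF \<open>l < k\<close>] False by (simp add: \<sigma>'_def)
          qed
        qed
        then have "map (\<lambda>l. xs[i := y] ! \<sigma>' l) [0..<k] \<in> D"
          using zs(4) by (simp add: transversals_in_def)
        moreover have "zs ! \<sigma> t = xs[i := y] ! \<sigma>' t" if "t < k" for t
        proof (cases "t = i")
          case True
          then show ?thesis using \<open>\<sigma> i = ?q\<close> l zs(1) i by (simp add: \<sigma>'_def nth_append)
        next
          case False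
          then have "\<sigma> t \<noteq> ?q" using new that by blast
          then have "\<sigma> t < ?q" "([0..<k] @ cs) ! \<sigma> t = t" using old that by auto
          moreover have "\<sigma> t \<noteq> i" using calculation(2) i False by (auto simp: nth_append)
          ultimately show ?thesis using False l zs(1) by (simp add: \<sigma>'_def nth_append)
        qed
        ultimately show ?thesis
          by (metis (no_types, lifting) atLeastLessThan_iff map_cong set_upt)
      qed
    qed
    then show "zs \<in> ?G'" using zs by (auto simp: transversals_in_def tuples_def)
  qed
  then have "card ?D2 \<le> card ?G'" using fin by (intro card_mono) auto
  moreover have "(real (card ?G))\<^sup>2 \<le> ?n ^ (?q - 1) * real (card ?D2)"
    using i by (intro card_duplicate_coordinate fin) auto
  ultimately have "(real (card ?G))\<^sup>2 \<le> ?n ^ (?q - 1) * real (card ?G')"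
    by (smt (verit) mult_left_mono of_nat_le_iff of_nat_0_le_iff zero_le_power)
  moreover have "(\<theta> ^ (2 ^ length cs) * ?n ^ ?q)\<^sup>2 \<le> (real (card ?G))\<^sup>2"
    using IH \<theta> by (intro power_mono) auto
  moreover have "(\<theta> ^ (2 ^ length cs) * ?n ^ ?q)\<^sup>2
      = ?n ^ (?q - 1) * (\<theta> ^ (2 ^ length (cs @ [i])) * ?n ^ (k + length (cs @ [i])))"
  proof -
    have 1: "?n ^ ?q * ?n ^ ?q = ?n ^ (?q - 1) * ?n ^ Suc ?q"
      unfolding power_add[symmetric] using i by (intro arg_cong[of _ _ "\<lambda>e. ?n ^ e"]) auto
    have 2: "\<theta> ^ (2 ^ length cs) * \<theta> ^ (2 ^ length cs) = \<theta> ^ (2 ^ length (cs @ [i]))"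
      unfolding power_add[symmetric] by (simp add: mult_2)
    have "(\<theta> ^ (2 ^ length cs) * ?n ^ ?q)\<^sup>2
        = (\<theta> ^ (2 ^ length cs) * \<theta> ^ (2 ^ length cs)) * (?n ^ ?q * ?n ^ ?q)"
      by (simp only: power2_eq_square mult_ac)
    also have "\<dots> = ?n ^ (?q - 1) * (\<theta> ^ (2 ^ length (cs @ [i])) * ?n ^ Suc ?q)"
      unfolding 1 2 by (simp only: mult_ac)
    finally show ?thesis by simp
  qed
  ultimately have "?n ^ (?q - 1) * (\<theta> ^ (2 ^ length (cs @ [i])) * ?n ^ (k + length (cs @ [i])))
      \<le> ?n ^ (?q - 1) * real (card ?G')" by linarith
  then show ?case using n by (simp only: mult_le_cancel_left_pos zero_less_power append_assoc)
qed

text \<open>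
  The representatives are forgotten; each remaining tuple extends to at most \<open>card V ^ k\<close> tuples with representatives,
  so the density does not drop.
\<close>
lemma blow_up:
  assumes fin: "finite V" "V \<noteq> {}" and D: "D \<subseteq> tuples k V" and \<theta>: "\<theta> \<ge> 0"
    "real (card D) \<ge> \<theta> * real (card V) ^ k" and cs: "set cs \<subseteq> {..<k}"
  shows "real (card {ys \<in> tuples (length cs) V. transversals_in k D cs ys})
     \<ge> \<theta> ^ (2 ^ length cs) * real (card V) ^ length cs"
proof -
  let ?n = "real (card V)"
  let ?G = "{xs \<in> tuples (k + length cs) V. transversals_in k D ([0..<k] @ cs) xs}"
  let ?H = "{ys \<in> tuples (length cs) V. transversals_in k D cs ys}"
  let ?f = "\<lambda>xs. (take k xs, drop k xs)"
  have n: "?n > 0" using fin by (simp add: card_gt_0_iff)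
  have "inj_on ?f ?G" by (rule inj_onI) (metis append_take_drop_id prod.inject)
  moreover have "?f ` ?G \<subseteq> tuples k V \<times> ?H"
  proof (clarify, intro conjI)
    fix xs assume xs: "xs \<in> tuples (k + length cs) V" "transversals_in k D ([0..<k] @ cs) xs"
    then show "take k xs \<in> tuples k V"
      by (auto simp: tuples_def dest: in_set_takeD)
    have "map (\<lambda>i. drop k xs ! \<sigma> i) [0..<k] \<in> D"
      if \<sigma>: "\<forall>i<k. \<sigma> i < length cs \<and> cs ! \<sigma> i = i" for \<sigma>
    proof -
      have "map (\<lambda>i. xs ! (k + \<sigma> i)) [0..<k] \<in> D"
        using xs(2) \<sigma> unfolding transversals_in_def
        by (elim allE[of _ "\<lambda>i. k + \<sigma> i"]) (auto simp: nth_append)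
      moreover have "map (\<lambda>i. xs ! (k + \<sigma> i)) [0..<k] = map (\<lambda>i. drop k xs ! \<sigma> i) [0..<k]"
        by (rule map_cong) (use xs(1) in \<open>auto simp: tuples_def\<close>)
      ultimately show ?thesis by (rule back_subst)
    qed
    then show "drop k xs \<in> ?H"
      using xs(1) by (auto simp: tuples_def transversals_in_def dest: in_set_dropD)
  qed
  ultimately have "card ?G \<le> card (tuples k V \<times> ?H)"
    using fin by (intro card_inj_on_le[of ?f]) auto
  also have "\<dots> = card V ^ k * card ?H"
    using fin by (simp only: card_cartesian_product card_tuples)
  finally have "real (card ?G) \<le> real (card V ^ k * card ?H)"
    by (simp only: of_nat_le_iff)
  then have "real (card ?G) \<le> ?n ^ k * real (card ?H)" by simp
  with blow_up_aux[OF assms]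
  have "?n ^ k * (\<theta> ^ (2 ^ length cs) * ?n ^ length cs) \<le> ?n ^ k * real (card ?H)"
    by (simp add: power_add mult_ac)
  then show ?thesis using n by (simp only: mult_le_cancel_left_pos zero_less_power)
qed

lemma card_degenerate_tuples:
  assumes fin: "finite V" and F: "finite F"
  shows "card {xs \<in> tuples q V. \<not> distinct xs \<or> set xs \<inter> F \<noteq> {}} \<le> (q\<^sup>2 + q * card F) * card V ^ (q - 1)"
proof -
  define fix_pos :: "nat \<Rightarrow> 'a \<Rightarrow> 'a list set" where "fix_pos i a = {xs \<in> tuples q V. xs ! i = a}" for i a
  define eq_pos where "eq_pos i j = {xs \<in> tuples q V. xs ! i = xs ! j}" for i j
  let ?rest = "\<lambda>i (xs :: 'a list). take i xs @ drop (Suc i) xs"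
  have fib: "card X \<le> card V ^ (q - 1)"
    if i: "i < q" and X: "X \<subseteq> tuples q V"
      and *: "\<And>xs ys. xs \<in> X \<Longrightarrow> ys \<in> X \<Longrightarrow> ?rest i xs = ?rest i ys \<Longrightarrow> xs ! i = ys ! i" for i X
  proof -
    have "inj_on (?rest i) X"
    proof (rule inj_onI)
      fix xs ys assume a: "xs \<in> X" "ys \<in> X" "?rest i xs = ?rest i ys"
      then have l: "length xs = q" "length ys = q" using X by (auto simp: tuples_def)
      have "take i xs = take i ys" "drop (Suc i) xs = drop (Suc i) ys"
        using a(3) l i by (simp_all add: append_eq_append_conv)
      then show "xs = ys" using l i *[OF a] by (metis id_take_nth_drop)
    qed
    moreover have "?rest i ` X \<subseteq> tuples (q - 1) V"
      using X i drop_coordinate_tuples by blast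
    ultimately have "card X \<le> card (tuples (q - 1) V)"
      using fin by (intro card_inj_on_le) auto
    then show ?thesis using fin by (simp add: card_tuples)
  qed
  have 1: "card (fix_pos i a) \<le> card V ^ (q - 1)" if "i < q" for i a
    by (rule fib[OF that]) (auto simp: fix_pos_def)
  have 2: "card (eq_pos i j) \<le> card V ^ (q - 1)" if "i < j" "j < q" for i j
  proof (rule fib[OF that(2)])
    fix xs ys assume a: "xs \<in> eq_pos i j" "ys \<in> eq_pos i j" "?rest j xs = ?rest j ys"
    then have "length xs = q" "length ys = q" by (auto simp: eq_pos_def tuples_def)
    then have "take j xs = take j ys" using a(3) that by (simp add: append_eq_append_conv)
    then have "xs ! i = ys ! i" using that by (metis nth_take)
    then show "xs ! j = ys ! j" using a by (auto simp: eq_pos_def)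
  qed (auto simp: eq_pos_def)
  let ?P = "{(i, j). i < j \<and> j < q}"
  have P: "?P \<subseteq> {..<q} \<times> {..<q}" by auto
  then have finP: "finite ?P" by (rule finite_subset) auto
  have cP: "card ?P \<le> q\<^sup>2" using card_mono[OF _ P] by (simp add: card_cartesian_product power2_eq_square)
  have "{xs \<in> tuples q V. \<not> distinct xs \<or> set xs \<inter> F \<noteq> {}}
      \<subseteq> (\<Union>p\<in>?P. eq_pos (fst p) (snd p)) \<union> (\<Union>p\<in>{..<q} \<times> F. fix_pos (fst p) (snd p))" (is "_ \<subseteq> ?A \<union> ?B")
  proof
    fix xs assume xs: "xs \<in> {xs \<in> tuples q V. \<not> distinct xs \<or> set xs \<inter> F \<noteq> {}}"
    then have l: "length xs = q" "xs \<in> tuples q V" by (auto simp: tuples_def)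
    from xs consider "\<not> distinct xs" | "set xs \<inter> F \<noteq> {}" by auto
    then show "xs \<in> ?A \<union> ?B"
    proof cases
      case 1
      then obtain i j where "i < q" "j < q" "i \<noteq> j" "xs ! i = xs ! j" using l by (auto simp: distinct_conv_nth)
      then have "(min i j, max i j) \<in> ?P" "xs ! min i j = xs ! max i j" by (auto simp: min_def max_def)
      then show ?thesis using l by (auto simp: eq_pos_def)
    next
      case 2
      then obtain a where "a \<in> set xs" "a \<in> F" by auto
      then obtain i where "i < q" "xs ! i = a" using l by (auto simp: in_set_conv_nth)
      then show ?thesis using l \<open>a \<in> F\<close> by (auto simp: fix_pos_def)
    qed
  qed
  then have "card {xs \<in> tuples q V. \<not> distinct xs \<or> set xs \<inter> F \<noteq> {}} \<le> card (?A \<union> ?B)"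
    using fin finP F by (intro card_mono) (auto simp: eq_pos_def fix_pos_def)
  also have "\<dots> \<le> card ?A + card ?B" by (rule card_Un_le)
  also have "card ?A \<le> (\<Sum>p\<in>?P. card (eq_pos (fst p) (snd p)))" by (rule card_UN_le[OF finP])
  also have "\<dots> \<le> (\<Sum>p\<in>?P. card V ^ (q - 1))" by (intro sum_mono) (use 2 in auto)
  also have "\<dots> \<le> q\<^sup>2 * card V ^ (q - 1)" using cP by simp
  also have "card ?B \<le> (\<Sum>p\<in>{..<q} \<times> F. card (fix_pos (fst p) (snd p)))" using F by (intro card_UN_le) auto
  also have "\<dots> \<le> (\<Sum>p\<in>{..<q} \<times> F. card V ^ (q - 1))" by (intro sum_mono) (use 1 in auto)
  also have "\<dots> = q * card F * card V ^ (q - 1)" by (simp add: card_cartesian_product)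
  finally show ?thesis by (simp add: algebra_simps)
qed

text \<open>
  Degenerate tuples have density of order \<open>1 / card V\<close>. Constructions can therefore ignore coincidences between vertices and
  remove them once at the end, at the cost of half the density.
\<close>
lemma card_clean_tuples:
  assumes fin: "finite V" "finite F" and D: "D \<subseteq> tuples q V" and q: "q > 0"
    and \<theta>: "real (card D) \<ge> \<theta> * real (card V) ^ q"
    and n: "2 * (real q ^ 2 + real q * real (card F)) \<le> \<theta> * real (card V)"
  shows "real (card {xs \<in> D. distinct xs \<and> set xs \<inter> F = {}}) \<ge> \<theta> / 2 * real (card V) ^ q"
proof -
  let ?n = "real (card V)"
  let ?B = "{xs \<in> tuples q V. \<not> distinct xs \<or> set xs \<inter> F \<noteq> {}}"
  let ?C = "{xs \<in> D. distinct xs \<and> set xs \<inter> F = {}}"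
  have "D \<subseteq> ?C \<union> ?B" using D by auto
  moreover have "finite (?C \<union> ?B)" using fin D finite_subset[OF D] by auto
  ultimately have "card D \<le> card ?C + card ?B"
    by (meson card_Un_le card_mono le_trans)
  then have "real (card D) \<le> real (card ?C) + real (card ?B)" by linarith
  moreover have "real (card ?B) \<le> (real q ^ 2 + real q * real (card F)) * ?n ^ (q - 1)"
  proof -
    have "real (card ?B) \<le> real ((q\<^sup>2 + q * card F) * card V ^ (q - 1))"
      using card_degenerate_tuples[OF fin, of q] by (simp only: of_nat_le_iff)
    then show ?thesis by simp
  qed
  moreover have "2 * (real q ^ 2 + real q * real (card F)) * ?n ^ (q - 1) \<le> \<theta> * ?n * ?n ^ (q - 1)"
    by (rule mult_right_mono[OF n]) simp
  moreover have "\<theta> * ?n * ?n ^ (q - 1) = \<theta> * ?n ^ q" using q by (cases q) auto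
  ultimately show ?thesis using \<theta> by linarith
qed

lemma blow_up_distinct:
  assumes fin: "finite V" "V \<noteq> {}" and D: "D \<subseteq> tuples k V" and \<theta>: "\<theta> > 0"
    "real (card D) \<ge> \<theta> * real (card V) ^ k" and cs: "set cs \<subseteq> {..<k}" "cs \<noteq> []"
    and n: "2 * (real (length cs))\<^sup>2 \<le> \<theta> ^ 2 ^ length cs * real (card V)"
  shows "\<theta> ^ 2 ^ length cs / 2 * real (card V) ^ length cs
    \<le> real (card {ys \<in> tuples (length cs) V. transversals_in k D cs ys \<and> distinct ys})"
proof -
  let ?Y = "{ys \<in> tuples (length cs) V. transversals_in k D cs ys}"
  have "\<theta> ^ 2 ^ length cs / 2 * real (card V) ^ length cs \<le> real (card {ys \<in> ?Y. distinct ys \<and> set ys \<inter> {} = {}})"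
    using fin n cs(2) blow_up[OF fin D _ \<theta>(2) cs(1)] \<theta>(1) by (intro card_clean_tuples) auto
  also have "{ys \<in> ?Y. distinct ys \<and> set ys \<inter> {} = {}}
      = {ys \<in> tuples (length cs) V. transversals_in k D cs ys \<and> distinct ys}" by auto
  finally show ?thesis .
qed

lemma card_drop_coordinate:
  assumes fin: "finite V" and D: "D \<subseteq> tuples q V" and i: "i < q"
  shows "card D \<le> card V * card ((\<lambda>xs. take i xs @ drop (Suc i) xs) ` D)"
proof -
  let ?r = "\<lambda>xs. take i xs @ drop (Suc i) xs"
  have finD: "finite D" using D fin finite_subset by blast
  have "inj_on (\<lambda>xs. (xs ! i, ?r xs)) D"
  proof (rule inj_onI)
    fix xs ys assume a: "xs \<in> D" "ys \<in> D" "(xs ! i, ?r xs) = (ys ! i, ?r ys)"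
    then have l: "length xs = q" "length ys = q" using D by (auto simp: tuples_def)
    have "take i xs = take i ys" "drop (Suc i) xs = drop (Suc i) ys"
      using a(3) l i by (simp_all add: append_eq_append_conv)
    then show "xs = ys" using l i a(3) by (metis id_take_nth_drop prod.inject)
  qed
  moreover have "(\<lambda>xs. (xs ! i, ?r xs)) ` D \<subseteq> V \<times> ?r ` D"
  proof (rule image_subsetI)
    fix xs assume "xs \<in> D"
    moreover from this have "xs ! i \<in> V" using D i nth_mem[of i xs] unfolding tuples_def by blast
    ultimately show "(xs ! i, ?r xs) \<in> V \<times> ?r ` D" by blast
  qed
  ultimately have "card D \<le> card (V \<times> ?r ` D)"
    using fin finD by (intro card_inj_on_le[of "\<lambda>xs. (xs ! i, ?r xs)"]) auto
  then show ?thesis by (simp add: card_cartesian_product)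
qed

lemma card_Sigma_image_ge:
  assumes S: "finite S" and F: "\<And>x. x \<in> S \<Longrightarrow> finite (F x) \<and> r \<le> real (card (F x))"
    and inj: "inj_on f (SIGMA x:S. F x)"
  shows "real (card S) * r \<le> real (card (f ` (SIGMA x:S. F x)))"
proof -
  have "card (f ` (SIGMA x:S. F x)) = (\<Sum>x\<in>S. card (F x))"
    using S F inj by (simp add: card_image card_SigmaI)
  moreover have "real (card S) * r \<le> (\<Sum>x\<in>S. real (card (F x)))"
    using sum_bounded_below[of S r "\<lambda>x. real (card (F x))"] F by simp
  ultimately show ?thesis by simp
qed

lemma card_append_ge:
  assumes S: "finite S" "\<And>xs. xs \<in> S \<Longrightarrow> length xs = a"
    and F: "\<And>xs. xs \<in> S \<Longrightarrow> finite (F xs) \<and> r \<le> real (card (F xs))"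
  shows "real (card S) * r \<le> real (card {xs @ ys | xs ys. xs \<in> S \<and> ys \<in> F xs})"
proof -
  have inj: "inj_on (\<lambda>(xs, ys). xs @ ys) (SIGMA xs:S. F xs)"
    by (rule inj_onI) (use S(2) in \<open>auto simp: append_eq_append_conv\<close>)
  have im: "(\<lambda>(xs, ys). xs @ ys) ` (SIGMA xs:S. F xs) = {xs @ ys | xs ys. xs \<in> S \<and> ys \<in> F xs}"
    by auto
  show ?thesis using card_Sigma_image_ge[OF S(1) F inj] unfolding im .
qed

lemma pigeonhole_card:
  assumes "finite I" "B \<subseteq> (\<Union>i\<in>I. F i)" "\<And>i. i \<in> I \<Longrightarrow> finite (F i)" "I \<noteq> {}"
  shows "\<exists>i\<in>I. real (card B) \<le> real (card I) * real (card (F i))"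
proof (rule ccontr)
  assume "\<not> ?thesis"
  then have lt: "real (card I) * real (card (F i)) < real (card B)" if "i \<in> I" for i using that by force
  have "card B \<le> card (\<Union>i\<in>I. F i)" using assms by (intro card_mono) auto
  also have "\<dots> \<le> (\<Sum>i\<in>I. card (F i))" by (rule card_UN_le[OF assms(1)])
  finally have "real (card I) * real (card B) \<le> (\<Sum>i\<in>I. real (card I) * real (card (F i)))"
    unfolding sum_distrib_left[symmetric] by (intro mult_left_mono) (auto simp flip: of_nat_sum)
  also have "\<dots> < (\<Sum>i\<in>I. real (card B))"
    using assms lt by (intro sum_strict_mono) auto
  finally show False by simp
qed

lemma eventually_le_mult:
  "\<theta> > 0 \<Longrightarrow> eventually (\<lambda>n. K \<le> \<theta> * real n) sequentially"
proof (rule eventually_sequentiallyI[of "nat \<lceil>K / \<theta>\<rceil>"])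
  fix n assume "\<theta> > 0" "nat \<lceil>K / \<theta>\<rceil> \<le> n"
  then have "K / \<theta> \<le> real n" by linarith
  then show "K \<le> \<theta> * real n" using \<open>\<theta> > 0\<close> by (simp add: field_simps)
qed

lemma eventually_ln_le:
  assumes "\<kappa> > 0"
  shows "eventually (\<lambda>n. a * ln (real n) + K \<le> \<kappa> * real n) sequentially"
proof -
  have "((\<lambda>x::real. a * (ln x / x) + K * inverse x) \<longlongrightarrow> a * 0 + K * 0) at_top"
    by (intro tendsto_intros ln_x_over_x_tendsto_0 tendsto_inverse_0_at_top filterlim_ident)
  then have "eventually (\<lambda>x::real. a * (ln x / x) + K * inverse x < \<kappa>) at_top"
    using assms by (intro order_tendstoD(2)) auto
  then have "eventually (\<lambda>x::real. a * ln x + K \<le> \<kappa> * x) at_top"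
    using eventually_gt_at_top[of 0] by eventually_elim (simp add: field_simps)
  then show ?thesis
    by (rule eventually_compose_filterlim[OF _ filterlim_real_sequentially])
qed

section \<open>Choosing a disjoint family that hits many sets\<close>

text \<open>
  The members of the family are chosen one after the other so that the potential \<open>\<Sum>w\<in>W. (1 / 2) ^ hits w\<close> shrinks by
  the factor \<open>1 - \<theta> / 4\<close> each time, where \<open>hits w\<close> counts the chosen members of \<open>Abs w\<close>. This is possible because the tuples that
  meet earlier choices are few: each \<open>Abs w\<close> still contains a proportion \<open>\<theta> / 2\<close> of all tuples, so an average candidate achieves the factor. A
  small potential forces many hits for every single \<open>w\<close>.
\<close>
lemma select_disjoint_hitting_family:
  fixes Abs :: "'b \<Rightarrow> 'a list set"
  assumes fin: "finite V" "V \<noteq> {}" and Q: "Q > 0" and W: "finite W" "W \<noteq> {}"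
    and G: "G \<subseteq> tuples Q V" and Abs: "\<And>w. w \<in> W \<Longrightarrow> Abs w \<subseteq> {zs \<in> G. distinct zs}"
    and \<theta>: "\<theta> > 0" "\<And>w. w \<in> W \<Longrightarrow> \<theta> * real (card V) ^ Q \<le> real (card (Abs w))"
    and m: "2 * (real Q)\<^sup>2 * real m \<le> \<theta> * real (card V)"
  shows "\<exists>F\<subseteq>G. finite F \<and> card F = m \<and> disjoint_family_on set F \<and>
    (\<Sum>w\<in>W. (1 / 2) ^ card (F \<inter> Abs w)) \<le> real (card W) * (1 - \<theta> / 4) ^ m"
  using m
proof (induction m)
  case 0
  then show ?case by (intro exI[of _ "{}"]) (auto simp: disjoint_family_on_def)
next
  case (Suc m)
  let ?n = "real (card V)"
  have n0: "?n > 0" using fin by (simp add: card_gt_0_iff)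
  have "2 * (real Q)\<^sup>2 * real m \<le> 2 * (real Q)\<^sup>2 * real (Suc m)" by (intro mult_left_mono) auto
  then obtain F where F: "F \<subseteq> G" "finite F" "card F = m" "disjoint_family_on set F"
    and sum: "(\<Sum>w\<in>W. (1 / 2) ^ card (F \<inter> Abs w)) \<le> real (card W) * (1 - \<theta> / 4) ^ m"
    using Suc by (meson order_trans)
  let ?U = "\<Union> (set ` F)"
  define C where "C = {zs \<in> G. set zs \<inter> ?U = {}}"
  have finU: "finite ?U" using F by auto
  have "card ?U \<le> (\<Sum>zs\<in>F. card (set zs))" using F by (intro card_UN_le) auto
  also have "\<dots> \<le> (\<Sum>zs\<in>F. Q)"
    using F G by (intro sum_mono) (auto simp: tuples_def intro: card_length[THEN order_trans])
  finally have cU: "card ?U \<le> m * Q" using F by simp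
  have finG: "finite G" using G fin finite_subset by blast
  have finC: "finite C" using finG by (simp add: C_def)
  have CG: "C \<subseteq> G" by (auto simp: C_def)
  have hit: "\<theta> / 2 * ?n ^ Q \<le> real (card (C \<inter> Abs w))" if w: "w \<in> W" for w
  proof -
    have "real (card ?U) \<le> real (m * Q)" using cU by (simp only: of_nat_le_iff)
    then have "real Q * real (card ?U) \<le> real Q * real (m * Q)" by (rule mult_left_mono) simp
    then have "2 * ((real Q)\<^sup>2 + real Q * real (card ?U)) \<le> 2 * ((real Q)\<^sup>2 + real Q * real (m * Q))"
      by (intro mult_left_mono[OF add_left_mono]) auto
    also have "\<dots> = 2 * (real Q)\<^sup>2 * real (Suc m)" by (simp add: power2_eq_square algebra_simps)
    also note Suc.prems
    finally have nn: "2 * ((real Q)\<^sup>2 + real Q * real (card ?U)) \<le> \<theta> * ?n" .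
    have "\<theta> / 2 * ?n ^ Q \<le> real (card {zs \<in> Abs w. distinct zs \<and> set zs \<inter> ?U = {}})"
      using Abs[OF w] G by (intro card_clean_tuples[OF fin(1) finU _ Q \<theta>(2)[OF w] nn]) auto
    also have "\<dots> \<le> real (card (C \<inter> Abs w))"
      unfolding of_nat_le_iff using finC Abs[OF w] by (intro card_mono) (auto simp: C_def)
    finally show ?thesis .
  qed
  have "card C \<le> card (tuples Q V)" using CG G fin by (intro card_mono) auto
  then have cC: "real (card C) \<le> ?n ^ Q" using fin by (simp add: card_tuples flip: of_nat_power)
  obtain w0 where "w0 \<in> W" using W by blast
  then have "real (card (C \<inter> Abs w0)) > 0" using hit \<theta>(1) n0 by (smt (verit) divide_pos_pos mult_pos_pos zero_less_power)
  then have C0: "C \<noteq> {}" by auto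
  have notF: "zs \<notin> F" if "zs \<in> C" for zs
  proof
    assume "zs \<in> F"
    then have "set zs \<subseteq> ?U" by (rule UN_upper)
    moreover have "set zs \<inter> ?U = {}" using that by (simp add: C_def)
    ultimately have "set zs = {}" by (metis Int_absorb2)
    then show False using that CG G Q by (auto simp: tuples_def)
  qed
  let ?h = "\<lambda>w. (1 / 2 :: real) ^ card (F \<inter> Abs w)"
  let ?\<Phi> = "\<lambda>zs. \<Sum>w\<in>W. (1 / 2 :: real) ^ card (insert zs F \<inter> Abs w)"
  have step: "(1 / 2 :: real) ^ card (insert zs F \<inter> Abs w) = ?h w * (1 - of_bool (zs \<in> Abs w) / 2)" if "zs \<in> C" for zs w
  proof (cases "zs \<in> Abs w")
    case True
    then have "insert zs F \<inter> Abs w = insert zs (F \<inter> Abs w)" by auto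
    then show ?thesis using True notF[OF that] F by simp
  next
    case False
    then have "insert zs F \<inter> Abs w = F \<inter> Abs w" by auto
    then show ?thesis using False by simp
  qed
  have "(\<Sum>zs\<in>C. ?\<Phi> zs) = (\<Sum>w\<in>W. \<Sum>zs\<in>C. ?h w * (1 - of_bool (zs \<in> Abs w) / 2))"
    using step by (subst sum.swap) (auto intro!: sum.cong)
  also have "\<dots> = (\<Sum>w\<in>W. ?h w * (real (card C) - real (card (C \<inter> Abs w)) / 2))"
  proof (intro sum.cong refl)
    fix w
    have "(\<Sum>zs\<in>C. of_bool (zs \<in> Abs w) :: real) = real (card (C \<inter> Abs w))"
      using finC by (simp add: of_bool_def sum.If_cases Int_def)
    then show "(\<Sum>zs\<in>C. ?h w * (1 - of_bool (zs \<in> Abs w) / 2)) = ?h w * (real (card C) - real (card (C \<inter> Abs w)) / 2)"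
      unfolding sum_distrib_left[symmetric] by (simp add: sum_subtractf sum_divide_distrib[symmetric])
  qed
  also have "\<dots> \<le> (\<Sum>w\<in>W. ?h w * (real (card C) * (1 - \<theta> / 4)))"
  proof (intro sum_mono mult_left_mono)
    fix w assume w: "w \<in> W"
    have "\<theta> / 4 * real (card C) \<le> \<theta> / 4 * ?n ^ Q" using cC \<theta>(1) by (intro mult_left_mono) auto
    moreover have "\<theta> / 2 * ?n ^ Q \<le> real (card (C \<inter> Abs w))" by (rule hit[OF w])
    ultimately have "\<theta> / 4 * real (card C) \<le> real (card (C \<inter> Abs w)) / 2" by linarith
    then show "real (card C) - real (card (C \<inter> Abs w)) / 2 \<le> real (card C) * (1 - \<theta> / 4)"
      by (simp add: algebra_simps)
  qed auto
  also have "\<dots> = real (card C) * ((\<Sum>w\<in>W. ?h w) * (1 - \<theta> / 4))"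
    by (simp add: sum_distrib_right sum_distrib_left mult_ac)
  finally have avg: "(\<Sum>zs\<in>C. ?\<Phi> zs) \<le> real (card C) * ((\<Sum>w\<in>W. ?h w) * (1 - \<theta> / 4))" .
  have "\<exists>zs\<in>C. ?\<Phi> zs \<le> (\<Sum>w\<in>W. ?h w) * (1 - \<theta> / 4)"
  proof (rule ccontr)
    assume "\<not> ?thesis"
    then have "(\<Sum>zs\<in>C. (\<Sum>w\<in>W. ?h w) * (1 - \<theta> / 4)) < (\<Sum>zs\<in>C. ?\<Phi> zs)"
      using finC C0 by (intro sum_strict_mono) (auto simp: not_le)
    then show False using avg by simp
  qed
  then obtain zs where zs: "zs \<in> C" "?\<Phi> zs \<le> (\<Sum>w\<in>W. ?h w) * (1 - \<theta> / 4)" by blast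
  \<comment> \<open>The hypotheses force \<open>\<theta> \<le> 1\<close>, since there are only \<open>card V ^ Q\<close> tuples.\<close>
  have \<theta>4: "0 \<le> 1 - \<theta> / 4"
  proof -
    have "\<theta> * ?n ^ Q \<le> real (card (Abs w0))" by (rule \<theta>(2)) fact
    also have "card (Abs w0) \<le> card (tuples Q V)" using Abs[OF \<open>w0 \<in> W\<close>] G fin by (intro card_mono) auto
    also have "real (card (tuples Q V)) = 1 * ?n ^ Q" using fin by (simp add: card_tuples)
    finally have "\<theta> * ?n ^ Q \<le> 1 * ?n ^ Q" by simp
    then have "\<theta> \<le> 1" using n0 by (simp only: mult_le_cancel_right_pos zero_less_power)
    then show ?thesis by simp
  qed
  have "(\<Sum>w\<in>W. ?h w) * (1 - \<theta> / 4) \<le> real (card W) * (1 - \<theta> / 4) ^ m * (1 - \<theta> / 4)"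
    using sum \<theta>4 by (rule mult_right_mono)
  then have "?\<Phi> zs \<le> real (card W) * (1 - \<theta> / 4) ^ Suc m" using zs(2) by (simp add: mult_ac)
  moreover have "disjoint_family_on set (insert zs F)"
    using F(4) zs(1) by (auto simp: disjoint_family_on_def C_def)
  moreover have "insert zs F \<subseteq> G" "card (insert zs F) = Suc m" using F zs(1) CG notF[OF zs(1)] by auto
  ultimately show ?case using F(2) by (intro exI[of _ "insert zs F"]) simp
qed

section \<open>A colouring lemma for loose triangles\<close>

text \<open>
  This is the combinatorial core of the case \<open>k = s = 3\<close>. Think of \<open>0, 1, 2\<close> as vertices of a class \<open>A\<close>, of \<open>3, 4, 5\<close> as
  vertices outside it, and of \<open>f i j\<close> as the statement that the pair \<open>i, j\<close> is completed to an edge by a vertex of \<open>A\<close>. A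
  loose triangle is obtained from three vertices by completing its three pairs, and the argument of \<open>R\<close> is the number of its vertices
  in \<open>A\<close>. Whatever \<open>f\<close> is, two of the triangles differ by exactly one in this number; the claim is a propositional tautology in the
  15 values of \<open>f\<close>.
\<close>
lemma consecutive_values:
  fixes f :: "nat \<Rightarrow> nat \<Rightarrow> bool" and R :: "nat \<Rightarrow> bool"
  assumes R: "\<And>i j l. i < j \<Longrightarrow> j < l \<Longrightarrow> l < 6 \<Longrightarrow>
      R (of_bool (i < 3) + of_bool (j < 3) + of_bool (l < 3) + (of_bool (f i j) + of_bool (f j l) + of_bool (f i l)))"
  shows "\<exists>j. R j \<and> R (Suc j)"
proof (rule ccontr)
  assume "\<not> ?thesis"
  then have no: "\<not> (R j \<and> R (j + 1))" for j by simp
  define choice where "choice r0 r1 r2 r3 p q w \<longleftrightarrow>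
     (if p then (if q then (if w then r3 else r2) else (if w then r2 else r1))
      else (if q then (if w then r2 else r1) else (if w then r1 else r0)))" for r0 r1 r2 r3 p q w :: bool
  have expand: "choice (R a) (R (a + 1)) (R (a + 2)) (R (a + 3)) p q w"
    if "R (a + (of_bool p + of_bool q + of_bool w))" for a p q w
    using that by (cases p; cases q; cases w) (simp_all add: choice_def numeral_eq_Suc)
  note T = R[THEN expand]
  have t012: "choice (R 3) (R 4) (R 5) (R 6) (f 0 1) (f 1 2) (f 0 2)"
    using T[of 0 1 2] by (simp del: One_nat_def)
  have t013: "choice (R 2) (R 3) (R 4) (R 5) (f 0 1) (f 1 3) (f 0 3)"
    using T[of 0 1 3] by (simp del: One_nat_def)
  have t014: "choice (R 2) (R 3) (R 4) (R 5) (f 0 1) (f 1 4) (f 0 4)"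
    using T[of 0 1 4] by (simp del: One_nat_def)
  have t015: "choice (R 2) (R 3) (R 4) (R 5) (f 0 1) (f 1 5) (f 0 5)"
    using T[of 0 1 5] by (simp del: One_nat_def)
  have t023: "choice (R 2) (R 3) (R 4) (R 5) (f 0 2) (f 2 3) (f 0 3)"
    using T[of 0 2 3] by (simp del: One_nat_def)
  have t024: "choice (R 2) (R 3) (R 4) (R 5) (f 0 2) (f 2 4) (f 0 4)"
    using T[of 0 2 4] by (simp del: One_nat_def)
  have t025: "choice (R 2) (R 3) (R 4) (R 5) (f 0 2) (f 2 5) (f 0 5)"
    using T[of 0 2 5] by (simp del: One_nat_def)
  have t034: "choice (R 1) (R 2) (R 3) (R 4) (f 0 3) (f 3 4) (f 0 4)"
    using T[of 0 3 4] by (simp del: One_nat_def)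
  have t035: "choice (R 1) (R 2) (R 3) (R 4) (f 0 3) (f 3 5) (f 0 5)"
    using T[of 0 3 5] by (simp del: One_nat_def)
  have t045: "choice (R 1) (R 2) (R 3) (R 4) (f 0 4) (f 4 5) (f 0 5)"
    using T[of 0 4 5] by (simp del: One_nat_def)
  have t123: "choice (R 2) (R 3) (R 4) (R 5) (f 1 2) (f 2 3) (f 1 3)"
    using T[of 1 2 3] by (simp del: One_nat_def)
  have t124: "choice (R 2) (R 3) (R 4) (R 5) (f 1 2) (f 2 4) (f 1 4)"
    using T[of 1 2 4] by (simp del: One_nat_def)
  have t125: "choice (R 2) (R 3) (R 4) (R 5) (f 1 2) (f 2 5) (f 1 5)"
    using T[of 1 2 5] by (simp del: One_nat_def)
  have t134: "choice (R 1) (R 2) (R 3) (R 4) (f 1 3) (f 3 4) (f 1 4)"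
    using T[of 1 3 4] by (simp del: One_nat_def)
  have t135: "choice (R 1) (R 2) (R 3) (R 4) (f 1 3) (f 3 5) (f 1 5)"
    using T[of 1 3 5] by (simp del: One_nat_def)
  have t145: "choice (R 1) (R 2) (R 3) (R 4) (f 1 4) (f 4 5) (f 1 5)"
    using T[of 1 4 5] by (simp del: One_nat_def)
  have t234: "choice (R 1) (R 2) (R 3) (R 4) (f 2 3) (f 3 4) (f 2 4)"
    using T[of 2 3 4] by (simp del: One_nat_def)
  have t235: "choice (R 1) (R 2) (R 3) (R 4) (f 2 3) (f 3 5) (f 2 5)"
    using T[of 2 3 5] by (simp del: One_nat_def)
  have t245: "choice (R 1) (R 2) (R 3) (R 4) (f 2 4) (f 4 5) (f 2 5)"
    using T[of 2 4 5] by (simp del: One_nat_def)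
  have t345: "choice (R 0) (R 1) (R 2) (R 3) (f 3 4) (f 4 5) (f 3 5)"
    using T[of 3 4 5] by (simp del: One_nat_def add_2_eq_Suc')
  have no5: "\<not> (R 0 \<and> R 1)" "\<not> (R 1 \<and> R 2)" "\<not> (R 2 \<and> R 3)" "\<not> (R 3 \<and> R 4)" "\<not> (R 4 \<and> R 5)" "\<not> (R 5 \<and> R 6)"
    using no[of 0] no[of 1] no[of 2] no[of 3] no[of 4] no[of 5] by (simp_all del: One_nat_def)
  show False
    using no5 t012 t013 t014 t015 t023 t024 t025 t034 t035 t045 t123 t124 t125 t134 t135 t145 t234 t235 t245 t345
    unfolding choice_def if_bool_eq_conj by metis
qed

section \<open>Copies of the loose cycle\<close>

locale loose_cycle_tiling =
  fixes k s :: nat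
  assumes k: "k \<ge> 3" and s: "s \<ge> 2"
begin

definition c :: nat where "c = s * (k - 1)"

abbreviation succ :: "nat \<Rightarrow> nat" where "succ j \<equiv> (j + 1) mod s"

text \<open>
  Positions are counted from \<open>0\<close>. The edge \<open>j\<close> consists of the block of the \<open>k - 1\<close> positions \<open>i\<close> with \<open>i div (k - 1) = j\<close>
  and of the first position of the next block. The first positions of the blocks, called joints below, are the positions that lie in two edges.
\<close>
definition cyc_edge :: "nat \<Rightarrow> nat set" where
  "cyc_edge j = insert (succ j * (k - 1)) {i. i div (k - 1) = j}"

text \<open>
  Copies are represented by the lists of their vertices in cyclic order, so that they can be counted as tuples.
\<close>
definition tile :: "'a set set \<Rightarrow> 'a list \<Rightarrow> bool" where
  "tile E ys \<longleftrightarrow> distinct ys \<and> length ys = c \<and> (\<forall>j<s. (\<lambda>i. ys ! i) ` cyc_edge j \<in> E)"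

definition tileable :: "'a set set \<Rightarrow> 'a set \<Rightarrow> bool" where
  "tileable E X \<longleftrightarrow> (\<exists>P. finite P \<and> pairwise disjnt P \<and> (\<forall>T\<in>P. \<exists>ys. tile E ys \<and> set ys = T) \<and> \<Union>P = X)"

lemma m2: "k - 1 \<ge> 2" using k by simp

lemma c_pos: "c > 0" using k s by (simp add: c_def)

lemma succ_less: "succ j < s" using s by simp

lemma succ_neq: "j < s \<Longrightarrow> succ j \<noteq> j"
  using s by (cases "j + 1 = s") auto

lemma inj_succ: "inj_on succ {..<s}"
proof (rule inj_onI)
  fix i j assume "i \<in> {..<s}" "j \<in> {..<s}" "succ i = succ j"
  then show "i = j" by (cases "i + 1 = s"; cases "j + 1 = s") auto
qed

lemma succ_surj: "j < s \<Longrightarrow> \<exists>i<s. succ i = j"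
proof (cases j)
  case 0
  then show "j < s \<Longrightarrow> ?thesis" using s by (intro exI[of _ "s - 1"]) auto
next
  case (Suc i)
  then show "j < s \<Longrightarrow> ?thesis" by (intro exI[of _ i]) auto
qed

lemma block_eq: "{i. i div (k - 1) = j} = {j * (k - 1)..<j * (k - 1) + (k - 1)}"
proof (intro set_eqI)
  fix i
  have "i div (k - 1) = j \<longleftrightarrow> j * (k - 1) \<le> i \<and> i < Suc j * (k - 1)"
  proof
    assume j: "i div (k - 1) = j"
    have "i mod (k - 1) < k - 1" using m2 by simp
    then show "j * (k - 1) \<le> i \<and> i < Suc j * (k - 1)"
      unfolding j[symmetric] mult_Suc using div_mult_mod_eq[of i "k - 1"] by (intro conjI; linarith)
  next
    assume "j * (k - 1) \<le> i \<and> i < Suc j * (k - 1)"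
    then show "i div (k - 1) = j" by (intro div_nat_eqI) (simp_all add: mult.commute)
  qed
  then show "i \<in> {i. i div (k - 1) = j} \<longleftrightarrow> i \<in> {j * (k - 1)..<j * (k - 1) + (k - 1)}" by auto
qed

lemma cyc_edge_subset: "j < s \<Longrightarrow> cyc_edge j \<subseteq> {..<c}"
proof -
  assume j: "j < s"
  have "i < c" if "i div (k - 1) < s" for i
    using that m2 by (simp add: c_def div_less_iff_less_mult)
  moreover have "succ j * (k - 1) < c" unfolding c_def using m2 succ_less[of j] by (intro mult_strict_right_mono) auto
  ultimately show ?thesis using j by (auto simp only: cyc_edge_def insert_subset lessThan_iff subset_iff mem_Collect_eq insert_iff)
qed

lemma card_cyc_edge: "j < s \<Longrightarrow> card (cyc_edge j) = k"
proof -
  assume j: "j < s"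
  have "succ j * (k - 1) \<notin> {i. i div (k - 1) = j}" using m2 succ_neq[OF j] by simp
  moreover have f: "finite {i. i div (k - 1) = j}" "card {i. i div (k - 1) = j} = k - 1"
    by (simp_all only: block_eq finite_atLeastLessThan card_atLeastLessThan diff_add_inverse)
  ultimately have "card (cyc_edge j) = Suc (k - 1)"
    unfolding cyc_edge_def using card_insert_disjoint[OF f(1)] by metis
  then show ?thesis using k by simp
qed

lemma index_div: "i < c \<Longrightarrow> i div (k - 1) < s"
  unfolding c_def by (simp add: less_mult_imp_div_less)

lemma tileable_empty: "tileable E {}"
  unfolding tileable_def by (intro exI[of _ "{}"]) auto

lemma tileable_tile: "tile E ys \<Longrightarrow> tileable E (set ys)"
  unfolding tileable_def by (intro exI[of _ "{set ys}"]) auto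

lemma tileable_Un:
  assumes "tileable E X" "tileable E Y" "X \<inter> Y = {}" shows "tileable E (X \<union> Y)"
proof -
  from assms obtain P Q where PQ: "finite P" "pairwise disjnt P" "\<forall>T\<in>P. \<exists>ys. tile E ys \<and> set ys = T" "\<Union>P = X"
    "finite Q" "pairwise disjnt Q" "\<forall>T\<in>Q. \<exists>ys. tile E ys \<and> set ys = T" "\<Union>Q = Y"
    unfolding tileable_def by blast
  have "pairwise disjnt (P \<union> Q)"
  proof (rule pairwiseI)
    fix T T' assume a: "T \<in> P \<union> Q" "T' \<in> P \<union> Q" "T \<noteq> T'"
    have "T \<inter> T' = {}" if "T \<in> P" "T' \<in> Q" for T T'
      using that PQ(4,8) assms(3) by blast
    then show "disjnt T T'"
      using a pairwiseD[OF PQ(2)] pairwiseD[OF PQ(6)] unfolding disjnt_def by (metis UnE inf_commute)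
  qed
  moreover have "\<forall>T\<in>P \<union> Q. \<exists>ys. tile E ys \<and> set ys = T" using PQ(3,7) by blast
  ultimately show ?thesis unfolding tileable_def using PQ(1,4,5,8) by (intro exI[of _ "P \<union> Q"]) auto
qed

lemma tileable_UN:
  assumes "finite I" "\<And>i. i \<in> I \<Longrightarrow> tileable E (X i)" "disjoint_family_on X I"
  shows "tileable E (\<Union>i\<in>I. X i)"
  using assms
proof (induction I rule: finite_induct)
  case empty
  then show ?case by (simp add: tileable_empty)
next
  case (insert i I)
  have "X i \<inter> (\<Union>i\<in>I. X i) = {}" using insert.hyps insert.prems(2) by (fastforce simp: disjoint_family_on_def)
  moreover have "tileable E (\<Union>i\<in>I. X i)"
    using insert.prems by (intro insert.IH) (auto simp: disjoint_family_on_def)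
  ultimately show ?case using insert.prems(1) by (simp add: tileable_Un)
qed

lemma tile_mono: "tile E ys \<Longrightarrow> E \<subseteq> E' \<Longrightarrow> tile E' ys"
  by (auto simp: tile_def)

lemma tileable_mono:
  assumes "tileable E X" "E \<subseteq> E'" shows "tileable E' X"
proof -
  from assms(1) obtain P where P: "finite P" "pairwise disjnt P" "\<forall>T\<in>P. \<exists>ys. tile E ys \<and> set ys = T" "\<Union>P = X"
    unfolding tileable_def by blast
  then have "\<forall>T\<in>P. \<exists>ys. tile E' ys \<and> set ys = T" using tile_mono[OF _ assms(2)] by blast
  then show ?thesis unfolding tileable_def using P by blast
qed

lemma card_tile: "tile E ys \<Longrightarrow> card (set ys) = c"
  by (auto simp: tile_def distinct_card)

lemma tileable_card_dvd:
  assumes "tileable E X" shows "finite X" "c dvd card X"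
proof -
  from assms obtain P where P: "finite P" "pairwise disjnt P" "\<forall>T\<in>P. \<exists>ys. tile E ys \<and> set ys = T" "\<Union>P = X"
    unfolding tileable_def by blast
  have *: "finite T \<and> card T = c" if "T \<in> P" for T using P(3) that card_tile by fastforce
  then show "finite X" using P by auto
  have "card X = (\<Sum>T\<in>P. card T)"
    using card_Union_disjoint[of P] P * by simp
  also have "\<dots> = card P * c" using * by simp
  finally show "c dvd card X" by simp
qed

lemma loose_cycle_edge:
  assumes j: "j < s"
  shows "(\<lambda>i. (j * (k - 1) + i - 1) mod c + 1) ` {1..k} = Suc ` cyc_edge j"
proof -
  let ?f = "\<lambda>i. (j * (k - 1) + i - 1) mod c"
  have k': "{1..k} = insert k {1..k - 1}" using k by auto
  have "j * (k - 1) + k - 1 = (j + 1) * (k - 1)" using k by (cases k) auto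
  then have "?f k = succ j * (k - 1)" by (simp only: mult_mod_left c_def)
  moreover have "?f ` {1..k - 1} = {i. i div (k - 1) = j}"
  proof -
    have "?f i = j * (k - 1) + (i - 1)" if "i \<in> {1..k - 1}" for i
    proof -
      have "i - 1 < k - 1" using that k by auto
      then have "j * (k - 1) + (i - 1) < (j + 1) * (k - 1)" by simp
      also have "\<dots> \<le> c" unfolding c_def using j by (intro mult_right_mono) auto
      finally show ?thesis using that by simp
    qed
    then have "?f ` {1..k - 1} = (\<lambda>i. j * (k - 1) + (i - 1)) ` {1..k - 1}" by (rule image_cong[OF refl])
    also have "\<dots> = {j * (k - 1)..<j * (k - 1) + (k - 1)}"
    proof
      show "{j * (k - 1)..<j * (k - 1) + (k - 1)} \<subseteq> (\<lambda>i. j * (k - 1) + (i - 1)) ` {1..k - 1}"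
      proof
        fix x assume "x \<in> {j * (k - 1)..<j * (k - 1) + (k - 1)}"
        then show "x \<in> (\<lambda>i. j * (k - 1) + (i - 1)) ` {1..k - 1}"
          by (intro image_eqI[of _ _ "x - j * (k - 1) + 1"]) auto
      qed
    qed auto
    finally show ?thesis by (simp only: block_eq)
  qed
  ultimately have "?f ` {1..k} = cyc_edge j" unfolding k' cyc_edge_def by (simp only: image_insert)
  then have "Suc ` ?f ` {1..k} = Suc ` cyc_edge j" by (simp only:)
  then show ?thesis by (simp only: image_image Suc_eq_plus1)
qed

lemma edges_loose_cycle: "edges (loose_cycle k s) = (\<lambda>j. Suc ` cyc_edge j) ` {..<s}"
  unfolding loose_cycle_def hypergraph.sel c_def[symmetric] by (intro image_cong refl loose_cycle_edge) auto

lemma verts_loose_cycle: "verts (loose_cycle k s) = Suc ` {..<c}"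
  unfolding loose_cycle_def hypergraph.sel c_def[symmetric] by (simp add: image_Suc_lessThan)

lemma perfect_packing_if_tileable:
  fixes G :: "'a hypergraph"
  assumes G: "k_graph k G" and "tileable (edges G) (verts G)"
  shows "\<exists>P. perfect_packing (loose_cycle k s) G P"
proof -
  from assms(2) obtain P where P: "finite P" "pairwise disjnt P" "\<forall>T\<in>P. \<exists>ys. tile (edges G) ys \<and> set ys = T" "\<Union>P = verts G"
    unfolding tileable_def by blast
  then obtain ys where ys: "\<And>T. T \<in> P \<Longrightarrow> tile (edges G) (ys T) \<and> set (ys T) = T" by metis
  define K where "K T = Hypergraph T ((\<lambda>j. (\<lambda>i. ys T ! i) ` cyc_edge j) ` {..<s})" for T
  have iso: "isomorphic (loose_cycle k s) (K T)" if "T \<in> P" for T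
  proof -
    let ?f = "\<lambda>v. ys T ! (v - 1)"
    have "bij_betw (\<lambda>i. ys T ! i) {..<c} T"
      using ys[OF that] by (auto simp: tile_def intro: bij_betw_nth)
    moreover have "bij_betw (\<lambda>v. v - 1) (Suc ` {..<c}) {..<c}"
      by (rule bij_betwI[where g = Suc]) auto
    ultimately have "bij_betw ?f (verts (loose_cycle k s)) (verts (K T))"
      unfolding verts_loose_cycle K_def hypergraph.sel using bij_betw_trans by (fastforce simp: o_def)
    moreover have "edges (K T) = (\<lambda>e. ?f ` e) ` edges (loose_cycle k s)"
      unfolding edges_loose_cycle K_def by (simp add: image_image)
    ultimately show ?thesis unfolding isomorphic_def by blast
  qed
  have sub: "subgraph (K T) G" if "T \<in> P" for T
    using ys[OF that] P(4) that by (auto simp: subgraph_def K_def tile_def)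
  have "pairwise (\<lambda>K L. disjnt (verts K) (verts L)) (K ` P)"
    using P(2) unfolding pairwise_def K_def by auto
  then have "perfect_packing (loose_cycle k s) G (K ` P)"
    unfolding perfect_packing_def packing_def using iso sub P(4) by (auto simp: K_def)
  then show ?thesis by blast
qed

lemma tile_if_isomorphic:
  assumes "isomorphic (loose_cycle k s) K" "subgraph K G"
  shows "\<exists>ys. tile (edges G) ys \<and> set ys = verts K"
proof -
  from assms(1) obtain f where f: "bij_betw f (verts (loose_cycle k s)) (verts K)"
    "edges K = (\<lambda>e. f ` e) ` edges (loose_cycle k s)" unfolding isomorphic_def by blast
  let ?ys = "map (\<lambda>i. f (Suc i)) [0..<c]"
  have "inj_on f (Suc ` {..<c})" "f ` Suc ` {..<c} = verts K"
    using f(1) unfolding verts_loose_cycle by (auto simp: bij_betw_def)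
  then have 1: "distinct ?ys" "set ?ys = verts K"
    by (auto simp: distinct_map inj_on_def image_image atLeast0LessThan)
  have "(\<lambda>i. ?ys ! i) ` cyc_edge j \<in> edges G" if "j < s" for j
  proof -
    have "(\<lambda>i. ?ys ! i) ` cyc_edge j = f ` Suc ` cyc_edge j"
      unfolding image_image using cyc_edge_subset[OF that] by (intro image_cong) auto
    also have "\<dots> \<in> edges K" unfolding f(2) edges_loose_cycle using that by blast
    finally show ?thesis using assms(2) by (auto simp: subgraph_def)
  qed
  then show ?thesis using 1 unfolding tile_def by (intro exI[of _ ?ys]) auto
qed

text \<open>
  Each position lies in at most two edges, so a set that meets all \<open>s\<close> edges has at least \<open>s / 2\<close> elements.
\<close>
lemma tile_cover_number:
  assumes "tile E ys" and A: "\<And>e. e \<in> E \<Longrightarrow> e \<inter> A \<noteq> {}"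
  shows "s \<le> 2 * card (set ys \<inter> A)"
proof -
  define I where "I = {i. i < c \<and> ys ! i \<in> A}"
  let ?J = "\<lambda>i. {j. j < s \<and> i \<in> cyc_edge j}"
  have d: "distinct ys" "length ys = c" using assms by (auto simp: tile_def)
  have "card (?J i) \<le> 2" for i
  proof -
    have "card {j. j < s \<and> succ j * (k - 1) = i} \<le> 1"
    proof (rule card_le_Suc0_iff_eq[THEN iffD2, unfolded One_nat_def[symmetric]], simp, clarify)
      fix x y assume "x < s" "y < s" "succ y * (k - 1) = succ x * (k - 1)"
      moreover have "k - 1 \<noteq> 0" using k by simp
      ultimately have "succ y = succ x" by (metis mult_cancel2)
      then show "x = y" using inj_succ \<open>x < s\<close> \<open>y < s\<close> by (metis inj_onD lessThan_iff)
    qed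
    moreover have "?J i \<subseteq> insert (i div (k - 1)) {j. j < s \<and> succ j * (k - 1) = i}"
      by (auto simp: cyc_edge_def)
    then have "card (?J i) \<le> card (insert (i div (k - 1)) {j. j < s \<and> succ j * (k - 1) = i})"
      by (intro card_mono) auto
    moreover have "\<dots> \<le> Suc (card {j. j < s \<and> succ j * (k - 1) = i})" by (rule card_insert_le_m1) auto
    ultimately show ?thesis by linarith
  qed
  note J = this
  have "{..<s} \<subseteq> (\<Union>i\<in>I. ?J i)"
  proof
    fix j assume j: "j \<in> {..<s}"
    then have "(\<lambda>i. ys ! i) ` cyc_edge j \<inter> A \<noteq> {}" using assms by (auto simp: tile_def)
    then obtain i where "i \<in> cyc_edge j" "ys ! i \<in> A" by auto
    moreover from this have "i < c" using cyc_edge_subset j by blast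
    ultimately show "j \<in> (\<Union>i\<in>I. ?J i)" using j by (auto simp: I_def)
  qed
  moreover have finI: "finite I" by (auto simp: I_def)
  ultimately have "card {..<s} \<le> card (\<Union>i\<in>I. ?J i)" by (intro card_mono) auto
  also have "\<dots> \<le> (\<Sum>i\<in>I. card (?J i))" by (rule card_UN_le[OF finI])
  also have "\<dots> \<le> (\<Sum>i\<in>I. 2)" by (intro sum_mono J)
  also have "\<dots> = 2 * card I" by simp
  also have "card I \<le> card (set ys \<inter> A)"
    by (rule card_inj_on_le[of "\<lambda>i. ys ! i"]) (use d in \<open>auto simp: I_def inj_on_def nth_eq_iff_index_eq\<close>)
  finally show ?thesis by simp
qed

section \<open>Colourings of the loose cycle\<close>

text \<open>
  Since an edge has \<open>k\<close> positions and there are \<open>k\<close> colours, injectivity on an edge means that each colour occurs exactly once.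
\<close>
definition proper_colouring :: "nat list \<Rightarrow> bool" where
  "proper_colouring cs \<longleftrightarrow> length cs = c \<and> set cs \<subseteq> {..<k} \<and> (\<forall>j<s. inj_on (\<lambda>i. cs ! i) (cyc_edge j))"

lemma proper_colouring_bij:
  assumes "proper_colouring cs" "j < s"
  shows "bij_betw (\<lambda>i. cs ! i) (cyc_edge j) {..<k}"
proof -
  have "(\<lambda>i. cs ! i) ` cyc_edge j \<subseteq> {..<k}"
    using assms cyc_edge_subset[OF assms(2)] unfolding proper_colouring_def
    by (metis (no_types, lifting) image_subsetI lessThan_iff nth_mem subsetD)
  moreover have "card ((\<lambda>i. cs ! i) ` cyc_edge j) = k"
    using assms card_cyc_edge by (simp add: proper_colouring_def card_image)
  ultimately have "(\<lambda>i. cs ! i) ` cyc_edge j = {..<k}"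
    by (intro card_subset_eq) auto
  then show ?thesis using assms by (simp add: bij_betw_def proper_colouring_def)
qed

text \<open>
  Only the joints lie in two edges. Once they are coloured so that consecutive ones differ, the inner positions
  of each edge can take the remaining \<open>k - 2\<close> colours in any order.
\<close>
lemma colouring_from_joints:
  assumes "\<And>j. j < s \<Longrightarrow> \<gamma> j < k" "\<And>j. j < s \<Longrightarrow> \<gamma> j \<noteq> \<gamma> (succ j)"
  obtains cs where "proper_colouring cs" "\<And>j. j < s \<Longrightarrow> cs ! (j * (k - 1)) = \<gamma> j"
proof -
  have "\<exists>\<beta>. bij_betw \<beta> {1..<k - 1} ({..<k} - {\<gamma> j, \<gamma> (succ j)})" if "j < s" for j
  proof (rule finite_same_card_bij)
    have "card ({..<k} - {\<gamma> j, \<gamma> (succ j)}) = k - 2"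
      using assms[OF that] assms(1)[OF succ_less, of j] by (subst card_Diff_subset) auto
    then show "card {1..<k - 1} = card ({..<k} - {\<gamma> j, \<gamma> (succ j)})" by simp
  qed auto
  then obtain \<beta> where \<beta>: "\<And>j. j < s \<Longrightarrow> bij_betw (\<beta> j) {1..<k - 1} ({..<k} - {\<gamma> j, \<gamma> (succ j)})" by metis
  define f where "f i = (if i mod (k - 1) = 0 then \<gamma> (i div (k - 1)) else \<beta> (i div (k - 1)) (i mod (k - 1)))" for i
  define cs where "cs = map f [0..<c]"
  have m: "k - 1 > 0" using k by simp
  have inner: "f i \<in> {..<k} - {\<gamma> j, \<gamma> (succ j)}" if "j < s" "i div (k - 1) = j" "i mod (k - 1) \<noteq> 0" for i j
  proof -
    have "i mod (k - 1) \<in> {1..<k - 1}" using that m by (simp add: Suc_leI)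
    then have "\<beta> j (i mod (k - 1)) \<in> {..<k} - {\<gamma> j, \<gamma> (succ j)}" by (rule bij_betwE[OF \<beta>[OF that(1)], rule_format])
    then show ?thesis using that(2,3) by (simp only: f_def if_False)
  qed
  have fk: "f i < k" if "i < c" for i
    using inner[OF index_div[OF that] refl] assms(1)[OF index_div[OF that]] by (auto simp: f_def)
  have "inj_on f (cyc_edge j)" if j: "j < s" for j
  proof (rule inj_onI)
    have j': "f (succ j * (k - 1)) = \<gamma> (succ j)" using m by (simp add: f_def)
    have jj: "f (j * (k - 1)) = \<gamma> j" using m by (simp add: f_def)
    have cas: "x = succ j * (k - 1) \<or> x = j * (k - 1) \<or> (x div (k - 1) = j \<and> x mod (k - 1) \<noteq> 0)" if "x \<in> cyc_edge j" for x
    proof -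
      have "x = x div (k - 1) * (k - 1)" if "x mod (k - 1) = 0"
        using div_mult_mod_eq[of x "k - 1"] that by linarith
      then show ?thesis using that unfolding cyc_edge_def by blast
    qed
    fix x y assume xy: "x \<in> cyc_edge j" "y \<in> cyc_edge j" "f x = f y"
    have ne: "\<gamma> j \<noteq> \<gamma> (succ j)" using assms(2)[OF j] .
    show "x = y"
    proof (cases "x div (k - 1) = j \<and> x mod (k - 1) \<noteq> 0 \<and> y div (k - 1) = j \<and> y mod (k - 1) \<noteq> 0")
      case True
      then have "\<beta> j (x mod (k - 1)) = \<beta> j (y mod (k - 1))" using xy(3) by (simp add: f_def)
      moreover have "x mod (k - 1) \<in> {1..<k - 1}" "y mod (k - 1) \<in> {1..<k - 1}" using True m by auto
      ultimately have "x mod (k - 1) = y mod (k - 1)"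
        using \<beta>[OF j] by (meson bij_betw_def inj_onD)
      then show ?thesis using True by (metis div_mult_mod_eq)
    next
      case False
      then show ?thesis using cas[OF xy(1)] cas[OF xy(2)] inner[OF j, of x] inner[OF j, of y] j' jj ne xy(3) by auto
    qed
  qed
  then have "proper_colouring cs"
    unfolding proper_colouring_def
    using fk cyc_edge_subset by (auto simp: cs_def inj_on_def subset_iff)
  moreover have "cs ! (j * (k - 1)) = \<gamma> j" if "j < s" for j
    using that m by (simp add: cs_def f_def c_def)
  ultimately show ?thesis using that by blast
qed

lemma card_evens: "card {j. j < n \<and> even j} = (n + 1) div (2::nat)"
proof (induction n)
  case (Suc n)
  have "{j. j < Suc n \<and> even j} = (if even n then insert n {j. j < n \<and> even j} else {j. j < n \<and> even j})"
    by (auto simp: less_Suc_eq)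
  then show ?case using Suc by (auto simp: card_insert_if)
qed auto

text \<open>
  Give colour \<open>0\<close> to the odd joints. The position of colour \<open>0\<close> in the edge \<open>j\<close> lies in block \<open>j\<close> unless the next joint has colour
  \<open>0\<close>, that is, unless \<open>j + 1\<close> is odd modulo \<open>s\<close>. So the positions of colour \<open>0\<close> correspond to the even indices below \<open>s\<close>.
\<close>
lemma balanced_colouring:
  obtains cs where "proper_colouring cs" "card {i. i < c \<and> cs ! i = 0} = (s + 1) div 2"
proof -
  define \<gamma> :: "nat \<Rightarrow> nat" where "\<gamma> j = (if odd j then 0 else if j + 1 = s then 2 else 1)" for j
  have "\<gamma> j < k" for j using k by (auto simp: \<gamma>_def)
  moreover have "\<gamma> j \<noteq> \<gamma> (succ j)" if "j < s" for j
    using that s by (cases "j + 1 = s") (auto simp: \<gamma>_def)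
  ultimately obtain cs where cs: "proper_colouring cs" "\<And>j. j < s \<Longrightarrow> cs ! (j * (k - 1)) = \<gamma> j"
    using colouring_from_joints[of \<gamma>] by blast
  let ?Z = "{i. i < c \<and> cs ! i = 0}"
  let ?f = "\<lambda>i. succ (i div (k - 1))"
  have m: "k - 1 > 0" using k by simp
  have edge: "i \<in> cyc_edge (i div (k - 1))" for i by (simp add: cyc_edge_def)
  have bij: "bij_betw (\<lambda>i. cs ! i) (cyc_edge j) {..<k}" if "j < s" for j
    using proper_colouring_bij[OF cs(1) that] .
  have "bij_betw ?f ?Z {j. j < s \<and> even j}"
    unfolding bij_betw_def
  proof
    show "inj_on ?f ?Z"
    proof (rule inj_onI)
      fix x y assume "x \<in> ?Z" "y \<in> ?Z" "?f x = ?f y"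
      then have xy: "x < c" "y < c" "cs ! x = 0" "cs ! y = 0" "?f x = ?f y" by simp_all
      then have "x div (k - 1) = y div (k - 1)"
        using inj_succ index_div by (metis inj_onD lessThan_iff)
      then show "x = y" using edge[of x] edge[of y] bij[OF index_div[OF xy(1)]] xy
        by (metis bij_betw_def inj_onD)
    qed
    show "?f ` ?Z = {j. j < s \<and> even j}"
    proof (intro equalityI subsetI)
      fix j assume "j \<in> ?f ` ?Z"
      then obtain i where i: "i < c" "cs ! i = 0" "j = ?f i" by auto
      let ?j = "i div (k - 1)"
      have "even j"
      proof (rule ccontr)
        assume "odd j"
        then have "cs ! (j * (k - 1)) = 0" using cs(2)[of j] succ_less i(3) by (simp add: \<gamma>_def)
        moreover have "j * (k - 1) \<in> cyc_edge ?j" using i(3) by (simp add: cyc_edge_def)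
        ultimately have "i = j * (k - 1)"
          using edge[of i] bij[OF index_div[OF i(1)]] i(2) by (metis bij_betw_def inj_onD)
        then have "i div (k - 1) = j" using m by (metis nonzero_mult_div_cancel_right less_irrefl)
        then show False using succ_neq[OF index_div[OF i(1)]] i(3) by metis
      qed
      then show "j \<in> {j. j < s \<and> even j}" using i succ_less by auto
    next
      fix j assume j: "j \<in> {j. j < s \<and> even j}"
      then obtain j' where j': "j' < s" "succ j' = j" using succ_surj by blast
      have "0 \<in> (\<lambda>i. cs ! i) ` cyc_edge j'" using bij[OF j'(1)] k by (simp add: bij_betw_def)
      then obtain i where i: "i \<in> cyc_edge j'" "cs ! i = 0" by auto
      have "cs ! (j * (k - 1)) \<noteq> 0" using j cs(2)[of j] by (auto simp: \<gamma>_def)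
      then have "i div (k - 1) = j'" using i j' by (auto simp: cyc_edge_def)
      then show "j \<in> ?f ` ?Z" using i j' cyc_edge_subset[OF j'(1)] by (intro image_eqI[of _ _ i]) auto
    qed
  qed
  then have "card ?Z = (s + 1) div 2" by (rule bij_betw_same_card[THEN trans, OF _ card_evens])
  then show ?thesis using that cs by blast
qed

text \<open>
  The positions \<open>p\<close> and \<open>p'\<close> are inner positions of the two edges through the joint \<open>0\<close>. Exchanging the colours \<open>0\<close> and \<open>1\<close> on these three
  positions will give a second colouring with one more vertex of colour \<open>0\<close>. For this the neighbouring joints must avoid the
  colours \<open>0\<close> and \<open>1\<close>, which is impossible exactly if \<open>k = s = 3\<close>: there the three joints need three different colours.
\<close>
lemma swap_colouring:
  assumes "\<not> (k = 3 \<and> s = 3)"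
  obtains cs p p' where "proper_colouring cs" "cs ! 0 = 0" "cs ! p = 1" "cs ! p' = 1"
    "p < c" "p' < c" "p div (k - 1) = 0" "p mod (k - 1) \<noteq> 0" "p' div (k - 1) = s - 1" "p' mod (k - 1) \<noteq> 0"
proof -
  define \<gamma> :: "nat \<Rightarrow> nat" where "\<gamma> j =
      (if j = 0 then 0
       else if k > 3 then (if odd j then 2 else 3)
       else if even s then (if odd j then 2 else 0)
       else if j = s - 2 then 1 else if j = s - 1 then 2 else if odd j then 2 else 0)" for j
  have "\<gamma> j < k" for j using k by (auto simp: \<gamma>_def)
  moreover have "\<gamma> j \<noteq> \<gamma> (succ j)" if "j < s" for j
  proof (cases "j + 1 = s")
    case True
    then show ?thesis using s assms k by (auto simp: \<gamma>_def)
  next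
    case False
    then have "succ j = j + 1" using that by simp
    have "s \<ge> 5" if "odd s" "s \<noteq> 3"
    proof -
      have "s \<noteq> 2" "s \<noteq> 4" using that by auto
      then show ?thesis using s that by linarith
    qed
    then consider (a) "k > 3" | (b) "k = 3" "even s" | (c) "k = 3" "odd s" "s \<ge> 5"
      using k assms by (metis le_neq_implies_less)
    then have "\<gamma> j \<noteq> \<gamma> (j + 1)"
    proof cases
      case a
      then show ?thesis by (cases "j = 0") (simp_all add: \<gamma>_def)
    next
      case b
      then show ?thesis by (cases "j = 0") (simp_all add: \<gamma>_def)
    next
      case c
      then have "even (s - 3)" "s - 3 \<noteq> s - 2" "s - 3 \<noteq> s - 1" "s - 3 \<noteq> 0" "s - 3 + 1 = s - 2" "s - 2 + 1 = s - 1"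
        "s - 2 \<noteq> s - 1" "s - 2 \<noteq> 0" "s - 1 \<noteq> 0" by simp_all
      note e = this
      consider "j = 0" | "j = s - 3" | "j = s - 2" | "j \<noteq> 0" "j + 1 \<noteq> s - 2" "j \<noteq> s - 2" "j \<noteq> s - 1"
        using that False c by linarith
      then show ?thesis
      proof cases
        case 1
        have "1 \<noteq> s - 2" "1 \<noteq> s - 1" using c by linarith+
        then show ?thesis using 1 c by (simp add: \<gamma>_def)
      next
        case 2
        show ?thesis unfolding 2 e(5) using e(1-4,8) c by (simp add: \<gamma>_def)
      next
        case 3
        show ?thesis unfolding 3 e(6) using e(7-9) c by (simp add: \<gamma>_def)
      next
        case 4
        have "j + 1 \<noteq> s - 1" using 4(3) c by linarith
        then show ?thesis using 4 c by (simp add: \<gamma>_def)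
      qed
    qed
    with \<open>succ j = j + 1\<close> show ?thesis by simp
  qed
  ultimately obtain cs where cs: "proper_colouring cs" "\<And>j. j < s \<Longrightarrow> cs ! (j * (k - 1)) = \<gamma> j"
    using colouring_from_joints[of \<gamma>] by blast
  have ex: "\<exists>p. p < c \<and> cs ! p = 1 \<and> p div (k - 1) = j \<and> p mod (k - 1) \<noteq> 0"
    if j: "j < s" "\<gamma> j \<noteq> 1" "\<gamma> (succ j) \<noteq> 1" for j
  proof -
    have "1 \<in> (\<lambda>i. cs ! i) ` cyc_edge j"
      using proper_colouring_bij[OF cs(1) j(1)] k by (simp add: bij_betw_def)
    then obtain i where i: "i \<in> cyc_edge j" "cs ! i = 1" by auto
    have h: "cs ! (j * (k - 1)) \<noteq> 1" "cs ! (succ j * (k - 1)) \<noteq> 1"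
      using cs(2)[OF j(1)] cs(2)[OF succ_less, of j] j by simp_all
    then have "i div (k - 1) = j" using i by (auto simp: cyc_edge_def)
    moreover have "i mod (k - 1) \<noteq> 0"
    proof
      assume "i mod (k - 1) = 0"
      then have "i = j * (k - 1)" using \<open>i div (k - 1) = j\<close> by (metis add.right_neutral div_mult_mod_eq)
      then show False using h i by simp
    qed
    ultimately show ?thesis using i cyc_edge_subset[OF j(1)] by blast
  qed
  have "0 < s" "succ 0 = 1" "s - 1 < s" "succ (s - 1) = 0" using s by auto
  moreover have "\<gamma> 0 \<noteq> 1" "\<gamma> 1 \<noteq> 1" "\<gamma> (s - 1) \<noteq> 1" using s assms k by (auto simp: \<gamma>_def)
  ultimately obtain p p' where p: "p < c" "cs ! p = 1" "p div (k - 1) = 0" "p mod (k - 1) \<noteq> 0"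
    "p' < c" "cs ! p' = 1" "p' div (k - 1) = s - 1" "p' mod (k - 1) \<noteq> 0"
    using ex[of 0] ex[of "s - 1"] by auto
  moreover have "cs ! 0 = 0" using cs(2)[of 0] s by (simp add: \<gamma>_def)
  ultimately show ?thesis using that cs(1) by blast
qed

lemma colour_at_index:
  assumes "proper_colouring cs" "j < s" "l < k"
  obtains i where "i \<in> cyc_edge j" "cs ! i = l"
proof -
  have "l \<in> (\<lambda>i. cs ! i) ` cyc_edge j"
    using proper_colouring_bij[OF assms(1,2)] assms(3) by (simp add: bij_betw_def)
  then show ?thesis using that by blast
qed

text \<open>
  The map \<open>pos\<close> sends the positions of the cycle to positions of the pattern \<open>ys\<close> with the same colour. As an edge sees
  every colour once, its image is a transversal, and \<open>fs\<close> lists this transversal by colours.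
\<close>
lemma transversal_along_edge:
  assumes cs: "proper_colouring cs" and j: "j < s" and T: "transversals_in k D cs' ys"
    and pos: "\<And>i. i \<in> cyc_edge j \<Longrightarrow> pos i < length cs' \<and> cs' ! pos i = cs ! i"
  obtains fs where "fs \<in> D" "length fs = k" "set fs = (\<lambda>i. ys ! pos i) ` cyc_edge j"
    "\<forall>i\<in>cyc_edge j. fs ! (cs ! i) = ys ! pos i"
    "set (tl fs) = (\<lambda>i. ys ! pos i) ` {i \<in> cyc_edge j. cs ! i \<noteq> 0}"
proof -
  let ?e = "cyc_edge j"
  define inv where "inv = the_inv_into ?e (\<lambda>i. cs ! i)"
  have inj: "inj_on (\<lambda>i. cs ! i) ?e" and im: "(\<lambda>i. cs ! i) ` ?e = {..<k}"
    using proper_colouring_bij[OF cs j] by (auto simp: bij_betw_def)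
  have inv1: "inv (cs ! i) = i" if "i \<in> ?e" for i
    unfolding inv_def using the_inv_into_f_f[OF inj that] .
  have inv2: "cs ! inv l = l" "inv l \<in> ?e" if "l < k" for l
    unfolding inv_def using f_the_inv_into_f[OF inj] the_inv_into_into[OF inj _ order_refl] im that by simp_all
  have less: "cs ! i < k" if "i \<in> ?e" for i using im that by blast
  define fs where "fs = map (\<lambda>l. ys ! pos (inv l)) [0..<k]"
  have nth: "fs ! l = ys ! pos (inv l)" if "l < k" for l using that by (simp add: fs_def)
  have len: "length fs = k" by (simp add: fs_def)
  have "\<forall>l<k. pos (inv l) < length cs' \<and> cs' ! pos (inv l) = l"
    using inv2 pos by simp
  then have "fs \<in> D" using T[unfolded transversals_in_def, rule_format, of "\<lambda>l. pos (inv l)"]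
    unfolding fs_def by blast
  moreover have ci: "fs ! (cs ! i) = ys ! pos i" if "i \<in> ?e" for i
    using nth[OF less[OF that]] inv1[OF that] by simp
  moreover have "set fs = (\<lambda>i. ys ! pos i) ` ?e"
  proof (intro equalityI subsetI)
    fix x assume "x \<in> set fs"
    then obtain l where "l < k" "x = fs ! l" using len by (metis in_set_conv_nth)
    then show "x \<in> (\<lambda>i. ys ! pos i) ` ?e" using nth inv2 by auto
  next
    fix x assume "x \<in> (\<lambda>i. ys ! pos i) ` ?e"
    then obtain i where "i \<in> ?e" "x = ys ! pos i" by blast
    then show "x \<in> set fs" using ci[of i] less[of i] len by (metis nth_mem)
  qed
  moreover have "set (tl fs) = (\<lambda>i. ys ! pos i) ` {i \<in> ?e. cs ! i \<noteq> 0}"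
  proof (intro equalityI subsetI)
    fix x assume "x \<in> set (tl fs)"
    then obtain l where "l < k - 1" "x = fs ! Suc l" using len by (metis in_set_conv_nth length_tl nth_tl)
    then have "Suc l < k" "x = fs ! Suc l" by auto
    then show "x \<in> (\<lambda>i. ys ! pos i) ` {i \<in> ?e. cs ! i \<noteq> 0}"
      using nth inv2 by (intro image_eqI[of _ _ "inv (Suc l)"]) auto
  next
    fix x assume "x \<in> (\<lambda>i. ys ! pos i) ` {i \<in> ?e. cs ! i \<noteq> 0}"
    then obtain i where i: "i \<in> ?e" "cs ! i \<noteq> 0" "x = ys ! pos i" by blast
    then have "x = tl fs ! (cs ! i - 1)" "cs ! i - 1 < length (tl fs)"
      using ci[OF i(1)] less[OF i(1)] len by (auto simp: nth_tl)
    then show "x \<in> set (tl fs)" by (metis nth_mem)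
  qed
  ultimately show ?thesis using that[of fs] len by blast
qed

lemma index_edge: "i \<in> cyc_edge (i div (k - 1))"
  by (simp add: cyc_edge_def)

lemma tile_from_transversals:
  assumes cs: "proper_colouring cs" and T: "transversals_in k D cs' ys"
    and D: "\<And>fs. fs \<in> D \<Longrightarrow> set fs \<in> E"
    and pos: "\<And>i. i < c \<Longrightarrow> pos i < length cs' \<and> cs' ! pos i = cs ! i"
    and dist: "distinct (map (\<lambda>i. ys ! pos i) [0..<c])"
  shows "tile E (map (\<lambda>i. ys ! pos i) [0..<c])"
  unfolding tile_def
proof (intro conjI dist allI impI)
  fix j assume j: "j < s"
  then have "pos i < length cs' \<and> cs' ! pos i = cs ! i" if "i \<in> cyc_edge j" for i
    using pos cyc_edge_subset[OF j] that by blast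
  then obtain fs where "fs \<in> D" "set fs = (\<lambda>i. ys ! pos i) ` cyc_edge j"
    using transversal_along_edge[OF cs j T, of pos] by metis
  moreover have "(\<lambda>i. map (\<lambda>i. ys ! pos i) [0..<c] ! i) ` cyc_edge j = (\<lambda>i. ys ! pos i) ` cyc_edge j"
    using cyc_edge_subset[OF j] by (intro image_cong refl) auto
  ultimately show "(\<lambda>i. map (\<lambda>i. ys ! pos i) [0..<c] ! i) ` cyc_edge j \<in> E" using D by metis
qed simp

text \<open>This keeps \<open>k - 1\<close> from being rewritten to \<open>k - Suc 0\<close>.\<close>

declare One_nat_def [simp del]

section \<open>Almost perfect tilings\<close>

lemma cyc_edge_split_zero:
  assumes "proper_colouring cs" "j < s" "i0 \<in> cyc_edge j" "cs ! i0 = 0"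
  shows "cyc_edge j = insert i0 {i \<in> cyc_edge j. cs ! i \<noteq> 0}"
proof -
  have "x = i0" if "x \<in> cyc_edge j" "cs ! x = 0" for x
    using assms that unfolding proper_colouring_def by (metis (mono_tags, lifting) inj_onD)
  then show ?thesis using assms(3) by blast
qed

definition host :: "real \<Rightarrow> 'a set \<Rightarrow> 'a set set \<Rightarrow> bool" where
  "host b V E \<longleftrightarrow> finite V \<and> (\<forall>e\<in>E. e \<subseteq> V \<and> card e = k) \<and>
     (\<forall>S\<subseteq>V. card S = k - 1 \<longrightarrow> b * real (card V) \<le> real (card {v \<in> V. insert v S \<in> E}))"

definition tile_family :: "'a set set \<Rightarrow> 'a set \<Rightarrow> 'a list set \<Rightarrow> bool" where
  "tile_family E V P \<longleftrightarrow> P \<subseteq> {ys \<in> tuples c V. tile E ys} \<and> pairwise (\<lambda>xs ys. set xs \<inter> set ys = {}) P"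

lemma tile_family_disjoint:
  "tile_family E V P \<Longrightarrow> xs \<in> P \<Longrightarrow> ys \<in> P \<Longrightarrow> xs \<noteq> ys \<Longrightarrow> set xs \<inter> set ys = {}"
  by (simp add: tile_family_def pairwise_def)

lemma tile_nonempty: "tile E ys \<Longrightarrow> set ys \<noteq> {}"
  using c_pos unfolding tile_def by (metis list.size(3) less_irrefl set_empty2)

lemma hd_in_tile: "tile E ys \<Longrightarrow> hd ys \<in> set ys"
  using tile_nonempty by (metis hd_in_set set_empty2)

lemma tile_family_tileable:
  assumes "finite V" "tile_family E V P"
  shows "tileable E (\<Union> (set ` P))"
proof -
  have "finite P" using assms finite_subset[of P "tuples c V"] by (auto simp: tile_family_def)
  moreover have "disjoint_family_on set P"
    using assms(2) by (auto simp: tile_family_def pairwise_def disjoint_family_on_def)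
  ultimately show ?thesis
    using assms(2) by (intro tileable_UN) (auto simp: tile_family_def intro: tileable_tile)
qed

lemma card_tile_family_le:
  assumes "finite V" "tile_family E V P" shows "finite P" "card P * c \<le> card V"
proof -
  show fP: "finite P" using assms finite_subset[of P "tuples c V"] by (auto simp: tile_family_def)
  have "disjoint_family_on set P"
    using assms(2) by (auto simp: tile_family_def pairwise_def disjoint_family_on_def)
  then have "card (\<Union> (set ` P)) = (\<Sum>ys\<in>P. card (set ys))"
    using fP by (intro card_UN_disjoint) (auto simp: disjoint_family_on_def)
  also have "\<dots> = (\<Sum>ys\<in>P. c)"
    using assms(2) by (intro sum.cong refl card_tile) (auto simp: tile_family_def)
  also have "\<dots> = card P * c" by simp
  also have "card (\<Union> (set ` P)) \<le> card V"
    using assms by (intro card_mono) (auto simp: tile_family_def tuples_def)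
  ultimately show "card P * c \<le> card V" by simp
qed

text \<open>
  Replacing the tiles \<open>R\<close> by the tiles \<open>N\<close> keeps the family disjoint, so it cannot gain.
\<close>
lemma exchange_tiles:
  assumes fin: "finite V" and P: "tile_family E V P" and max: "\<And>P'. tile_family E V P' \<Longrightarrow> card P' \<le> card P"
    and R: "R \<subseteq> P" and N: "tile_family E V N"
    and new: "\<And>ys. ys \<in> N \<Longrightarrow> set ys \<subseteq> (V - \<Union> (set ` P)) \<union> \<Union> (set ` R)"
  shows "card N \<le> card R"
proof -
  have disj: "set zs \<inter> set ys = {}" if "zs \<in> N" "ys \<in> P - R" for zs ys
  proof -
    have "set ys \<inter> set xs = {}" if "xs \<in> R" for xs
    proof (rule tile_family_disjoint[OF P])
      show "ys \<in> P" "xs \<in> P" "ys \<noteq> xs" using \<open>ys \<in> P - R\<close> \<open>xs \<in> R\<close> R by auto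
    qed
    then show ?thesis using new[OF that(1)] that(2) by blast
  qed
  have "tile_family E V (P - R \<union> N)"
    unfolding tile_family_def
  proof
    show "P - R \<union> N \<subseteq> {ys \<in> tuples c V. tile E ys}" using P N unfolding tile_family_def by blast
    show "pairwise (\<lambda>xs ys. set xs \<inter> set ys = {}) (P - R \<union> N)"
    proof (rule pairwiseI)
      fix xs ys assume a: "xs \<in> P - R \<union> N" "ys \<in> P - R \<union> N" "xs \<noteq> ys"
      show "set xs \<inter> set ys = {}"
      proof (cases "xs \<in> N"; cases "ys \<in> N")
        assume "xs \<notin> N" "ys \<notin> N"
        then show ?thesis using a tile_family_disjoint[OF P, of xs ys] by simp
      next
        assume "xs \<in> N" "ys \<in> N"
        then show ?thesis using a tile_family_disjoint[OF N, of xs ys] by simp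
      next
        assume "xs \<in> N" "ys \<notin> N"
        then show ?thesis using a disj[of xs ys] by simp
      next
        assume "xs \<notin> N" "ys \<in> N"
        then show ?thesis using a disj[of ys xs] by (simp add: inf_commute)
      qed
    qed
  qed
  then have "card (P - R \<union> N) \<le> card P" by (rule max)
  moreover have fP: "finite P" "finite N" using card_tile_family_le[OF fin] P N by auto
  moreover have "(P - R) \<inter> N = {}"
  proof -
    have "zs \<notin> P - R" if "zs \<in> N" for zs
    proof
      assume "zs \<in> P - R"
      moreover have "set zs \<noteq> {}" using N that unfolding tile_family_def by (intro tile_nonempty[of E]) auto
      ultimately show False using disj[OF that, of zs] by simp
    qed
    then show ?thesis by blast
  qed
  ultimately have "card (P - R) + card N \<le> card P" by (metis card_Un_disjoint finite_Diff)
  moreover have "card (P - R) = card P - card R" "card R \<le> card P"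
    using R fP card_mono finite_subset[OF R] by (auto simp: card_Diff_subset)
  ultimately show ?thesis by linarith
qed

text \<open>
  Blow up the dense set \<open>D\<close> of ordered edges along a proper colouring of the cycle.
\<close>
lemma many_tiles_in_dense_subset:
  fixes E :: "'a set set"
  assumes fin: "finite V" "V \<noteq> {}" and \<theta>: "\<theta> > 0"
    and D: "D \<subseteq> {fs \<in> tuples k V. set fs \<subseteq> U \<and> set fs \<in> E}"
    and dense: "\<theta> * real (card V) ^ k \<le> real (card D)"
    and n: "2 * (real c)\<^sup>2 \<le> \<theta> ^ 2 ^ c * real (card V)"
  shows "\<theta> ^ 2 ^ c / 2 * real (card V) ^ c \<le> real (card {ys \<in> tuples c V. tile E ys \<and> set ys \<subseteq> U})"
proof -
  obtain cs where cs: "proper_colouring cs" using balanced_colouring by blast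
  then have len: "length cs = c" "set cs \<subseteq> {..<k}" by (auto simp: proper_colouring_def)
  have "D \<subseteq> tuples k V" "cs \<noteq> []" using D len c_pos by auto
  then have "\<theta> ^ 2 ^ c / 2 * real (card V) ^ c
      \<le> real (card {ys \<in> tuples c V. transversals_in k D cs ys \<and> distinct ys})"
    using blow_up_distinct[OF fin _ \<theta> dense len(2)] n unfolding len(1) by blast
  also have "\<dots> \<le> real (card {ys \<in> tuples c V. tile E ys \<and> set ys \<subseteq> U})"
    unfolding of_nat_le_iff
  proof (intro card_mono subsetI)
    fix ys assume "ys \<in> {ys \<in> tuples c V. transversals_in k D cs ys \<and> distinct ys}"
    then have ys: "ys \<in> tuples c V" "transversals_in k D cs ys" "distinct ys" by auto
    then have l: "length ys = c" by (simp add: tuples_def)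
    have e: "map (\<lambda>i. ys ! i) [0..<c] = ys" using map_nth[of ys] l by simp
    have "tile E (map (\<lambda>i. ys ! i) [0..<c])"
    proof (rule tile_from_transversals[OF cs ys(2)])
      show "distinct (map (\<lambda>i. ys ! i) [0..<c])" unfolding e by (rule ys(3))
    qed (use len D in auto)
    then have "tile E ys" unfolding e .
    moreover have "set ys \<subseteq> U"
    proof
      fix y assume "y \<in> set ys"
      then obtain i where i: "i < c" "y = ys ! i" using l by (metis in_set_conv_nth)
      have e: "i' < length cs \<and> cs ! i' = cs ! i'" if "i' \<in> cyc_edge (i div (k - 1))" for i'
        using cyc_edge_subset[OF index_div[OF i(1)]] that len by auto
      obtain fs where "fs \<in> D" "length fs = k" "set fs = (\<lambda>i. ys ! i) ` cyc_edge (i div (k - 1))"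
        "\<forall>i'\<in>cyc_edge (i div (k - 1)). fs ! (cs ! i') = ys ! i'"
        "set (tl fs) = (\<lambda>i. ys ! i) ` {i' \<in> cyc_edge (i div (k - 1)). cs ! i' \<noteq> 0}"
        by (rule transversal_along_edge[OF cs index_div[OF i(1)] ys(2) e])
      then show "y \<in> U" using D index_edge i(2) by blast
    qed
    ultimately show "ys \<in> {ys \<in> tuples c V. tile E ys \<and> set ys \<subseteq> U}" using ys(1) by simp
  qed (use fin in auto)
  finally show ?thesis .
qed

text \<open>
  All intermediate results hold for hosts that are large in terms of the constants only; the bound is kept implicit.
\<close>
definition for_large_hosts :: "real \<Rightarrow> ('a set \<Rightarrow> 'a set set \<Rightarrow> bool) \<Rightarrow> bool" where
  "for_large_hosts b P \<longleftrightarrow> (\<exists>N. \<forall>V E. host b V E \<longrightarrow> N \<le> card V \<longrightarrow> P V E)"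

lemma for_large_hostsI:
  assumes "eventually C sequentially" "\<And>V E. host b V E \<Longrightarrow> C (card V) \<Longrightarrow> P V E"
  shows "for_large_hosts b P"
  using assms unfolding for_large_hosts_def eventually_sequentially by meson

lemma for_large_hosts_combine:
  assumes P: "for_large_hosts b P1" "for_large_hosts b P2" and C: "eventually C sequentially"
    and R: "\<And>V E. host b V E \<Longrightarrow> P1 V E \<Longrightarrow> P2 V E \<Longrightarrow> C (card V) \<Longrightarrow> R V E"
  shows "for_large_hosts b R"
proof -
  obtain N1 N2 N3 where "\<And>V E. host b V E \<Longrightarrow> N1 \<le> card V \<Longrightarrow> P1 V E"
    "\<And>V E. host b V E \<Longrightarrow> N2 \<le> card V \<Longrightarrow> P2 V E" "\<And>n. N3 \<le> n \<Longrightarrow> C n"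
    using P C unfolding for_large_hosts_def eventually_sequentially by blast
  then show ?thesis
    unfolding for_large_hosts_def using R by (intro exI[of _ "max N1 (max N2 N3)"]) simp
qed

text \<open>
  By \<open>tile_cover_number\<close> and \<open>balanced_colouring\<close> this is the smallest number of vertices that meet all edges of the loose cycle.
\<close>
definition \<tau> :: nat where "\<tau> = (s + 1) div 2"

text \<open>
  Double counting of the edges that consist of a tuple \<open>us\<close> in the uncovered set \<open>U\<close> and one further vertex. Each \<open>us\<close> has at least
  \<open>(\<tau> / c + \<eta>) * n\<close> neighbours. At most \<open>\<tau> * n / c\<close> of them are accounted for by tiles with at most \<open>\<tau>\<close> neighbours,
  so the excess of \<open>\<eta> * n\<close> has to lie in \<open>U\<close> or in tiles with more than \<open>\<tau>\<close> neighbours.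
\<close>
lemma many_rich_pairs:
  fixes E :: "'a set set"
  assumes host: "host (real \<tau> / real c + \<eta>) V E" and P: "tile_family E V P"
    and U: "U = V - \<Union> (set ` P)" and X: "X = {us \<in> tuples (k - 1) V. set us \<subseteq> U \<and> distinct us}"
    and EU: "EU = {fs \<in> tuples k V. set fs \<subseteq> U \<and> set fs \<in> E}"
  shows "real (card X) * (\<eta> * real (card V)) \<le> real (card EU) +
    real c * real (card (SIGMA us:X. {T \<in> P. \<tau> < card {v \<in> set T. insert v (set us) \<in> E}}))"
proof -
  let ?n = "real (card V)"
  let ?rich = "\<lambda>us. {T \<in> P. \<tau> < card {v \<in> set T. insert v (set us) \<in> E}}"
  let ?a = "\<lambda>us. {v \<in> U. insert v (set us) \<in> E}"
  have fin: "finite V" and E: "\<And>e. e \<in> E \<Longrightarrow> e \<subseteq> V \<and> card e = k" using host by (auto simp: host_def)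
  have fP: "finite P" "card P * c \<le> card V" using card_tile_family_le[OF fin P] by auto
  have fX: "finite X" using fin by (simp add: X)
  have fU: "finite U" and UV: "U \<subseteq> V" using fin U by auto
  have c0: "real c > 0" using c_pos by linarith
  have deg: "\<eta> * ?n \<le> real (card (?a us)) + real c * real (card (?rich us))" if us: "us \<in> X" for us
  proof -
    let ?N = "{v \<in> V. insert v (set us) \<in> E}"
    let ?d = "\<lambda>T. card {v \<in> set T. insert v (set us) \<in> E}"
    have "set us \<subseteq> V" "card (set us) = k - 1" using us by (auto simp: X tuples_def distinct_card)
    then have 1: "(real \<tau> / real c + \<eta>) * ?n \<le> real (card ?N)" using host by (simp add: host_def)
    have "?N \<subseteq> ?a us \<union> (\<Union>T\<in>P. {v \<in> set T. insert v (set us) \<in> E})" using U by auto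
    then have "card ?N \<le> card (?a us \<union> (\<Union>T\<in>P. {v \<in> set T. insert v (set us) \<in> E}))"
      using fP fU by (intro card_mono) auto
    also have "\<dots> \<le> card (?a us) + card (\<Union>T\<in>P. {v \<in> set T. insert v (set us) \<in> E})" by (rule card_Un_le)
    also have "card (\<Union>T\<in>P. {v \<in> set T. insert v (set us) \<in> E}) \<le> (\<Sum>T\<in>P. ?d T)"
      by (rule card_UN_le[OF fP(1)])
    also have "\<dots> \<le> (\<Sum>T\<in>P. \<tau> + (if \<tau> < ?d T then c else 0))"
    proof (intro sum_mono)
      fix T assume "T \<in> P"
      then have "card (set T) = c" using P card_tile unfolding tile_family_def by blast
      then have "?d T \<le> c" by (metis (no_types, lifting) List.finite_set card_mono mem_Collect_eq subsetI)
      then show "?d T \<le> \<tau> + (if \<tau> < ?d T then c else 0)" by simp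
    qed
    also have "\<dots> = card P * \<tau> + card (?rich us) * c"
      using fP(1) by (simp add: sum.distrib sum.If_cases Int_def)
    finally have "real (card ?N) \<le> real (card (?a us) + (card P * \<tau> + card (?rich us) * c))"
      by (simp only: of_nat_le_iff)
    moreover have "real (card P) * real \<tau> \<le> ?n / real c * real \<tau>"
    proof (intro mult_right_mono)
      have "real (card P) * real c \<le> ?n" using fP(2) by (metis of_nat_le_iff of_nat_mult)
      then show "real (card P) \<le> ?n / real c" by (simp only: pos_le_divide_eq[OF c0])
    qed simp
    ultimately show ?thesis using 1 by (simp add: algebra_simps)
  qed
  have "real (card X) * (\<eta> * ?n) \<le> (\<Sum>us\<in>X. real (card (?a us)) + real c * real (card (?rich us)))"
    using sum_bounded_below[of X "\<eta> * ?n"] deg by simp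
  also have "\<dots> = real (\<Sum>us\<in>X. card (?a us)) + real c * real (\<Sum>us\<in>X. card (?rich us))"
    by (simp add: sum.distrib sum_distrib_left)
  also have "(\<Sum>us\<in>X. card (?rich us)) = card (SIGMA us:X. ?rich us)"
    using fX fP by (simp add: card_SigmaI)
  also have "(\<Sum>us\<in>X. card (?a us)) \<le> card EU"
  proof -
    have "(\<Sum>us\<in>X. card (?a us)) = card (SIGMA us:X. ?a us)" using fX fU by (simp add: card_SigmaI)
    also have "\<dots> \<le> card EU"
    proof (rule card_inj_on_le[of "\<lambda>(us, v). v # us"])
      show "(\<lambda>(us, v). v # us) ` (SIGMA us:X. ?a us) \<subseteq> EU"
        using k UV by (auto simp: X EU tuples_def)
      show "finite EU" using fin by (simp add: EU)
    qed (auto simp: inj_on_def)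
    finally show ?thesis .
  qed
  finally show ?thesis by simp
qed

text \<open>
  A tile is represented by its head, so that pairs of a tile and a tuple in \<open>U\<close> become \<open>k\<close>-tuples of vertices and can be blown up.
  The pattern has \<open>\<tau> + 1\<close> disjoint copies of the loose cycle, one for each position in \<open>Q\<close>, which share their \<open>\<tau>\<close>
  entries of colour \<open>0\<close>. These entries are heads of \<open>\<tau>\<close> tiles. The new copy for the position \<open>q\<close> takes from each of these tiles the
  vertex at position \<open>q\<close> as its vertices of colour \<open>0\<close>, and its other vertices from \<open>U\<close>. So \<open>\<tau>\<close> tiles are replaced by \<open>\<tau> + 1\<close>.
\<close>
lemma dense_exchange:
  fixes E :: "'a set set"
  assumes fin: "finite V" "V \<noteq> {}" and P: "tile_family E V P"
    and max: "\<And>P'. tile_family E V P' \<Longrightarrow> card P' \<le> card P"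
    and U: "U = V - \<Union> (set ` P)" and Q: "Q \<subseteq> {..<c}" "card Q = \<tau> + 1"
    and D: "D \<subseteq> {hd T # us | T us. T \<in> P \<and> us \<in> tuples (k - 1) V \<and> set us \<subseteq> U \<and> (\<forall>q\<in>Q. insert (T ! q) (set us) \<in> E)}"
    and \<theta>: "\<theta> > 0" "\<theta> * real (card V) ^ k \<le> real (card D)"
    and n: "2 * (real ((\<tau> + 1) * c)) ^ 2 \<le> \<theta> ^ 2 ^ ((\<tau> + 1) * c) * real (card V)"
  shows False
proof -
  let ?L = "(\<tau> + 1) * c"
  obtain cs where cs: "proper_colouring cs" "card {i. i < c \<and> cs ! i = 0} = \<tau>"
    using balanced_colouring unfolding \<tau>_def by metis
  then have len: "length cs = c" "set cs \<subseteq> {..<k}" by (auto simp: proper_colouring_def)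
  \<comment> \<open>The pattern for the position of \<open>Q\<close> with number \<open>q\<close> occupies \<open>q * c, \<dots>, q * c + c - 1\<close>; entries of colour \<open>0\<close> are read from the pattern with number \<open>0\<close> only.\<close>
  define cs' where "cs' = map (\<lambda>p. cs ! (p mod c)) [0..<?L]"
  have len': "length cs' = ?L" by (simp add: cs'_def)
  have "cs ! (p mod c) < k" for p using len c_pos by (metis lessThan_iff mod_less_divisor nth_mem subsetD)
  then have cs'_sub: "set cs' \<subseteq> {..<k}" by (auto simp: cs'_def)
  have posL: "q * c + i < ?L" if "q \<le> \<tau>" "i < c" for q i
  proof -
    have "q * c + i < (q + 1) * c" unfolding add_mult_distrib mult_1 using \<open>i < c\<close> by (rule add_strict_left_mono)
    also have "\<dots> \<le> ?L" using that by (intro mult_right_mono) auto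
    finally show ?thesis .
  qed
  have cs'_nth: "cs' ! (q * c + i) = cs ! i" if "q \<le> \<tau>" "i < c" for q i
    using posL[OF that] that by (simp add: cs'_def)
  have DV: "D \<subseteq> tuples k V"
  proof
    fix fs assume "fs \<in> D"
    then obtain T us where "fs = hd T # us" "T \<in> P" "us \<in> tuples (k - 1) V" using D by blast
    moreover from this have "hd T \<in> set T" "set T \<subseteq> V"
      using P hd_in_tile by (auto simp: tile_family_def tuples_def)
    ultimately show "fs \<in> tuples k V" using k by (auto simp: tuples_def)
  qed
  have "cs' \<noteq> []" using len' c_pos by auto
  then have "\<theta> ^ 2 ^ ?L / 2 * real (card V) ^ ?L
      \<le> real (card {ys \<in> tuples ?L V. transversals_in k D cs' ys \<and> distinct ys})"
    using blow_up_distinct[OF fin DV \<theta> cs'_sub] n unfolding len' by blast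
  moreover have "\<theta> ^ 2 ^ ?L / 2 * real (card V) ^ ?L > 0" using \<theta> fin by (simp add: card_gt_0_iff)
  ultimately have "card {ys \<in> tuples ?L V. transversals_in k D cs' ys \<and> distinct ys} \<noteq> 0" by linarith
  then have "{ys \<in> tuples ?L V. transversals_in k D cs' ys \<and> distinct ys} \<noteq> {}" by (metis card.empty)
  then obtain ys where ys: "transversals_in k D cs' ys" "distinct ys" "length ys = ?L"
    by (auto simp: tuples_def)
  define pos where "pos q i = (if cs ! i = 0 then i else q * c + i)" for q i :: nat
  have pos: "pos q i < length cs' \<and> cs' ! pos q i = cs ! i" if "q \<le> \<tau>" "i < c" for q i
    using posL[OF that] posL[of 0 i] cs'_nth[OF that] cs'_nth[of 0 i] that len' by (auto simp: pos_def)
  have edge: "\<exists>T us. T \<in> P \<and> set us \<subseteq> U \<and> (\<forall>q\<in>Q. insert (T ! q) (set us) \<in> E)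
      \<and> (\<forall>i\<in>cyc_edge j. cs ! i = 0 \<longrightarrow> hd T = ys ! i)
      \<and> set us = (\<lambda>i. ys ! (q * c + i)) ` {i \<in> cyc_edge j. cs ! i \<noteq> 0}" if "q \<le> \<tau>" "j < s" for q j
  proof -
    have posj: "pos q i < length cs' \<and> cs' ! pos q i = cs ! i" if "i \<in> cyc_edge j" for i
      using pos[OF \<open>q \<le> \<tau>\<close>] cyc_edge_subset[OF \<open>j < s\<close>] that by auto
    obtain fs where fs: "fs \<in> D" "length fs = k" "set fs = (\<lambda>i. ys ! pos q i) ` cyc_edge j"
      "\<forall>i\<in>cyc_edge j. fs ! (cs ! i) = ys ! pos q i"
      "set (tl fs) = (\<lambda>i. ys ! pos q i) ` {i \<in> cyc_edge j. cs ! i \<noteq> 0}"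
      by (rule transversal_along_edge[OF cs(1) \<open>j < s\<close> ys(1) posj])
    from fs(1) D obtain T us where T: "fs = hd T # us" "T \<in> P" "set us \<subseteq> U" "\<forall>q\<in>Q. insert (T ! q) (set us) \<in> E"
      by blast
    have "hd T = ys ! i" if "i \<in> cyc_edge j" "cs ! i = 0" for i
      using fs(4) that T(1) by (auto simp: pos_def)
    moreover have "set us = (\<lambda>i. ys ! (q * c + i)) ` {i \<in> cyc_edge j. cs ! i \<noteq> 0}"
      using fs(5) T(1) by (auto simp: pos_def)
    ultimately show ?thesis using T by blast
  qed
  have "\<exists>T. T \<in> P \<and> hd T = ys ! i" if "i < c" "cs ! i = 0" for i
    using edge[OF _ index_div[OF that(1)], of 0] index_edge[of i] that by blast
  then obtain Tl where Tl: "\<And>i. i < c \<Longrightarrow> cs ! i = 0 \<Longrightarrow> Tl i \<in> P \<and> hd (Tl i) = ys ! i" by metis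
  have Ttile: "tile E T \<and> T \<in> tuples c V" if "T \<in> P" for T using P that by (auto simp: tile_family_def)
  have hd_in: "hd T \<in> set T" if "T \<in> P" for T using Ttile[OF that] hd_in_tile by blast
  have same: "T = T'" if "T \<in> P" "T' \<in> P" "x \<in> set T" "x \<in> set T'" for T T' x
    using tile_family_disjoint[OF P that(1,2)] that(3,4) by blast
  have inU: "ys ! (q * c + i) \<in> U" if "q \<le> \<tau>" "i < c" "cs ! i \<noteq> 0" for q i
    using edge[OF that(1) index_div[OF that(2)]] index_edge[of i] that(3) by blast
  obtain Qf where Qf: "bij_betw Qf {0..<\<tau> + 1} Q"
    using ex_bij_betw_nat_finite[of Q] Q finite_subset by (metis finite_lessThan)
  have Qf_in: "Qf q \<in> Q \<and> Qf q < c" if "q \<le> \<tau>" for q using bij_betwE[OF Qf] Q(1) that by (auto simp: subset_iff)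
  define g where "g q i = (if cs ! i = 0 then Tl i ! Qf q else ys ! (q * c + i))" for q i
  have g0: "g q i \<in> set (Tl i)" if "q \<le> \<tau>" "i < c" "cs ! i = 0" for q i
    using Ttile[of "Tl i"] Tl[OF that(2,3)] Qf_in[OF that(1)] that(3) by (auto simp: g_def tuples_def)
  have g_inj: "q = q' \<and> i = i'"
    if q: "q \<le> \<tau>" "q' \<le> \<tau>" and i: "i < c" "i' < c" and eq: "g q i = g q' i'" for q q' i i'
  proof (cases "cs ! i = 0"; cases "cs ! i' = 0")
    assume z: "cs ! i = 0" "cs ! i' = 0"
    have T: "Tl i = Tl i'" using same[of "Tl i" "Tl i'" "g q i"] Tl g0 q i z eq by metis
    then have "ys ! i = ys ! i'" using Tl[OF i(1) z(1)] Tl[OF i(2) z(2)] by simp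
    then have ii: "i = i'" using ys(2,3) posL[of 0] i by (simp add: nth_eq_iff_index_eq)
    have "Tl i ! Qf q = Tl i ! Qf q'" using eq z ii by (simp add: g_def)
    moreover have "distinct (Tl i)" "length (Tl i) = c" using Ttile[of "Tl i"] Tl[OF i(1) z(1)] by (auto simp: tile_def)
    ultimately have "Qf q = Qf q'" using Qf_in[OF q(1)] Qf_in[OF q(2)] by (simp add: nth_eq_iff_index_eq)
    then have "q = q'" using inj_onD[OF bij_betw_imp_inj_on[OF Qf], of q q'] q by simp
    then show ?thesis using ii by simp
  next
    assume z: "cs ! i \<noteq> 0" "cs ! i' \<noteq> 0"
    then have "ys ! (q * c + i) = ys ! (q' * c + i')" using eq by (simp add: g_def)
    then have e: "q * c + i = q' * c + i'" using ys(2,3) posL q i by (simp add: nth_eq_iff_index_eq)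
    then have "(q * c + i) div c = (q' * c + i') div c" "(q * c + i) mod c = (q' * c + i') mod c" by simp_all
    then show ?thesis using i by simp
  next
    assume z: "cs ! i = 0" "cs ! i' \<noteq> 0"
    then have "g q i \<in> \<Union> (set ` P)" using g0[OF q(1) i(1) z(1)] Tl[OF i(1) z(1)] by blast
    moreover have "g q' i' \<in> U" using inU[OF q(2) i(2) z(2)] z(2) by (simp add: g_def)
    ultimately show ?thesis using U eq by auto
  next
    assume z: "cs ! i \<noteq> 0" "cs ! i' = 0"
    then have "g q' i' \<in> \<Union> (set ` P)" using g0[OF q(2) i(2) z(2)] Tl[OF i(2) z(2)] by blast
    moreover have "g q i \<in> U" using inU[OF q(1) i(1) z(1)] z(1) by (simp add: g_def)
    ultimately show ?thesis using U eq by auto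
  qed
  define zs where "zs q = map (g q) [0..<c]" for q
  have tile_zs: "tile E (zs q)" if q: "q \<le> \<tau>" for q
    unfolding tile_def
  proof (intro conjI allI impI)
    show "distinct (zs q)" using g_inj[OF q q] by (auto simp: zs_def distinct_map inj_on_def)
    show "length (zs q) = c" by (simp add: zs_def)
    fix j assume j: "j < s"
    obtain T us where T: "T \<in> P" "\<forall>q\<in>Q. insert (T ! q) (set us) \<in> E" "\<forall>i\<in>cyc_edge j. cs ! i = 0 \<longrightarrow> hd T = ys ! i"
      "set us = (\<lambda>i. ys ! (q * c + i)) ` {i \<in> cyc_edge j. cs ! i \<noteq> 0}"
      using edge[OF q j] by blast
    obtain i0 where i0: "i0 \<in> cyc_edge j" "cs ! i0 = 0" using colour_at_index[OF cs(1) j, of 0] k by auto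
    have i0c: "i0 < c" using cyc_edge_subset[OF j] i0 by auto
    have T0: "Tl i0 = T" using same[of "Tl i0" T "hd T"] Tl[OF i0c i0(2)] T(1,3) i0 hd_in by metis
    have "(\<lambda>i. zs q ! i) ` cyc_edge j = g q ` cyc_edge j"
      using cyc_edge_subset[OF j] by (intro image_cong) (auto simp: zs_def)
    also have "\<dots> = g q ` insert i0 {i \<in> cyc_edge j. cs ! i \<noteq> 0}"
      using cyc_edge_split_zero[OF cs(1) j i0] by (rule arg_cong)
    also have "g q ` insert i0 {i \<in> cyc_edge j. cs ! i \<noteq> 0} = insert (T ! Qf q) (set us)"
      unfolding T(4) using i0 T0 by (auto simp: g_def)
    finally have im: "(\<lambda>i. zs q ! i) ` cyc_edge j = insert (T ! Qf q) (set us)" .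
    show "(\<lambda>i. zs q ! i) ` cyc_edge j \<in> E" unfolding im using T(2) Qf_in[OF q] by blast
  qed
  have set_zs: "set (zs q) \<subseteq> U \<union> \<Union> (set ` Tl ` {i. i < c \<and> cs ! i = 0})" if "q \<le> \<tau>" for q
  proof
    fix x assume "x \<in> set (zs q)"
    then obtain i where i: "i < c" "x = g q i" by (auto simp: zs_def)
    show "x \<in> U \<union> \<Union> (set ` Tl ` {i. i < c \<and> cs ! i = 0})"
      using g0[OF that i(1)] inU[OF that i(1)] i by (cases "cs ! i = 0") (auto simp: g_def)
  qed
  have R: "Tl ` {i. i < c \<and> cs ! i = 0} \<subseteq> P" using Tl by blast
  have zs_disj: "set (zs q) \<inter> set (zs q') = {}" if "q \<le> \<tau>" "q' \<le> \<tau>" "q \<noteq> q'" for q q'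
    using g_inj[OF that(1,2)] that(3) by (auto simp: zs_def)
  have N: "tile_family E V (zs ` {..\<tau>})"
    unfolding tile_family_def
  proof
    have "\<Union> (set ` Tl ` {i. i < c \<and> cs ! i = 0}) \<subseteq> \<Union> (set ` P)"
      using R by (intro Union_mono image_mono)
    also have "\<dots> \<subseteq> V" using P by (auto simp: tile_family_def tuples_def)
    finally have "set (zs q) \<subseteq> V" if "q \<le> \<tau>" for q
      using set_zs[OF that] U by blast
    moreover have "length (zs q) = c" for q by (simp add: zs_def)
    ultimately show "zs ` {..\<tau>} \<subseteq> {ys \<in> tuples c V. tile E ys}"
      using tile_zs by (intro image_subsetI) (simp add: tuples_def)
    show "pairwise (\<lambda>xs ys. set xs \<inter> set ys = {}) (zs ` {..\<tau>})"
      using zs_disj by (auto simp: pairwise_def)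
  qed
  have "card (zs ` {..\<tau>}) \<le> card (Tl ` {i. i < c \<and> cs ! i = 0})"
  proof (rule exchange_tiles[OF fin(1) P max R N])
    fix xs assume "xs \<in> zs ` {..\<tau>}"
    then show "set xs \<subseteq> (V - \<Union> (set ` P)) \<union> \<Union> (set ` Tl ` {i. i < c \<and> cs ! i = 0})"
      using set_zs U by blast
  qed
  also have "\<dots> \<le> \<tau>" using card_image_le[of "{i. i < c \<and> cs ! i = 0}" Tl] cs(2) by simp
  finally have "card (zs ` {..\<tau>}) \<le> \<tau>" .
  moreover have "inj_on zs {..\<tau>}"
  proof (rule inj_onI)
    fix q q' assume "q \<in> {..\<tau>}" "q' \<in> {..\<tau>}" "zs q = zs q'"
    then show "q = q'" using zs_disj[of q q'] tile_nonempty[OF tile_zs, of q] by force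
  qed
  ultimately show False by (simp add: card_image)
qed

text \<open>
  In a tiling with as many tiles as possible, a large uncovered set \<open>U\<close> would have few edges and therefore, by \<open>many_rich_pairs\<close>, many pairs of
  a tile and a tuple in \<open>U\<close> with more than \<open>\<tau>\<close> adjacencies. For a dense set of these pairs the adjacencies occur at the same
  \<open>\<tau> + 1\<close> positions of the tile, which contradicts \<open>dense_exchange\<close>.
\<close>
lemma almost_perfect_tiling:
  assumes \<eta>: "\<eta> > 0" and \<gamma>: "\<gamma> > 0"
  shows "for_large_hosts (real \<tau> / real c + \<eta>)
    (\<lambda>(V :: 'a set) E. \<exists>X\<subseteq>V. tileable E X \<and> real (card (V - X)) \<le> \<gamma> * real (card V))"
proof -
  define \<theta>1 where "\<theta>1 = \<eta> * \<gamma> ^ (k - 1) / 4"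
  define \<theta>2 where "\<theta>2 = \<theta>1 / (real c * 2 ^ c)"
  have c0: "real c > 0" using c_pos by linarith
  have pos1: "\<theta>1 > 0" using \<eta> \<gamma> by (simp add: \<theta>1_def)
  have "real c * 2 ^ c > 0" using c0 by (intro mult_pos_pos) auto
  then have pos: "\<theta>1 > 0" "\<theta>2 > 0" unfolding \<theta>2_def using pos1 by (auto intro: divide_pos_pos)
  have "eventually (\<lambda>n. 1 \<le> real n \<and> 2 * (real c)\<^sup>2 \<le> \<theta>1 ^ 2 ^ c * real n
     \<and> 2 * (real (k - 1))\<^sup>2 \<le> \<gamma> ^ (k - 1) * real n
     \<and> 2 * (real ((\<tau> + 1) * c))\<^sup>2 \<le> \<theta>2 ^ 2 ^ ((\<tau> + 1) * c) * real n) sequentially" (is "eventually ?C _")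
    by (intro eventually_conj eventually_le_mult) (use pos \<gamma> eventually_le_mult[of 1 1] in auto)
  then show ?thesis
  proof (rule for_large_hostsI)
    fix V :: "'a set" and E
    assume host: "host (real \<tau> / real c + \<eta>) V E" and nC: "?C (card V)"
    define n where "n = card V"
    note cV = n_def[symmetric]
    have n: "?C n" using nC cV by simp
    have V0: "V \<noteq> {}" using n cV by auto
    have fin: "finite V" using host by (simp add: host_def)
    have "tile_family E V {}" by (simp add: tile_family_def)
    moreover have "card P < Suc (card V)" if "tile_family E V P" for P
      using card_tile_family_le(2)[OF fin that] c_pos
      by (metis le_imp_less_Suc le_trans mult.right_neutral mult_le_mono2 One_nat_def Suc_leI)
    ultimately obtain P where P: "tile_family E V P" and max: "\<And>P'. tile_family E V P' \<Longrightarrow> card P' \<le> card P"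
      using ex_has_greatest_nat[of "tile_family E V" "{}" card "Suc (card V)"] by (metis less_imp_le)
    define U where "U = V - \<Union> (set ` P)"
    define X where "X = {us \<in> tuples (k - 1) V. set us \<subseteq> U \<and> distinct us}"
    define EU where "EU = {fs \<in> tuples k V. set fs \<subseteq> U \<and> set fs \<in> E}"
    have sub: "\<Union> (set ` P) \<subseteq> V" using P by (auto simp: tile_family_def tuples_def)
    have "real (card U) \<le> \<gamma> * real n"
    proof (rule ccontr)
      assume "\<not> ?thesis"
      then have large: "\<gamma> * real n \<le> real (card U)" by simp
      have sparse: "real (card EU) < \<theta>1 * real n ^ k"
      proof (rule ccontr)
        assume "\<not> ?thesis"
        then have "\<theta>1 ^ 2 ^ c / 2 * real n ^ c \<le> real (card {ys \<in> tuples c V. tile E ys \<and> set ys \<subseteq> U})"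
          using many_tiles_in_dense_subset[OF fin V0 pos(1), of EU U E] n cV unfolding EU_def by auto
        moreover have "\<theta>1 ^ 2 ^ c / 2 * real n ^ c > 0" using pos n by simp
        ultimately have "card {ys \<in> tuples c V. tile E ys \<and> set ys \<subseteq> U} \<noteq> 0" by linarith
        then have "{ys \<in> tuples c V. tile E ys \<and> set ys \<subseteq> U} \<noteq> {}" by (metis card.empty)
        then obtain ys where ys: "tile E ys" "set ys \<subseteq> U" by blast
        have "tile_family E V {ys}" using ys U_def by (auto simp: tile_family_def tile_def tuples_def)
        then have "card {ys} \<le> card ({} :: 'a list set)"
          using exchange_tiles[OF fin P max, of "{}" "{ys}"] ys U_def by auto
        then show False by simp
      qed
      have X: "\<gamma> ^ (k - 1) / 2 * real n ^ (k - 1) \<le> real (card X)"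
      proof -
        have "(\<gamma> * real n) ^ (k - 1) \<le> real (card U) ^ (k - 1)"
          using large \<gamma> by (intro power_mono) auto
        also have "\<dots> = real (card (tuples (k - 1) U))" using fin U_def by (simp add: card_tuples)
        finally have "\<gamma> ^ (k - 1) / 2 * real (card V) ^ (k - 1)
            \<le> real (card {us \<in> tuples (k - 1) U. distinct us \<and> set us \<inter> {} = {}})"
          using fin n k cV U_def by (intro card_clean_tuples) (auto simp: tuples_def power_mult_distrib)
        also have "{us \<in> tuples (k - 1) U. distinct us \<and> set us \<inter> {} = {}} = X"
          unfolding X_def U_def by (auto simp: tuples_def)
        finally show ?thesis using cV by simp
      qed
      define B where "B = (SIGMA us:X. {T \<in> P. \<tau> < card {v \<in> set T. insert v (set us) \<in> E}})"
      define F where "F Q = {(us, T). us \<in> X \<and> T \<in> P \<and> card Q = \<tau> + 1 \<and> (\<forall>q\<in>Q. insert (T ! q) (set us) \<in> E)}" for Q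
      have "real (card X) * (\<eta> * real n) \<le> real (card EU) + real c * real (card B)"
        using many_rich_pairs[OF host P U_def X_def EU_def] cV unfolding B_def by simp
      moreover have "\<gamma> ^ (k - 1) / 2 * real n ^ (k - 1) * (\<eta> * real n) \<le> real (card X) * (\<eta> * real n)"
        using X \<eta> by (intro mult_right_mono) auto
      moreover have "\<gamma> ^ (k - 1) / 2 * real n ^ (k - 1) * (\<eta> * real n) = 2 * \<theta>1 * real n ^ k"
        using k by (cases k) (auto simp: \<theta>1_def)
      ultimately have B: "\<theta>1 * real n ^ k \<le> real c * real (card B)" using sparse by linarith
      have fP: "finite P" using card_tile_family_le[OF fin P] by simp
      have fX: "finite X" using fin by (simp add: X_def)
      have finF: "finite (F Q)" for Q
        by (rule finite_subset[of _ "X \<times> P"]) (use fX fP in \<open>auto simp: F_def\<close>)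
      have "B \<subseteq> (\<Union>Q\<in>Pow {..<c}. F Q)"
      proof
        fix x assume "x \<in> B"
        then obtain us T where x: "x = (us, T)" "us \<in> X" "T \<in> P" "\<tau> < card {v \<in> set T. insert v (set us) \<in> E}"
          unfolding B_def by blast
        have T: "distinct T" "length T = c" using P x(3) by (auto simp: tile_family_def tile_def)
        let ?I = "{i. i < c \<and> insert (T ! i) (set us) \<in> E}"
        have "{v \<in> set T. insert v (set us) \<in> E} \<subseteq> (\<lambda>i. T ! i) ` ?I"
          using T by (auto simp: in_set_conv_nth)
        then have "card {v \<in> set T. insert v (set us) \<in> E} \<le> card ((\<lambda>i. T ! i) ` ?I)"
          by (intro card_mono) auto
        also have "\<dots> \<le> card ?I" by (intro card_image_le) auto
        finally have "\<tau> + 1 \<le> card ?I" using x(4) by simp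
        then obtain Q where "Q \<subseteq> ?I" "card Q = \<tau> + 1" "finite Q" by (rule obtain_subset_with_card_n)
        then show "x \<in> (\<Union>Q\<in>Pow {..<c}. F Q)" using x by (intro UN_I[of Q]) (auto simp: F_def)
      qed
      then obtain Q where Q: "Q \<subseteq> {..<c}" "real (card B) \<le> real (card (Pow {..<c})) * real (card (F Q))"
        using pigeonhole_card[of "Pow {..<c}" B F] finF by auto
      define D where "D = (\<lambda>(us, T). hd T # us) ` F Q"
      have "inj_on (\<lambda>(us, T). hd T # us) (F Q)"
      proof (rule inj_onI, clarsimp simp: F_def)
        fix T T' assume "T \<in> P" "T' \<in> P" "hd T = hd T'"
        moreover from this have "tile E T" "tile E T'" using P by (auto simp: tile_family_def)
        ultimately show "T = T'" using tile_family_disjoint[OF P, of T T'] hd_in_tile by (metis disjoint_iff)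
      qed
      then have cD: "card D = card (F Q)" unfolding D_def by (rule card_image)
      have "\<theta>1 * real n ^ k \<le> real c * (2 ^ c * real (card D))"
        using B Q(2) c0 cD by (simp add: card_Pow) (meson mult_left_mono of_nat_0_le_iff order_trans)
      then have dense: "\<theta>2 * real (card V) ^ k \<le> real (card D)"
        using c0 cV by (simp add: \<theta>2_def field_simps)
      have "real (card D) > 0" using dense pos n cV by (smt (verit) mult_pos_pos zero_less_power)
      then have "F Q \<noteq> {}" unfolding D_def by auto
      then have cQ: "card Q = \<tau> + 1" by (auto simp: F_def)
      have "D \<subseteq> {hd T # us | T us. T \<in> P \<and> us \<in> tuples (k - 1) V \<and> set us \<subseteq> U \<and> (\<forall>q\<in>Q. insert (T ! q) (set us) \<in> E)}"
        unfolding D_def F_def X_def by auto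
      then show False using dense_exchange[OF fin V0 P max U_def Q(1) cQ _ pos(2) dense] n cV by simp
    qed
    then show "\<exists>X\<subseteq>V. tileable E X \<and> real (card (V - X)) \<le> \<gamma> * real (card V)"
      using tile_family_tileable[OF fin P] sub U_def cV by blast
  qed
qed

section \<open>Reachable pairs of vertices\<close>

text \<open>
  The lists that let \<open>x\<close> and \<open>y\<close> take each other's place in a tiling. If there are \<open>\<theta> * n ^ q\<close> of them, the two vertices are called
  reachable from each other below.
\<close>
definition reach :: "'a set set \<Rightarrow> 'a set \<Rightarrow> nat \<Rightarrow> 'a \<Rightarrow> 'a \<Rightarrow> 'a list set" where
  "reach E V q x y = {zs \<in> tuples q V. distinct zs \<and> x \<notin> set zs \<and> y \<notin> set zs \<and>
     tileable E (insert x (set zs)) \<and> tileable E (insert y (set zs))}"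

definition link :: "'a set set \<Rightarrow> 'a set \<Rightarrow> 'a \<Rightarrow> 'a list set" where
  "link E V x = {us \<in> tuples (k - 1) V. insert x (set us) \<in> E}"

lemma finite_reach: "finite V \<Longrightarrow> finite (reach E V q x y)"
  by (simp add: reach_def)

lemma finite_link: "finite V \<Longrightarrow> finite (link E V x)"
  by (simp add: link_def)

lemma reach_commute: "reach E V q x y = reach E V q y x"
  by (auto simp: reach_def)

lemma hostD:
  assumes "host b V E"
  shows "finite V" "\<And>e. e \<in> E \<Longrightarrow> e \<subseteq> V \<and> card e = k"
    "\<And>S. S \<subseteq> V \<Longrightarrow> card S = k - 1 \<Longrightarrow> b * real (card V) \<le> real (card {v \<in> V. insert v S \<in> E})"
  using assms by (auto simp: host_def)

lemma card_link_set:
  assumes "host b V E" "us \<in> link E V x"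
  shows "distinct us" "set us \<subseteq> V" "card (set us) = k - 1" "x \<notin> set us" "length us = k - 1"
proof -
  have l: "length us = k - 1" "set us \<subseteq> V" using assms(2) by (auto simp: link_def tuples_def)
  have "card (insert x (set us)) = k" using assms by (auto simp: link_def host_def)
  moreover have "card (set us) \<le> k - 1" using l card_length by metis
  ultimately have *: "x \<notin> set us \<and> card (set us) = k - 1" using k by (auto simp: card_insert_if split: if_splits)
  then show "x \<notin> set us" "card (set us) = k - 1" by auto
  show "distinct us" using * l by (simp add: card_distinct)
  show "set us \<subseteq> V" "length us = k - 1" using l by auto
qed

lemma card_reach_ge:
  assumes fin: "finite V" and Z: "Z \<subseteq> tuples q V" "\<theta> * real (card V) ^ q \<le> real (card Z)" and q: "q > 0"
    and n: "2 * ((real q)\<^sup>2 + real q * 2) \<le> \<theta> * real (card V)"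
    and tiles: "\<And>zs. zs \<in> Z \<Longrightarrow> distinct zs \<Longrightarrow> x \<notin> set zs \<Longrightarrow> y \<notin> set zs \<Longrightarrow>
      tileable E (insert x (set zs)) \<and> tileable E (insert y (set zs))"
  shows "\<theta> / 2 * real (card V) ^ q \<le> real (card (reach E V q x y))"
proof -
  have "real (card {x, y}) \<le> 2" by (simp add: card_insert_if)
  then have "real q * real (card {x, y}) \<le> real q * 2" by (rule mult_left_mono) simp
  then have "2 * ((real q)\<^sup>2 + real q * real (card {x, y})) \<le> \<theta> * real (card V)"
    by (intro order_trans[OF mult_left_mono[OF add_left_mono] n]) auto
  then have "\<theta> / 2 * real (card V) ^ q \<le> real (card {zs \<in> Z. distinct zs \<and> set zs \<inter> {x, y} = {}})"
    using fin by (intro card_clean_tuples Z q) auto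
  also have "\<dots> \<le> real (card (reach E V q x y))"
    unfolding of_nat_le_iff
  proof (intro card_mono finite_reach fin subsetI)
    fix zs assume "zs \<in> {zs \<in> Z. distinct zs \<and> set zs \<inter> {x, y} = {}}"
    then show "zs \<in> reach E V q x y" using tiles[of zs] Z(1) unfolding reach_def by blast
  qed
  finally show ?thesis .
qed

text \<open>
  Blow up the edges that extend tuples of the common link by one vertex. In a resulting copy of the cycle, the vertices of colour \<open>0\<close> are only
  required to form edges with tuples of the common link, and \<open>x\<close> and \<open>y\<close> do so, too. Hence one vertex of colour \<open>0\<close> can be
  replaced by either of them.
\<close>
lemma reach_if_common_link:
  assumes host: "host b V E" and xy: "x \<in> V" "y \<in> V" and b: "b > 0" and \<epsilon>: "\<epsilon> > 0"
    and common: "\<epsilon> * real (card V) ^ (k - 1) \<le> real (card (link E V x \<inter> link E V y))"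
    and n: "2 * ((real (c - 1))\<^sup>2 + real (c - 1) * 2) \<le> (\<epsilon> * b) ^ 2 ^ c * real (card V)"
  shows "(\<epsilon> * b) ^ 2 ^ c / 2 * real (card V) ^ (c - 1) \<le> real (card (reach E V (c - 1) x y))"
proof -
  let ?n = "real (card V)"
  have fin: "finite V" and V0: "V \<noteq> {}" using hostD(1)[OF host] xy by auto
  have n0: "?n > 0" using fin V0 by (simp add: card_gt_0_iff)
  have c1: "c - 1 > 0" using mult_le_mono[OF s m2] by (simp add: c_def)
  let ?C = "link E V x \<inter> link E V y"
  define D where "D = (\<lambda>(us, v). v # us) ` (SIGMA us:?C. {v \<in> V. insert v (set us) \<in> E})"
  have "real (card ?C) * (b * ?n) \<le> real (card D)"
    unfolding D_def
  proof (rule card_Sigma_image_ge)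
    fix us assume "us \<in> ?C"
    then show "finite {v \<in> V. insert v (set us) \<in> E} \<and> b * ?n \<le> real (card {v \<in> V. insert v (set us) \<in> E})"
      using card_link_set[OF host, of us x] hostD(3)[OF host, of "set us"] fin by auto
  qed (use finite_link[OF fin] in \<open>auto simp: inj_on_def\<close>)
  moreover have "\<epsilon> * ?n ^ (k - 1) * (b * ?n) \<le> real (card ?C) * (b * ?n)"
    using common b by (intro mult_right_mono) auto
  moreover have "\<epsilon> * ?n ^ (k - 1) * (b * ?n) = (\<epsilon> * b) * ?n ^ k" using k by (cases k) auto
  ultimately have dense: "(\<epsilon> * b) * ?n ^ k \<le> real (card D)" by linarith
  have DE: "set fs \<in> E \<and> insert x (set (tl fs)) \<in> E \<and> insert y (set (tl fs)) \<in> E" if "fs \<in> D" for fs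
    using that by (auto simp: D_def link_def)
  have DV: "D \<subseteq> tuples k V" using k by (auto simp: D_def link_def tuples_def)
  obtain cs where cs: "proper_colouring cs" using balanced_colouring by blast
  then have len: "length cs = c" "set cs \<subseteq> {..<k}" by (auto simp: proper_colouring_def)
  obtain i0 where i0: "i0 \<in> cyc_edge 0" "cs ! i0 = 0" using colour_at_index[OF cs, of 0 0] s k by auto
  have i0c: "i0 < c" using cyc_edge_subset[of 0] i0 s by auto
  let ?Y = "{ys \<in> tuples (length cs) V. transversals_in k D cs ys}"
  let ?r = "\<lambda>xs. take i0 xs @ drop (Suc i0) xs"
  have "(\<epsilon> * b) ^ 2 ^ c * ?n ^ c \<le> real (card ?Y)"
    using blow_up[OF fin V0 DV _ dense len(2)] \<epsilon> b len by simp
  also have "\<dots> \<le> real (card V * card (?r ` ?Y))"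
    unfolding of_nat_le_iff using fin i0c len by (intro card_drop_coordinate) auto
  finally have "?n * ((\<epsilon> * b) ^ 2 ^ c * ?n ^ (c - 1)) \<le> ?n * real (card (?r ` ?Y))"
    using c_pos by (cases c) (auto simp: mult_ac)
  then have dense': "(\<epsilon> * b) ^ 2 ^ c * ?n ^ (c - 1) \<le> real (card (?r ` ?Y))"
    using n0 by (simp only: mult_le_cancel_left_pos)
  have Zsub: "?r ` ?Y \<subseteq> tuples (c - 1) V" using drop_coordinate_tuples i0c len by fastforce
  show ?thesis
  proof (rule card_reach_ge[OF fin Zsub dense' c1 n])
    fix zs assume "zs \<in> ?r ` ?Y" and zs: "distinct zs" "x \<notin> set zs" "y \<notin> set zs"
    then obtain ys where ys: "ys \<in> tuples c V" "transversals_in k D cs ys" "zs = ?r ys" using len by auto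
    have l: "length ys = c" using ys by (simp add: tuples_def)
    have tile: "tileable E (insert w (set zs))" if w: "w \<in> {x, y}" for w
    proof -
      let ?ws = "ys[i0 := w]"
      have e: "?ws = take i0 ys @ w # drop (Suc i0) ys" using l i0c by (simp add: upd_conv_take_nth_drop)
      have "distinct ?ws" "set ?ws = insert w (set zs)" using zs w unfolding e ys(3) by auto
      moreover have "(\<lambda>i. ?ws ! i) ` cyc_edge j \<in> E" if j: "j < s" for j
      proof -
        have pos: "i < length cs \<and> cs ! i = cs ! i" if "i \<in> cyc_edge j" for i
          using cyc_edge_subset[OF j] that len by auto
        obtain fs where fs: "fs \<in> D" "length fs = k" "set fs = (\<lambda>i. ys ! i) ` cyc_edge j"
          "\<forall>i\<in>cyc_edge j. fs ! (cs ! i) = ys ! i" "set (tl fs) = (\<lambda>i. ys ! i) ` {i \<in> cyc_edge j. cs ! i \<noteq> 0}"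
          by (rule transversal_along_edge[OF cs j ys(2) pos])
        show ?thesis
        proof (cases "i0 \<in> cyc_edge j")
          case False
          then have "(\<lambda>i. ?ws ! i) ` cyc_edge j = set fs" unfolding fs(3) by (intro image_cong) (metis nth_list_update_neq)+
          then show ?thesis using DE[OF fs(1)] by simp
        next
          case True
          have "cyc_edge j = insert i0 {i \<in> cyc_edge j. cs ! i \<noteq> 0}"
            by (rule cyc_edge_split_zero[OF cs j True i0(2)])
          then have "(\<lambda>i. ?ws ! i) ` cyc_edge j = (\<lambda>i. ?ws ! i) ` insert i0 {i \<in> cyc_edge j. cs ! i \<noteq> 0}" by simp
          also have "\<dots> = insert w (set (tl fs))"
            unfolding fs(5) image_insert using i0 i0c l by (intro arg_cong2[of _ _ _ _ insert] image_cong) (auto simp: nth_list_update)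
          finally show ?thesis using DE[OF fs(1)] w by auto
        qed
      qed
      ultimately show ?thesis using tileable_tile[of E ?ws] l unfolding tile_def by simp
    qed
    then show "tileable E (insert x (set zs)) \<and> tileable E (insert y (set zs))" by simp
  qed
qed

definition partners :: "'a set set \<Rightarrow> 'a set \<Rightarrow> real \<Rightarrow> 'a \<Rightarrow> 'a set" where
  "partners E V \<epsilon> x = {y \<in> V. \<epsilon> * real (card V) ^ (k - 1) \<le> real (card (link E V x \<inter> link E V y))}"

lemma card_link_ge:
  assumes host: "host b V E" and x: "x \<in> V" and b: "b > 0" and r: "r \<ge> 0"
    and r': "r * real (card V) ^ (k - 2) \<le> real (card {ws \<in> tuples (k - 2) V. distinct ws \<and> set ws \<inter> {x} = {}})"
  shows "r * b * real (card V) ^ (k - 1) \<le> real (card (link E V x))"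
proof -
  let ?n = "real (card V)"
  let ?W = "{ws \<in> tuples (k - 2) V. distinct ws \<and> set ws \<inter> {x} = {}}"
  let ?F = "\<lambda>ws. {v \<in> V. insert v (insert x (set ws)) \<in> E}"
  have fin: "finite V" using hostD[OF host] by simp
  have "real (card ?W) * (b * ?n) \<le> real (card ((\<lambda>(ws, v). v # ws) ` (SIGMA ws:?W. ?F ws)))"
  proof (rule card_Sigma_image_ge)
    fix ws assume "ws \<in> ?W"
    then have "insert x (set ws) \<subseteq> V" "card (insert x (set ws)) = k - 1"
      using x k by (auto simp: tuples_def distinct_card)
    then show "finite (?F ws) \<and> b * ?n \<le> real (card (?F ws))"
      using hostD(3)[OF host] fin by simp
  qed (use fin in \<open>auto simp: inj_on_def\<close>)
  also have "\<dots> \<le> real (card (link E V x))"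
    unfolding of_nat_le_iff using k
    by (intro card_mono finite_link fin) (auto simp: link_def tuples_def insert_commute)
  finally have "real (card ?W) * (b * ?n) \<le> real (card (link E V x))" .
  moreover have "r * ?n ^ (k - 2) * (b * ?n) \<le> real (card ?W) * (b * ?n)"
    using r' b by (intro mult_right_mono) auto
  moreover have "r * ?n ^ (k - 2) * (b * ?n) = r * b * ?n ^ (k - 1)"
  proof -
    have "k - 1 = Suc (k - 2)" using k by simp
    then show ?thesis by simp
  qed
  ultimately show ?thesis by linarith
qed

text \<open>
  The tuples in the link of \<open>x\<close> have at least \<open>b * n\<close> neighbours each, so the links of the other vertices meet the link of \<open>x\<close> in a
  density of \<open>b\<^sup>2 / 2\<close> on average.
\<close>
lemma card_partners_ge:
  assumes host: "host b V E" and x: "x \<in> V" and b: "b > 0"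
    and n: "2 * ((real (k - 2))\<^sup>2 + real (k - 2)) \<le> real (card V)"
  shows "b\<^sup>2 / 4 * real (card V) \<le> real (card (partners E V (b\<^sup>2 / 4) x))"
proof -
  let ?n = "real (card V)"
  let ?P = "partners E V (b\<^sup>2 / 4) x"
  have fin: "finite V" using hostD[OF host] by simp
  have n0: "?n > 0" using fin x by (auto simp: card_gt_0_iff)
  have "1 / 2 * ?n ^ (k - 2) \<le> real (card {ws \<in> tuples (k - 2) V. distinct ws \<and> set ws \<inter> {x} = {}})"
    using fin n k by (intro card_clean_tuples) (auto simp: card_tuples)
  then have L: "1 / 2 * b * ?n ^ (k - 1) \<le> real (card (link E V x))"
    by (intro card_link_ge[OF host x b]) auto
  let ?S = "(SIGMA us:link E V x. {y \<in> V. insert y (set us) \<in> E})"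
  have "real (card (link E V x)) * (b * ?n) \<le> real (card ((\<lambda>p. p) ` ?S))"
  proof (rule card_Sigma_image_ge)
    fix us assume "us \<in> link E V x"
    then show "finite {y \<in> V. insert y (set us) \<in> E} \<and> b * ?n \<le> real (card {y \<in> V. insert y (set us) \<in> E})"
      using card_link_set[OF host, of us x] hostD(3)[OF host, of "set us"] fin by auto
  qed (use finite_link[OF fin] in auto)
  moreover have "1 / 2 * b * ?n ^ (k - 1) * (b * ?n) \<le> real (card (link E V x)) * (b * ?n)"
    using L b by (intro mult_right_mono) auto
  moreover have "card ((\<lambda>p. p) ` ?S) = card (SIGMA y:V. link E V x \<inter> link E V y)"
  proof -
    have "?S = prod.swap ` (SIGMA y:V. link E V x \<inter> link E V y)" by (auto simp: link_def image_iff)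
    then show ?thesis by (simp add: card_image)
  qed
  moreover have "card (SIGMA y:V. link E V x \<inter> link E V y) = (\<Sum>y\<in>V. card (link E V x \<inter> link E V y))"
    using fin finite_link[OF fin] by (simp add: card_SigmaI)
  moreover have "real (\<Sum>y\<in>V. card (link E V x \<inter> link E V y))
      \<le> (\<Sum>y\<in>V. b\<^sup>2 / 4 * ?n ^ (k - 1) + (if y \<in> ?P then ?n ^ (k - 1) else 0))"
    unfolding of_nat_sum
  proof (intro sum_mono)
    fix y assume y: "y \<in> V"
    have "card (link E V x \<inter> link E V y) \<le> card (tuples (k - 1) V)"
      using fin by (intro card_mono) (auto simp: link_def)
    then have "real (card (link E V x \<inter> link E V y)) \<le> ?n ^ (k - 1)"
      using fin by (simp add: card_tuples)
    then show "real (card (link E V x \<inter> link E V y)) \<le> b\<^sup>2 / 4 * ?n ^ (k - 1) + (if y \<in> ?P then ?n ^ (k - 1) else 0)"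
      using y by (auto simp: partners_def add_increasing)
  qed
  moreover have "(\<Sum>y\<in>V. b\<^sup>2 / 4 * ?n ^ (k - 1) + (if y \<in> ?P then ?n ^ (k - 1) else 0))
      = ?n * (b\<^sup>2 / 4 * ?n ^ (k - 1)) + real (card ?P) * ?n ^ (k - 1)"
  proof -
    have "V \<inter> ?P = ?P" by (auto simp: partners_def)
    then show ?thesis using fin by (simp add: sum.distrib sum.If_cases)
  qed
  ultimately have "1 / 2 * b * ?n ^ (k - 1) * (b * ?n) \<le> ?n * (b\<^sup>2 / 4 * ?n ^ (k - 1)) + real (card ?P) * ?n ^ (k - 1)"
    by linarith
  then have "?n ^ (k - 1) * (b\<^sup>2 / 4 * ?n) \<le> ?n ^ (k - 1) * real (card ?P)"
    by (simp add: power2_eq_square algebra_simps)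
  then show ?thesis using n0 by (simp only: mult_le_cancel_left_pos zero_less_power)
qed

lemma joint_edges:
  assumes "j < s" shows "0 \<in> cyc_edge j \<longleftrightarrow> j = 0 \<or> j = s - 1"
proof
  assume "0 \<in> cyc_edge j"
  then consider "j = 0" | "succ j * (k - 1) = 0" by (auto simp: cyc_edge_def)
  then show "j = 0 \<or> j = s - 1"
  proof cases
    case 2
    then have "succ j = 0" using k by simp
    then show ?thesis using assms by (cases "j + 1 = s") auto
  qed simp
next
  assume "j = 0 \<or> j = s - 1"
  then show "0 \<in> cyc_edge j" using s k by (auto simp: cyc_edge_def)
qed

lemma inner_edge:
  assumes "p mod (k - 1) \<noteq> 0" shows "p \<in> cyc_edge j \<longleftrightarrow> p div (k - 1) = j"
  using assms by (auto simp: cyc_edge_def)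

text \<open>
  On the two edges through the joint \<open>0\<close> the new colouring is the old one followed by the transposition of \<open>0\<close> and \<open>1\<close>, and on
  all other edges nothing changes.
\<close>
lemma swapped_colouring:
  assumes cs: "proper_colouring cs" "cs ! 0 = 0" "cs ! p = 1" "cs ! p' = 1"
    and p: "p < c" "p' < c" "p div (k - 1) = 0" "p mod (k - 1) \<noteq> 0" "p' div (k - 1) = s - 1" "p' mod (k - 1) \<noteq> 0"
  shows "proper_colouring (cs[0 := 1, p := 0, p' := 0])"
proof -
  let ?cs = "cs[0 := 1, p := 0, p' := 0]"
  have len: "length cs = c" "set cs \<subseteq> {..<k}" using cs(1) by (auto simp: proper_colouring_def)
  have "p \<noteq> 0" using p(4) by (cases "p = 0") auto
  moreover have "p' \<noteq> 0" using p(6) by (cases "p' = 0") auto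
  moreover have "p \<noteq> p'" using p(3,5) s by auto
  ultimately have ne: "p \<noteq> p'" "p \<noteq> 0" "p' \<noteq> 0" by auto
  have inj: "x = y" if "j < s" "x \<in> cyc_edge j" "y \<in> cyc_edge j" "cs ! x = cs ! y" for j x y
    using cs(1) that unfolding proper_colouring_def by (meson inj_onD)
  have "set ?cs \<subseteq> insert 0 (insert 0 (insert 1 (set cs)))"
    by (meson insert_mono order_trans set_update_subset_insert subset_insertI2 subset_refl)
  then have sub: "set ?cs \<subseteq> {..<k}" using len k by auto
  define t where "t l = (if l = 0 then 1 else if l = 1 then 0 else l)" for l :: nat
  have t_inj: "t a = t b \<Longrightarrow> a = b" for a b by (auto simp: t_def split: if_splits)
  have "inj_on (\<lambda>i. ?cs ! i) (cyc_edge j)" if j: "j < s" for j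
  proof (cases "0 \<in> cyc_edge j")
    case True
    define q where "q = (if j = 0 then p else p')"
    have jj: "j = 0 \<or> j = s - 1" using joint_edges[OF j] True by simp
    have q: "q \<in> cyc_edge j" "cs ! q = 1"
      using jj cs p inner_edge by (auto simp: q_def)
    have in_e: "p \<in> cyc_edge j \<longleftrightarrow> q = p" "p' \<in> cyc_edge j \<longleftrightarrow> q = p'"
      using jj p inner_edge s ne by (auto simp: q_def)
    have "?cs ! i = t (cs ! i)" if i: "i \<in> cyc_edge j" for i
    proof -
      have ic: "i < c" using cyc_edge_subset[OF j] i by auto
      consider "i = 0" | "i = q" "i \<noteq> 0" | "i \<noteq> 0" "i \<noteq> q" by blast
      then show ?thesis
      proof cases
        case 1
        then show ?thesis using ne cs(2) len c_pos by (simp add: t_def)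
      next
        case 2
        then have "i = p \<or> i = p'" by (auto simp: q_def)
        then show ?thesis using q 2 ne len ic by (auto simp: t_def nth_list_update)
      next
        case 3
        then have "cs ! i \<noteq> 0" "cs ! i \<noteq> 1" using inj[OF j i True] inj[OF j i q(1)] cs(2) q(2) by auto
        moreover have "i \<noteq> p" "i \<noteq> p'" using 3 in_e i by auto
        ultimately show ?thesis using 3 by (simp add: t_def)
      qed
    qed
    then show ?thesis using inj[OF j] t_inj by (auto simp: inj_on_def)
  next
    case False
    then have "j \<noteq> 0" "j \<noteq> s - 1" using joint_edges[OF j] by auto
    then have "p \<notin> cyc_edge j" "p' \<notin> cyc_edge j" using inner_edge p by auto
    then have "?cs ! i = cs ! i" if "i \<in> cyc_edge j" for i using that False by (metis nth_list_update_neq)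
    then show ?thesis using inj[OF j] by (auto simp: inj_on_def)
  qed
  then show ?thesis using len sub by (simp add: proper_colouring_def)
qed

lemma many_crossing_edges:
  assumes host: "host b V E" and b: "b > 0" and \<alpha>: "\<alpha> > 0" and AB: "A \<subseteq> V" "B \<subseteq> V"
    "\<alpha> * real (card V) \<le> real (card A)" "\<alpha> * real (card V) \<le> real (card B)"
    and n: "2 * (real (k - 1))\<^sup>2 \<le> \<alpha>\<^sup>2 * real (card V)"
  shows "\<alpha>\<^sup>2 / 2 * b * real (card V) ^ k
    \<le> real (card {fs \<in> tuples k V. fs ! 0 \<in> A \<and> fs ! 1 \<in> B \<and> set fs \<in> E})"
proof -
  let ?n = "real (card V)"
  have fin: "finite V" "finite A" "finite B" using hostD[OF host] AB finite_subset by auto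
  define S where "S = (\<lambda>(a, b, us). a # b # us) ` (A \<times> B \<times> tuples (k - 3) V)"
  have "card S = card A * (card B * card V ^ (k - 3))"
    unfolding S_def using fin by (subst card_image) (auto simp: inj_on_def card_cartesian_product card_tuples)
  then have "real (card S) = real (card A) * (real (card B) * ?n ^ (k - 3))" by simp
  moreover have "(\<alpha> * ?n) * ((\<alpha> * ?n) * ?n ^ (k - 3)) \<le> real (card A) * (real (card B) * ?n ^ (k - 3))"
    using AB \<alpha> by (intro mult_mono) auto
  moreover have "(\<alpha> * ?n) * ((\<alpha> * ?n) * ?n ^ (k - 3)) = \<alpha>\<^sup>2 * ?n ^ (k - 1)"
  proof -
    have "k - 1 = Suc (Suc (k - 3))" using k by simp
    then show ?thesis by (simp add: power2_eq_square)
  qed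
  ultimately have S: "\<alpha>\<^sup>2 * ?n ^ (k - 1) \<le> real (card S)" by linarith
  have Ssub: "S \<subseteq> tuples (k - 1) V" using AB k by (auto simp: S_def tuples_def)
  let ?S = "{us \<in> S. distinct us \<and> set us \<inter> {} = {}}"
  have "\<alpha>\<^sup>2 / 2 * ?n ^ (k - 1) \<le> real (card ?S)"
    using fin S Ssub n k by (intro card_clean_tuples) auto
  then have "\<alpha>\<^sup>2 / 2 * ?n ^ (k - 1) * (b * ?n) \<le> real (card ?S) * (b * ?n)"
    using b by (intro mult_right_mono) auto
  also have "\<dots> \<le> real (card ((\<lambda>(us, v). us @ [v]) ` (SIGMA us:?S. {v \<in> V. insert v (set us) \<in> E})))"
  proof (rule card_Sigma_image_ge)
    show "finite ?S" using Ssub fin finite_subset[of S "tuples (k - 1) V"] by auto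
    fix us assume "us \<in> ?S"
    then have "set us \<subseteq> V" "card (set us) = k - 1" using Ssub by (auto simp: tuples_def distinct_card)
    then show "finite {v \<in> V. insert v (set us) \<in> E} \<and> b * ?n \<le> real (card {v \<in> V. insert v (set us) \<in> E})"
      using hostD(3)[OF host] fin by auto
  qed (auto simp: inj_on_def)
  also have "\<dots> \<le> real (card {fs \<in> tuples k V. fs ! 0 \<in> A \<and> fs ! 1 \<in> B \<and> set fs \<in> E})"
    unfolding of_nat_le_iff
  proof (intro card_mono, goal_cases)
    case 2
    show ?case
    proof clarify
      fix us v assume a: "us \<in> S" "v \<in> V" "insert v (set us) \<in> E"
      then obtain x y zs where us: "us = x # y # zs" "x \<in> A" "y \<in> B" by (auto simp: S_def)
      have "us \<in> tuples (k - 1) V" using a Ssub by blast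
      then have "us @ [v] \<in> tuples k V" using a(2) k by (auto simp: tuples_def)
      then show "us @ [v] \<in> tuples k V \<and> (us @ [v]) ! 0 \<in> A \<and> (us @ [v]) ! 1 \<in> B \<and> set (us @ [v]) \<in> E"
        using us a by (simp add: insert_commute)
    qed
  qed (use fin in auto)
  finally have "\<alpha>\<^sup>2 / 2 * ?n ^ (k - 1) * (b * ?n)
      \<le> real (card {fs \<in> tuples k V. fs ! 0 \<in> A \<and> fs ! 1 \<in> B \<and> set fs \<in> E})" .
  moreover have "?n ^ k = ?n ^ (k - 1) * ?n" using k by (cases k) auto
  ultimately show ?thesis by (simp add: mult_ac)
qed

text \<open>
  Blow up the edges with first vertex in \<open>A\<close> and second vertex in \<open>B\<close> along a colouring of \<open>c + 1\<close> positions: those of the cycle and one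
  extra position \<open>c\<close> of colour \<open>0\<close>. The identity embeds the cycle and leaves out position \<open>c\<close>. By \<open>swapped_colouring\<close> the map \<open>g\<close> that
  moves \<open>0\<close> to \<open>p\<close>, \<open>p\<close> to \<open>0\<close> and \<open>p'\<close> to \<open>c\<close> embeds it as well, and leaves out \<open>p'\<close>. Thus the vertex at position \<open>c\<close>, which lies in
  \<open>A\<close>, and the vertex at position \<open>p'\<close>, which lies in \<open>B\<close>, can take each other's place.
\<close>
lemma many_crossing_reachable_pairs:
  fixes E :: "'a set set"
  assumes ks: "\<not> (k = 3 \<and> s = 3)" and host: "host b V E" and b: "b > 0" and \<alpha>: "\<alpha> > 0" and AB: "A \<subseteq> V" "B \<subseteq> V"
    "\<alpha> * real (card V) \<le> real (card A)" "\<alpha> * real (card V) \<le> real (card B)" and V0: "V \<noteq> {}"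
    and \<theta>: "\<theta> = \<alpha>\<^sup>2 / 2 * b"
    and n: "2 * (real (k - 1))\<^sup>2 \<le> \<alpha>\<^sup>2 * real (card V)" "2 * (real (c + 1))\<^sup>2 \<le> \<theta> ^ 2 ^ (c + 1) * real (card V)"
  shows "\<theta> ^ 2 ^ (c + 1) / 2 * real (card V) ^ (c + 1)
    \<le> real (card {x # y # zs | x y zs. x \<in> A \<and> y \<in> B \<and> zs \<in> reach E V (c - 1) x y})"
proof -
  let ?n = "real (card V)"
  let ?T = "{x # y # zs | x y zs. x \<in> A \<and> y \<in> B \<and> zs \<in> reach E V (c - 1) x y}"
  have fin: "finite V" using hostD[OF host] by simp
  have \<theta>0: "\<theta> > 0" unfolding \<theta> using \<alpha> b by simp
  obtain cs p p' where cs: "proper_colouring cs" "cs ! 0 = 0" "cs ! p = 1" "cs ! p' = 1" and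
    p: "p < c" "p' < c" "p div (k - 1) = 0" "p mod (k - 1) \<noteq> 0" "p' div (k - 1) = s - 1" "p' mod (k - 1) \<noteq> 0"
    using swap_colouring[OF ks] by metis
  \<comment> \<open>The colours that the cycle receives from the pattern under the second embedding \<open>g\<close>.\<close>
  define cs2 where "cs2 = cs[0 := 1, p := 0, p' := 0]"
  have cs2: "proper_colouring cs2" unfolding cs2_def by (rule swapped_colouring[OF cs p])
  have "p \<noteq> 0" using p(4) by (cases "p = 0") auto
  moreover have "p' \<noteq> 0" using p(6) by (cases "p' = 0") auto
  moreover have "p \<noteq> p'" using p(3,5) s by auto
  ultimately have ne: "p \<noteq> p'" "p \<noteq> 0" "p' \<noteq> 0" by auto
  have len: "length cs = c" "set cs \<subseteq> {..<k}" using cs(1) by (auto simp: proper_colouring_def)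
  define cs' where "cs' = cs @ [0]"
  define g where "g = (\<lambda>i. i)(0 := p, p := 0, p' := c)"
  have len': "length cs' = c + 1" "set cs' \<subseteq> {..<k}" using len k by (auto simp: cs'_def)
  have pos1: "i < length cs' \<and> cs' ! i = cs ! i" if "i < c" for i
    using that len by (simp add: cs'_def nth_append)
  have pos2: "g i < length cs' \<and> cs' ! g i = cs2 ! i" if "i < c" for i
    using that len cs ne p by (auto simp: cs'_def nth_append g_def cs2_def nth_list_update)
  define D where "D = {fs \<in> tuples k V. fs ! 0 \<in> A \<and> fs ! 1 \<in> B \<and> set fs \<in> E}"
  have dense: "\<theta> * ?n ^ k \<le> real (card D)"
    using many_crossing_edges[OF host b \<alpha> AB n(1)] unfolding \<theta> D_def by simp
  let ?Y' = "{ys \<in> tuples (c + 1) V. transversals_in k D cs' ys \<and> distinct ys}"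
  have "D \<subseteq> tuples k V" "cs' \<noteq> []" using len' by (auto simp: D_def)
  then have "\<theta> ^ 2 ^ (c + 1) / 2 * ?n ^ (c + 1) \<le> real (card ?Y')"
    using blow_up_distinct[OF fin V0 _ \<theta>0 dense len'(2)] n(2) unfolding len'(1) by blast
  also have "card ?Y' \<le> card ?T"
  proof (rule card_inj_on_le)
    let ?f = "\<lambda>ys. ys ! c # ys ! p' # (take p' ys @ drop (Suc p') (take c ys))"
    have rest: "ys = take p' ys @ ys ! p' # drop (Suc p') (take c ys) @ [ys ! c]" if "length ys = c + 1" for ys :: "'a list"
    proof -
      have "take c ys = take p' (take c ys) @ take c ys ! p' # drop (Suc p') (take c ys)"
        by (rule id_take_nth_drop) (use that p in simp)
      moreover have "take p' (take c ys) = take p' ys" "take c ys ! p' = ys ! p'"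
        using p by (simp_all add: min_def)
      moreover have "ys = take c ys @ [ys ! c]"
        using that by (metis Suc_eq_plus1 append_Nil2 lessI take_Suc_conv_app_nth take_all order_refl)
      ultimately show ?thesis by (metis append_Cons append_assoc)
    qed
    show "inj_on ?f ?Y'"
    proof (rule inj_onI)
      fix xs ys assume a: "xs \<in> ?Y'" "ys \<in> ?Y'" "?f xs = ?f ys"
      then have l: "length xs = c + 1" "length ys = c + 1" using len' by (auto simp: tuples_def)
      have "take p' xs = take p' ys" "drop (Suc p') (take c xs) = drop (Suc p') (take c ys)"
        using a(3) l by (simp_all add: append_eq_append_conv)
      then show "xs = ys" using rest[OF l(1)] rest[OF l(2)] a(3) by (metis list.inject)
    qed
    show "?f ` ?Y' \<subseteq> ?T"
    proof (rule image_subsetI)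
      fix ys assume "ys \<in> ?Y'"
      then have ys: "length ys = c + 1" "set ys \<subseteq> V" "transversals_in k D cs' ys" "distinct ys"
        using len' by (auto simp: tuples_def)
      let ?zs = "take p' ys @ drop (Suc p') (take c ys)"
      have DE: "set fs \<in> E" if "fs \<in> D" for fs using that by (simp add: D_def)
      have inj_ys: "ys ! i = ys ! i' \<longleftrightarrow> i = i'" if "i < c + 1" "i' < c + 1" for i i'
        using ys that by (simp add: nth_eq_iff_index_eq)
      have d1: "distinct (map (\<lambda>i. ys ! i) [0..<c])"
        using inj_ys by (auto simp: distinct_map inj_on_def)
      have d2: "distinct (map (\<lambda>i. ys ! g i) [0..<c])"
      proof -
        have "ys ! g i = ys ! g i' \<longleftrightarrow> i = i'" if "i < c" "i' < c" for i i'
        proof -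
          have "g i < c + 1" "g i' < c + 1" using pos2 that len' by auto
          then have "ys ! g i = ys ! g i' \<longleftrightarrow> g i = g i'" by (rule inj_ys)
          also have "\<dots> \<longleftrightarrow> i = i'" using that p ne by (auto simp: g_def)
          finally show ?thesis .
        qed
        then show ?thesis by (auto simp: distinct_map inj_on_def)
      qed
      have t1: "tile E (map (\<lambda>i. ys ! i) [0..<c])"
        by (rule tile_from_transversals[OF cs(1) ys(3) DE pos1 d1])
      have t2: "tile E (map (\<lambda>i. ys ! g i) [0..<c])"
        by (rule tile_from_transversals[OF cs2 ys(3) DE pos2 d2])
      have sys: "set ys = insert (ys ! c) (insert (ys ! p') (set ?zs))"
        by (subst rest[OF ys(1)]) auto
      have dr: "distinct (take p' ys @ ys ! p' # drop (Suc p') (take c ys) @ [ys ! c])"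
        using ys(4) rest[OF ys(1)] by simp
      then have dz: "distinct ?zs" "ys ! c \<notin> set ?zs" "ys ! p' \<notin> set ?zs" "ys ! c \<noteq> ys ! p'" by auto
      have sys': "set ys = (\<lambda>i. ys ! i) ` {..c}"
        using ys(1) by (auto simp: set_conv_nth less_Suc_eq_le)
      have s1: "set (map (\<lambda>i. ys ! i) [0..<c]) = insert (ys ! p') (set ?zs)"
      proof -
        have "set (map (\<lambda>i. ys ! i) [0..<c]) = set ys - {ys ! c}"
          unfolding sys' using inj_ys by (auto simp: image_iff le_less)
        then show ?thesis using sys dz by auto
      qed
      have s2: "set (map (\<lambda>i. ys ! g i) [0..<c]) = insert (ys ! c) (set ?zs)"
      proof -
        have "g ` {0..<c} = {..c} - {p'}"
        proof (intro equalityI subsetI)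
          fix i assume i: "i \<in> {..c} - {p'}"
          consider "i = 0" | "i = p" | "i = c" | "i \<noteq> 0" "i \<noteq> p" "i \<noteq> c" by blast
          then show "i \<in> g ` {0..<c}"
          proof cases
            case 1 then show ?thesis using p ne by (intro image_eqI[of _ _ p]) (auto simp: g_def)
          next
            case 2 then show ?thesis using c_pos ne by (intro image_eqI[of _ _ 0]) (auto simp: g_def)
          next
            case 3 then show ?thesis using p by (intro image_eqI[of _ _ p']) (auto simp: g_def)
          next
            case 4 then show ?thesis using i by (intro image_eqI[of _ _ i]) (auto simp: g_def)
          qed
        qed (use p ne in \<open>auto simp: g_def split: if_splits\<close>)
        then have "set (map (\<lambda>i. ys ! g i) [0..<c]) = (\<lambda>i. ys ! i) ` ({..c} - {p'})"
          by (simp add: image_image[symmetric])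
        also have "\<dots> = set ys - {ys ! p'}"
          unfolding sys' using inj_ys p by (auto simp: image_iff)
        finally show ?thesis using sys dz by auto
      qed
      have e: "s - 1 < s" using s by simp
      have pe: "p' \<in> cyc_edge (s - 1)" using inner_edge p by simp
      have A: "ys ! c \<in> A"
      proof -
        have pos: "g i < length cs' \<and> cs' ! g i = cs2 ! i" if "i \<in> cyc_edge (s - 1)" for i
          using pos2 cyc_edge_subset[OF e] that by auto
        obtain fs where fs: "fs \<in> D" "length fs = k" "set fs = (\<lambda>i. ys ! g i) ` cyc_edge (s - 1)"
          "\<forall>i\<in>cyc_edge (s - 1). fs ! (cs2 ! i) = ys ! g i"
          "set (tl fs) = (\<lambda>i. ys ! g i) ` {i \<in> cyc_edge (s - 1). cs2 ! i \<noteq> 0}"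
          by (rule transversal_along_edge[OF cs2 e ys(3) pos])
        have "fs ! 0 = ys ! c" using fs(4) pe len p by (force simp: g_def cs2_def)
        then show ?thesis using fs(1) by (simp add: D_def)
      qed
      have B: "ys ! p' \<in> B"
      proof -
        have pos: "i < length cs' \<and> cs' ! i = cs ! i" if "i \<in> cyc_edge (s - 1)" for i
          using pos1 cyc_edge_subset[OF e] that by auto
        obtain fs where fs: "fs \<in> D" "length fs = k" "set fs = (\<lambda>i. ys ! i) ` cyc_edge (s - 1)"
          "\<forall>i\<in>cyc_edge (s - 1). fs ! (cs ! i) = ys ! i"
          "set (tl fs) = (\<lambda>i. ys ! i) ` {i \<in> cyc_edge (s - 1). cs ! i \<noteq> 0}"
          by (rule transversal_along_edge[OF cs(1) e ys(3) pos])
        have "fs ! 1 = ys ! p'" using fs(4) pe cs(4) by force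
        then show ?thesis using fs(1) by (simp add: D_def)
      qed
      have "?zs \<in> tuples (c - 1) V"
        using ys(1,2) sys p by (auto simp: tuples_def)
      then have "?zs \<in> reach E V (c - 1) (ys ! c) (ys ! p')"
        using dz tileable_tile[OF t1] tileable_tile[OF t2] unfolding s1 s2 reach_def by simp
      then show "?f ys \<in> ?T" using A B by blast
    qed
    have "?T \<subseteq> tuples (c + 1) V" using AB c_pos by (auto simp: reach_def tuples_def)
    then show "finite ?T" using fin finite_subset by blast
  qed
  finally show ?thesis by simp
qed

text \<open>
  Walk from \<open>x\<close> to a partner \<open>a\<close>, from there across to a partner \<open>d\<close> of \<open>y\<close>, and on to \<open>y\<close>. The list that serves \<open>x\<close> and \<open>y\<close> consists of
  \<open>a\<close>, \<open>d\<close> and the lists for the three steps.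
\<close>
lemma all_pairs_reachable_not_triangle:
  assumes ks: "\<not> (k = 3 \<and> s = 3)" and b: "b > 0"
  shows "\<exists>q \<theta>. \<theta> > 0 \<and> for_large_hosts b (\<lambda>(V :: 'a set) E.
    \<forall>x\<in>V. \<forall>y\<in>V. \<theta> * real (card V) ^ q \<le> real (card (reach E V q x y)))"
proof -
  define \<alpha> where "\<alpha> = b\<^sup>2 / 4"
  define \<theta>1 where "\<theta>1 = (\<alpha> * b) ^ 2 ^ c / 2"
  define \<theta>2 where "\<theta>2 = \<alpha>\<^sup>2 / 2 * b"
  define \<theta>3 where "\<theta>3 = \<theta>2 ^ 2 ^ (c + 1) / 2 * (\<theta>1 * \<theta>1)"
  define q where "q = c + 1 + (c - 1) + (c - 1)"
  have pos: "\<alpha> > 0" "\<theta>1 > 0" "\<theta>2 > 0" "\<theta>3 > 0" using b by (simp_all add: \<alpha>_def \<theta>1_def \<theta>2_def \<theta>3_def)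
  have "eventually (\<lambda>n. 1 \<le> 1 * real n \<and> 2 * ((real (c - 1))\<^sup>2 + real (c - 1) * 2) \<le> (\<alpha> * b) ^ 2 ^ c * real n
    \<and> 2 * ((real (k - 2))\<^sup>2 + real (k - 2)) \<le> 1 * real n
    \<and> 2 * (real (k - 1))\<^sup>2 \<le> \<alpha>\<^sup>2 * real n \<and> 2 * (real (c + 1))\<^sup>2 \<le> \<theta>2 ^ 2 ^ (c + 1) * real n
    \<and> 2 * ((real q)\<^sup>2 + real q * 2) \<le> \<theta>3 * real n) sequentially" (is "eventually ?C _")
    by (intro eventually_conj eventually_le_mult) (use pos b in auto)
  then have "for_large_hosts b (\<lambda>(V :: 'a set) E.
    \<forall>x\<in>V. \<forall>y\<in>V. \<theta>3 / 2 * real (card V) ^ q \<le> real (card (reach E V q x y)))"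
  proof (rule for_large_hostsI, intro ballI)
    fix V :: "'a set" and E x y
    assume host: "host b V E" and nC: "?C (card V)" and xy: "x \<in> V" "y \<in> V"
    define n where "n = card V"
    note cV = n_def[symmetric]
    have n: "?C n" using nC cV by simp
    have fin: "finite V" and V0: "V \<noteq> {}" using hostD[OF host] xy by auto
    define A where "A = partners E V \<alpha> x"
    define B where "B = partners E V \<alpha> y"
    have AB: "A \<subseteq> V" "B \<subseteq> V" "\<alpha> * real (card V) \<le> real (card A)" "\<alpha> * real (card V) \<le> real (card B)"
      using card_partners_ge[OF host xy(1) b] card_partners_ge[OF host xy(2) b] n cV
      by (auto simp: A_def B_def \<alpha>_def partners_def)
    define T where "T = {a # d # zs | a d zs. a \<in> A \<and> d \<in> B \<and> zs \<in> reach E V (c - 1) a d}"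
    have cT: "\<theta>2 ^ 2 ^ (c + 1) / 2 * real n ^ (c + 1) \<le> real (card T)"
      using many_crossing_reachable_pairs[OF ks host b pos(1) AB V0 \<theta>2_def] n cV by (simp add: T_def)
    have Tsub: "T \<subseteq> tuples (c + 1) V" using AB c_pos by (auto simp: T_def reach_def tuples_def)
    have reach1: "\<theta>1 * real n ^ (c - 1) \<le> real (card (reach E V (c - 1) z a))"
      if "z \<in> V" "a \<in> partners E V \<alpha> z" for z a
      using reach_if_common_link[OF host that(1) _ b pos(1), of a] that(2) n cV
      by (auto simp: partners_def \<theta>1_def)
    let ?F = "\<lambda>ts. reach E V (c - 1) x (ts ! 0) \<times> reach E V (c - 1) y (ts ! 1)"
    let ?f = "\<lambda>(ts, us, ws). ts @ us @ ws"
    let ?Z = "?f ` (SIGMA ts:T. ?F ts)"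
    have Za: "real (card T) * ((\<theta>1 * real n ^ (c - 1)) * (\<theta>1 * real n ^ (c - 1))) \<le> real (card ?Z)"
    proof (rule card_Sigma_image_ge)
      show "finite T" using Tsub fin finite_subset by blast
      fix ts assume "ts \<in> T"
      then have "ts ! 0 \<in> partners E V \<alpha> x" "ts ! 1 \<in> partners E V \<alpha> y" by (auto simp: T_def A_def B_def)
      then show "finite (?F ts) \<and> (\<theta>1 * real n ^ (c - 1)) * (\<theta>1 * real n ^ (c - 1)) \<le> real (card (?F ts))"
        using fin reach1 xy pos by (auto simp: card_cartesian_product finite_reach intro!: mult_mono)
    next
      show "inj_on ?f (SIGMA ts:T. ?F ts)"
      proof (rule inj_onI)
        fix p1 p2 assume P: "p1 \<in> (SIGMA ts:T. ?F ts)" "p2 \<in> (SIGMA ts:T. ?F ts)" "?f p1 = ?f p2"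
        obtain t1 u1 w1 t2 u2 w2 where p: "p1 = (t1, u1, w1)" "p2 = (t2, u2, w2)" by (metis prod.exhaust)
        have "t1 \<in> tuples (c + 1) V" "t2 \<in> tuples (c + 1) V" using P p Tsub by blast+
        then have "length t1 = length t2" by (simp add: tuples_def)
        moreover have "length u1 = length u2" using P p by (auto simp: reach_def tuples_def)
        ultimately show "p1 = p2" using P(3) p by (simp add: append_eq_append_conv)
      qed
    qed
    have Zb: "\<theta>2 ^ 2 ^ (c + 1) / 2 * real n ^ (c + 1) * ((\<theta>1 * real n ^ (c - 1)) * (\<theta>1 * real n ^ (c - 1)))
        \<le> real (card T) * ((\<theta>1 * real n ^ (c - 1)) * (\<theta>1 * real n ^ (c - 1)))"
      using cT pos by (intro mult_right_mono) auto
    have Zc: "\<theta>2 ^ 2 ^ (c + 1) / 2 * real n ^ (c + 1) * ((\<theta>1 * real n ^ (c - 1)) * (\<theta>1 * real n ^ (c - 1)))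
        = \<theta>3 * real n ^ q"
      unfolding \<theta>3_def q_def power_add by (simp only: mult_ac)
    have Z: "\<theta>3 * real (card V) ^ q \<le> real (card ?Z)"
      unfolding cV Zc[symmetric] by (rule order_trans[OF Zb Za])
    have Zsub: "?Z \<subseteq> tuples q V"
    proof clarify
      fix ts us ws assume "ts \<in> T" "us \<in> reach E V (c - 1) x (ts ! 0)" "ws \<in> reach E V (c - 1) y (ts ! 1)"
      then have "ts \<in> tuples (c + 1) V" "us \<in> tuples (c - 1) V" "ws \<in> tuples (c - 1) V"
        using Tsub by (auto simp: reach_def)
      then show "ts @ us @ ws \<in> tuples q V" by (auto simp: tuples_def q_def)
    qed
    show "\<theta>3 / 2 * real (card V) ^ q \<le> real (card (reach E V q x y))"
    proof (rule card_reach_ge[OF fin Zsub Z])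
      show "q > 0" using c_pos by (simp add: q_def)
      show "2 * ((real q)\<^sup>2 + real q * 2) \<le> \<theta>3 * real (card V)" using n cV by simp
      fix zs assume zs: "zs \<in> ?Z" and d: "distinct zs" "x \<notin> set zs" "y \<notin> set zs"
      then obtain ts us ws where z: "zs = ts @ us @ ws" "ts \<in> T" "us \<in> reach E V (c - 1) x (ts ! 0)"
        "ws \<in> reach E V (c - 1) y (ts ! 1)" by auto
      then obtain a d rs where ts: "ts = a # d # rs" "rs \<in> reach E V (c - 1) a d" unfolding T_def by blast
      have us: "tileable E (insert x (set us))" "tileable E (insert a (set us))"
        using z(3) ts by (auto simp: reach_def)
      have ws: "tileable E (insert y (set ws))" "tileable E (insert d (set ws))"
        using z(4) ts by (auto simp: reach_def)
      have rs: "tileable E (insert a (set rs))" "tileable E (insert d (set rs))" using ts(2) by (auto simp: reach_def)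
      have zz: "zs = a # d # rs @ us @ ws" using z ts by simp
      have "tileable E (insert x (set us) \<union> (insert a (set rs) \<union> insert d (set ws)))"
        using d unfolding zz by (intro tileable_Un us ws rs) auto
      moreover have "tileable E (insert y (set ws) \<union> (insert d (set rs) \<union> insert a (set us)))"
        using d unfolding zz by (intro tileable_Un us ws rs) auto
      moreover have "insert x (set us) \<union> (insert a (set rs) \<union> insert d (set ws)) = insert x (set zs)"
        "insert y (set ws) \<union> (insert d (set rs) \<union> insert a (set us)) = insert y (set zs)"
        unfolding zz by auto
      ultimately show "tileable E (insert x (set zs)) \<and> tileable E (insert y (set zs))" by simp
    qed
  qed
  then show ?thesis using pos by (intro exI[of _ q] exI[of _ "\<theta>3 / 2"]) auto
qed

section \<open>Reachability for loose triangles in 3-graphs\<close>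

text \<open>
  Concatenations of one list for each pair. Such a list can be tiled together with all first components and also together with
  all second components.
\<close>
fun exch :: "'a set set \<Rightarrow> 'a set \<Rightarrow> nat \<Rightarrow> ('a \<times> 'a) list \<Rightarrow> 'a list set" where
  "exch E V q [] = {[]}"
| "exch E V q (p # ps) = {us @ ws | us ws. us \<in> reach E V q (fst p) (snd p) \<and> ws \<in> exch E V q ps}"

lemma exch_tuples: "exch E V q ps \<subseteq> tuples (length ps * q) V"
proof (induction ps)
  case (Cons p ps)
  then show ?case by (fastforce simp: reach_def tuples_def)
qed (simp add: tuples_def)

lemma card_exch:
  assumes fin: "finite V" and r: "r \<ge> 0" "\<And>p. p \<in> set ps \<Longrightarrow> r \<le> real (card (reach E V q (fst p) (snd p)))"
  shows "r ^ length ps \<le> real (card (exch E V q ps))"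
  using r(2)
proof (induction ps)
  case (Cons p ps)
  have "r * r ^ length ps \<le> real (card (reach E V q (fst p) (snd p))) * r ^ length ps"
    using Cons.prems r(1) by (intro mult_right_mono) auto
  also have "\<dots> \<le> real (card {us @ ws | us ws. us \<in> reach E V q (fst p) (snd p) \<and> ws \<in> exch E V q ps})"
  proof (rule card_append_ge)
    show "finite (exch E V q ps) \<and> r ^ length ps \<le> real (card (exch E V q ps))"
      using Cons fin exch_tuples finite_subset by (metis finite_tuples list.set_intros(2))
  qed (use fin finite_reach in \<open>auto simp: reach_def tuples_def\<close>)
  finally show ?case by simp
qed simp

lemma exch_tileable_fst:
  assumes "zs \<in> exch E V q ps" "distinct zs" "distinct (map fst ps)" "fst ` set ps \<inter> set zs = {}"
  shows "tileable E (fst ` set ps \<union> set zs)"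
  using assms
proof (induction ps arbitrary: zs)
  case (Cons p ps)
  then obtain us ws where z: "zs = us @ ws" "us \<in> reach E V q (fst p) (snd p)" "ws \<in> exch E V q ps" by auto
  have 1: "tileable E (fst ` set ps \<union> set ws)" using Cons.prems z by (intro Cons.IH) auto
  have 2: "tileable E (insert (fst p) (set us))" using z by (simp add: reach_def)
  have 3: "insert (fst p) (set us) \<inter> (fst ` set ps \<union> set ws) = {}" using Cons.prems z by auto
  have "tileable E (insert (fst p) (set us) \<union> (fst ` set ps \<union> set ws))" by (rule tileable_Un[OF 2 1 3])
  moreover have "insert (fst p) (set us) \<union> (fst ` set ps \<union> set ws) = fst ` set (p # ps) \<union> set zs" using z by auto
  ultimately show ?case by simp
qed (simp add: tileable_empty)

lemma exch_swap: "exch E V q (map prod.swap ps) = exch E V q ps"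
  by (induction ps) (simp_all add: reach_commute)

lemma exch_tileable_snd:
  assumes "zs \<in> exch E V q ps" "distinct zs" "distinct (map snd ps)" "snd ` set ps \<inter> set zs = {}"
  shows "tileable E (snd ` set ps \<union> set zs)"
  using exch_tileable_fst[of zs E V q "map prod.swap ps"] assms
  by (simp add: exch_swap image_image o_def)

lemma many_tiles:
  assumes b: "b > 0"
  shows "\<exists>\<theta>>0. for_large_hosts b (\<lambda>(V :: 'a set) E. \<theta> * real (card V) ^ c \<le> real (card {ys \<in> tuples c V. tile E ys}))"
proof -
  define \<theta> where "\<theta> = (b / 2) ^ 2 ^ c"
  have \<theta>: "\<theta> > 0" using b by (simp add: \<theta>_def)
  have "eventually (\<lambda>n. 1 \<le> 1 * real n \<and> 2 * (real (k - 1))\<^sup>2 \<le> 1 * real n \<and> 2 * (real c)\<^sup>2 \<le> \<theta> * real n) sequentially"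
    (is "eventually ?C _")
    by (intro eventually_conj eventually_le_mult) (use \<theta> in auto)
  then have "for_large_hosts b (\<lambda>(V :: 'a set) E. \<theta> / 2 * real (card V) ^ c \<le> real (card {ys \<in> tuples c V. tile E ys}))"
  proof (rule for_large_hostsI)
    fix V :: "'a set" and E
    assume host: "host b V E" and n: "?C (card V)"
    have fin: "finite V" and V0: "V \<noteq> {}" using hostD[OF host] n by auto
    define D where "D = {fs \<in> tuples k V. fs ! 0 \<in> V \<and> fs ! 1 \<in> V \<and> set fs \<in> E}"
    have dense: "b / 2 * real (card V) ^ k \<le> real (card D)"
      using many_crossing_edges[OF host b, of 1 V V] n unfolding D_def by simp
    have "D \<subseteq> {fs \<in> tuples k V. set fs \<subseteq> V \<and> set fs \<in> E}" by (auto simp: D_def tuples_def)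
    then have "\<theta> / 2 * real (card V) ^ c \<le> real (card {ys \<in> tuples c V. tile E ys \<and> set ys \<subseteq> V})"
      unfolding \<theta>_def using n b by (intro many_tiles_in_dense_subset[OF fin V0 _ _ dense]) (auto simp: \<theta>_def)
    also have "{ys \<in> tuples c V. tile E ys \<and> set ys \<subseteq> V} = {ys \<in> tuples c V. tile E ys}" by (auto simp: tuples_def)
    finally show "\<theta> / 2 * real (card V) ^ c \<le> real (card {ys \<in> tuples c V. tile E ys})" .
  qed
  then show ?thesis using \<theta> by (intro exI[of _ "\<theta> / 2"]) auto
qed

text \<open>
  Appending vertex-disjoint copies of the cycle makes the lists longer. In this way the lists for different pairs
  get the same length, as they have to in \<open>exch\<close>.
\<close>
lemma reach_pad:
  assumes b: "b > 0" and \<theta>: "\<theta> > 0" and q: "q > 0"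
  shows "\<exists>\<theta>'>0. for_large_hosts b (\<lambda>(V :: 'a set) E.
    \<forall>x\<in>V. \<forall>y\<in>V. \<theta> * real (card V) ^ q \<le> real (card (reach E V q x y)) \<longrightarrow>
       \<theta>' * real (card V) ^ (q + j * c) \<le> real (card (reach E V (q + j * c) x y)))"
proof (induction j)
  case 0
  then show ?case using \<theta> by (intro exI[of _ \<theta>]) (auto simp: for_large_hosts_def)
next
  case (Suc j)
  let ?q = "q + j * c"
  let ?Q = "?q + c"
  obtain \<theta>1 where \<theta>1: "\<theta>1 > 0" and ev1: "for_large_hosts b (\<lambda>(V :: 'a set) E.
    \<forall>x\<in>V. \<forall>y\<in>V. \<theta> * real (card V) ^ q \<le> real (card (reach E V q x y)) \<longrightarrow>
       \<theta>1 * real (card V) ^ ?q \<le> real (card (reach E V ?q x y)))" using Suc by blast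
  obtain \<theta>T where \<theta>T: "\<theta>T > 0" and evT: "for_large_hosts b (\<lambda>(V :: 'a set) E.
    \<theta>T * real (card V) ^ c \<le> real (card {ys \<in> tuples c V. tile E ys}))" using many_tiles[OF b] by blast
  have "eventually (\<lambda>n. 2 * ((real ?Q)\<^sup>2 + real ?Q * 2) \<le> \<theta>1 * \<theta>T * real n) sequentially"
    by (rule eventually_le_mult) (use \<theta>1 \<theta>T in simp)
  with ev1 evT have "for_large_hosts b (\<lambda>(V :: 'a set) E.
    \<forall>x\<in>V. \<forall>y\<in>V. \<theta> * real (card V) ^ q \<le> real (card (reach E V q x y)) \<longrightarrow>
       \<theta>1 * \<theta>T / 2 * real (card V) ^ ?Q \<le> real (card (reach E V ?Q x y)))"
  proof (rule for_large_hosts_combine, intro ballI impI)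
    fix V :: "'a set" and E x y
    assume host: "host b V E" and xy: "x \<in> V" "y \<in> V"
      and n: "2 * ((real ?Q)\<^sup>2 + real ?Q * 2) \<le> \<theta>1 * \<theta>T * real (card V)"
      and a1: "\<forall>x\<in>V. \<forall>y\<in>V. \<theta> * real (card V) ^ q \<le> real (card (reach E V q x y)) \<longrightarrow>
       \<theta>1 * real (card V) ^ ?q \<le> real (card (reach E V ?q x y))"
      and rT: "\<theta>T * real (card V) ^ c \<le> real (card {ys \<in> tuples c V. tile E ys})"
      and r: "\<theta> * real (card V) ^ q \<le> real (card (reach E V q x y))"
    let ?n = "real (card V)"
    have fin: "finite V" using hostD[OF host] by simp
    let ?T = "{ys \<in> tuples c V. tile E ys}"
    let ?Z = "{us @ ws | us ws. us \<in> reach E V ?q x y \<and> ws \<in> ?T}"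
    have r1: "\<theta>1 * ?n ^ ?q \<le> real (card (reach E V ?q x y))" using a1 xy r by blast
    have "\<theta>1 * ?n ^ ?q * (\<theta>T * ?n ^ c) \<le> real (card (reach E V ?q x y)) * (\<theta>T * ?n ^ c)"
      using r1 \<theta>T by (intro mult_right_mono) auto
    also have "\<dots> \<le> real (card ?Z)"
    proof (rule card_append_ge)
      show "finite (reach E V ?q x y)" by (rule finite_reach[OF fin])
      show "length us = ?q" if "us \<in> reach E V ?q x y" for us using that by (simp add: reach_def tuples_def)
      show "finite ?T \<and> \<theta>T * ?n ^ c \<le> real (card ?T)" using rT fin by simp
    qed
    also have "\<theta>1 * ?n ^ ?q * (\<theta>T * ?n ^ c) = \<theta>1 * \<theta>T * ?n ^ ?Q"
      unfolding power_add by (simp only: mult_ac)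
    finally have Z: "\<theta>1 * \<theta>T * ?n ^ ?Q \<le> real (card ?Z)" .
    have Zsub: "?Z \<subseteq> tuples ?Q V" by (auto simp: reach_def tuples_def)
    show "\<theta>1 * \<theta>T / 2 * ?n ^ ?Q \<le> real (card (reach E V ?Q x y))"
    proof (rule card_reach_ge[OF fin Zsub Z _ n])
      show "?Q > 0" using q by simp
      fix zs assume "zs \<in> ?Z" and d: "distinct zs" "x \<notin> set zs" "y \<notin> set zs"
      then obtain us ws where z: "zs = us @ ws" "us \<in> reach E V ?q x y" "ws \<in> ?T" by auto
      have "tileable E (insert w (set us) \<union> set ws)" if "w \<in> {x, y}" for w
        using z d that by (intro tileable_Un tileable_tile) (auto simp: reach_def)
      then show "tileable E (insert x (set zs)) \<and> tileable E (insert y (set zs))" using z(1) by auto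
    qed
  qed
  moreover have "?Q = q + Suc j * c" by simp
  ultimately show ?case using \<theta>1 \<theta>T by (intro exI[of _ "\<theta>1 * \<theta>T / 2"]) auto
qed

text \<open>
  In contrast to the crude estimate in \<open>card_partners_ge\<close>, the density of the link has to be kept almost equal to \<open>b\<close> here, because
  it is compared with \<open>1 / 3\<close>.
\<close>
lemma card_link_ge_nearly:
  assumes host: "host b V E" and x: "x \<in> V" and b: "b > 0" and k3: "k = 3" and r: "0 \<le> r"
    and n: "1 \<le> (1 - r) * real (card V)"
  shows "r * b * real (card V) ^ 2 \<le> real (card (link E V x))"
proof -
  have fin: "finite V" using hostD[OF host] by simp
  have "{ws \<in> tuples (k - 2) V. distinct ws \<and> set ws \<inter> {x} = {}} = (\<lambda>v. [v]) ` (V - {x})"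
    using k3 by (auto simp: tuples_def length_Suc_conv One_nat_def numeral_eq_Suc)
  then have "card {ws \<in> tuples (k - 2) V. distinct ws \<and> set ws \<inter> {x} = {}} = card V - 1"
    using fin x by (simp add: card_image inj_on_def)
  moreover have "card V \<ge> 1" using fin x by (metis One_nat_def Suc_leI card_gt_0_iff empty_iff)
  ultimately have "real (card {ws \<in> tuples (k - 2) V. distinct ws \<and> set ws \<inter> {x} = {}}) = real (card V) - 1"
    by simp
  then have "r * real (card V) ^ (k - 2) \<le> real (card {ws \<in> tuples (k - 2) V. distinct ws \<and> set ws \<inter> {x} = {}})"
    using n k3 by (simp add: algebra_simps)
  from card_link_ge[OF host x b r this] k3 show ?thesis by simp
qed

text \<open>
  Three sets of density more than \<open>1 / 3\<close> cannot be pairwise almost disjoint.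
\<close>
lemma three_links_meet:
  assumes host: "host b V E" and k3: "k = 3" and xyz: "x \<in> V" "y \<in> V" "z \<in> V"
    and L: "\<And>w. w \<in> V \<Longrightarrow> (1 / 3 + \<epsilon>) * real (card V) ^ 2 \<le> real (card (link E V w))"
  shows "x \<in> partners E V \<epsilon> y \<or> x \<in> partners E V \<epsilon> z \<or> y \<in> partners E V \<epsilon> z"
proof (rule ccontr)
  let ?n = "real (card V)"
  have k1: "k - 1 = 2" using k3 by simp
  let ?X = "link E V x" and ?Y = "link E V y" and ?Z = "link E V z"
  assume "\<not> ?thesis"
  then have lt: "real (card (?X \<inter> ?Y)) < \<epsilon> * ?n\<^sup>2" "real (card (?X \<inter> ?Z)) < \<epsilon> * ?n\<^sup>2" "real (card (?Y \<inter> ?Z)) < \<epsilon> * ?n\<^sup>2"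
    using xyz k1 by (auto simp: partners_def Int_commute)
  have fin: "finite V" using hostD[OF host] by simp
  note f = finite_link[OF fin, of E]
  have "card (?X \<union> ?Y \<union> ?Z) \<le> card (tuples 2 V)"
    using fin by (intro card_mono) (auto simp: link_def k1)
  then have "real (card (?X \<union> ?Y \<union> ?Z)) \<le> ?n\<^sup>2" using fin by (simp add: card_tuples)
  moreover have "card (?X \<union> ?Y) + card (?X \<inter> ?Y) = card ?X + card ?Y"
    "card (?X \<union> ?Y \<union> ?Z) + card ((?X \<union> ?Y) \<inter> ?Z) = card (?X \<union> ?Y) + card ?Z"
    using card_Un_Int[OF f f, of x y] card_Un_Int[OF finite_UnI[OF f f] f, of x y z] by linarith+
  moreover have "card ((?X \<union> ?Y) \<inter> ?Z) \<le> card (?X \<inter> ?Z) + card (?Y \<inter> ?Z)"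
    unfolding Int_Un_distrib2 by (rule card_Un_le)
  ultimately have "real (card ?X) + real (card ?Y) + real (card ?Z)
      \<le> ?n\<^sup>2 + real (card (?X \<inter> ?Y)) + real (card (?X \<inter> ?Z)) + real (card (?Y \<inter> ?Z))" by linarith
  then have "(1 / 3 + \<epsilon>) * ?n\<^sup>2 + (1 / 3 + \<epsilon>) * ?n\<^sup>2 + (1 / 3 + \<epsilon>) * ?n\<^sup>2 < ?n\<^sup>2 + \<epsilon> * ?n\<^sup>2 + \<epsilon> * ?n\<^sup>2 + \<epsilon> * ?n\<^sup>2"
    using L[OF xyz(1)] L[OF xyz(2)] L[OF xyz(3)] lt by linarith
  then show False by (simp add: algebra_simps)
qed

lemma triangle_tile:
  assumes ks: "k = 3" "s = 3" and d: "distinct [u1, p1, u2, p2, u3, p3]"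
    and E: "insert p1 {u1, u2} \<in> E" "insert p2 {u2, u3} \<in> E" "insert p3 {u1, u3} \<in> E"
  shows "tile E [u1, p1, u2, p2, u3, p3]"
  unfolding tile_def
proof (intro conjI allI impI d)
  show "length [u1, p1, u2, p2, u3, p3] = c" unfolding c_def using ks by simp
  have e: "cyc_edge 0 = {0, 1, 2}" "cyc_edge 1 = {2, 3, 4}" "cyc_edge 2 = {4, 5, 0}"
    unfolding cyc_edge_def block_eq using ks by auto
  fix j assume "j < s"
  then consider "j = 0" | "j = 1" | "j = 2" using ks by linarith
  then show "(\<lambda>i. [u1, p1, u2, p2, u3, p3] ! i) ` cyc_edge j \<in> E"
  proof cases
    case 1
    have "(\<lambda>i. [u1, p1, u2, p2, u3, p3] ! i) ` cyc_edge 0 = insert p1 {u1, u2}" unfolding e by (simp add: nth_Cons' insert_commute)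
    then show ?thesis using 1 E by simp
  next
    case 2
    have "(\<lambda>i. [u1, p1, u2, p2, u3, p3] ! i) ` cyc_edge 1 = insert p2 {u2, u3}" unfolding e by (simp add: nth_Cons' insert_commute)
    then show ?thesis using 2 E by simp
  next
    case 3
    have "(\<lambda>i. [u1, p1, u2, p2, u3, p3] ! i) ` cyc_edge 2 = insert p3 {u1, u3}" unfolding e by (simp add: nth_Cons' insert_commute)
    then show ?thesis using 3 E by simp
  qed
qed

definition mixed_tiles :: "'a set set \<Rightarrow> 'a set \<Rightarrow> 'a set \<Rightarrow> 'a set \<Rightarrow> nat \<Rightarrow> 'a list set" where
  "mixed_tiles E V A B j = {ys \<in> tuples c V. tile E ys \<and> set ys \<subseteq> A \<union> B \<and> card (set ys \<inter> A) = j}"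

lemma reach_two_step:
  assumes fin: "finite V" and C: "C \<subseteq> V" "\<xi> * real (card V) \<le> real (card C)" and \<xi>: "\<xi> > 0" and \<theta>: "\<theta> > 0"
    and R: "\<And>z. z \<in> C \<Longrightarrow> \<theta> * real (card V) ^ q \<le> real (card (reach E V q x z))"
      "\<And>z. z \<in> C \<Longrightarrow> \<theta> * real (card V) ^ q \<le> real (card (reach E V q y z))"
    and n: "2 * ((real (2 * q + 1))\<^sup>2 + real (2 * q + 1) * 2) \<le> \<xi> * (\<theta> * \<theta>) * real (card V)"
  shows "\<xi> * (\<theta> * \<theta>) / 2 * real (card V) ^ (2 * q + 1) \<le> real (card (reach E V (2 * q + 1) x y))"
proof -
  let ?n = "real (card V)"
  let ?F = "\<lambda>z. reach E V q x z \<times> reach E V q y z"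
  let ?f = "\<lambda>(z, us, ws). z # us @ ws"
  let ?Z = "?f ` (SIGMA z:C. ?F z)"
  have "\<xi> * ?n * ((\<theta> * ?n ^ q) * (\<theta> * ?n ^ q)) \<le> real (card C) * ((\<theta> * ?n ^ q) * (\<theta> * ?n ^ q))"
    using C \<theta> by (intro mult_right_mono) auto
  also have "\<dots> \<le> real (card ?Z)"
  proof (rule card_Sigma_image_ge)
    show "finite C" using C fin finite_subset by blast
    fix z assume "z \<in> C"
    then show "finite (?F z) \<and> (\<theta> * ?n ^ q) * (\<theta> * ?n ^ q) \<le> real (card (?F z))"
      using fin R \<theta> by (auto simp: card_cartesian_product finite_reach intro!: mult_mono)
  next
    show "inj_on ?f (SIGMA z:C. ?F z)"
    proof (rule inj_onI)
      fix p1 p2 assume P: "p1 \<in> (SIGMA z:C. ?F z)" "p2 \<in> (SIGMA z:C. ?F z)" "?f p1 = ?f p2"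
      obtain z1 u1 w1 z2 u2 w2 where p: "p1 = (z1, u1, w1)" "p2 = (z2, u2, w2)" by (metis prod.exhaust)
      have "length u1 = length u2" using P p by (auto simp: reach_def tuples_def)
      then show "p1 = p2" using P(3) p by (simp add: append_eq_append_conv)
    qed
  qed
  also have "\<xi> * ?n * ((\<theta> * ?n ^ q) * (\<theta> * ?n ^ q)) = \<xi> * (\<theta> * \<theta>) * ?n ^ (2 * q + 1)"
  proof -
    have "2 * q + 1 = Suc (q + q)" by simp
    then show ?thesis by (simp only: power_Suc power_add mult_ac)
  qed
  finally have Z: "\<xi> * (\<theta> * \<theta>) * ?n ^ (2 * q + 1) \<le> real (card ?Z)" .
  have Zsub: "?Z \<subseteq> tuples (2 * q + 1) V" using C by (auto simp: reach_def tuples_def)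
  show ?thesis
  proof (rule card_reach_ge[OF fin Zsub Z _ n])
    fix zs assume "zs \<in> ?Z" and d: "distinct zs" "x \<notin> set zs" "y \<notin> set zs"
    then obtain z us ws where z: "zs = z # us @ ws" "us \<in> reach E V q x z" "ws \<in> reach E V q y z" by auto
    have us: "tileable E (insert x (set us))" "tileable E (insert z (set us))" using z(2) by (auto simp: reach_def)
    have ws: "tileable E (insert y (set ws))" "tileable E (insert z (set ws))" using z(3) by (auto simp: reach_def)
    have "tileable E (insert x (set us) \<union> insert z (set ws))"
      using d unfolding z(1) by (intro tileable_Un us ws) auto
    moreover have "tileable E (insert y (set ws) \<union> insert z (set us))"
      using d unfolding z(1) by (intro tileable_Un us ws) auto
    moreover have "insert x (set us) \<union> insert z (set ws) = insert x (set zs)"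
      "insert y (set ws) \<union> insert z (set us) = insert y (set zs)" unfolding z(1) by auto
    ultimately show "tileable E (insert x (set zs)) \<and> tileable E (insert y (set zs))" by simp
  qed simp
qed

text \<open>
  The exchange list consists of a tile \<open>d1\<close> with \<open>j + 1\<close> vertices in \<open>A\<close>, a tile \<open>d2\<close> with \<open>j\<close> vertices in \<open>A\<close>, and lists that
  exchange the vertices of \<open>x # d2\<close> one by one for those of \<open>d1 @ [y]\<close>. Both of these have \<open>j + 1\<close> vertices in \<open>A\<close> and the others in
  \<open>B\<close>, so they can be matched within the classes. With \<open>x\<close> present, \<open>d1\<close> is a tile and the exchange lists are tiled with
  \<open>x # d2\<close>; with \<open>y\<close> present, \<open>d2\<close> is a tile and they are tiled with \<open>d1 @ [y]\<close>.
\<close>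
lemma reach_by_exchange:
  assumes fin: "finite V" and AB: "A \<inter> B = {}" and x: "x \<in> A" and y: "y \<in> B" and \<theta>: "\<theta> > 0" and \<phi>: "\<phi> > 0"
    and R: "\<And>u v. u \<in> A \<and> v \<in> A \<or> u \<in> B \<and> v \<in> B \<Longrightarrow> \<theta> * real (card V) ^ q \<le> real (card (reach E V q u v))"
    and T1: "\<phi> * real (card V) ^ c \<le> real (card (mixed_tiles E V A B (Suc j)))"
    and T2: "\<phi> * real (card V) ^ c \<le> real (card (mixed_tiles E V A B j))"
    and Q: "Q = c + c + (c + 1) * q"
    and n: "2 * ((real Q)\<^sup>2 + real Q * 2) \<le> \<phi> * \<phi> * \<theta> ^ (c + 1) * real (card V)"
  shows "\<phi> * \<phi> * \<theta> ^ (c + 1) / 2 * real (card V) ^ Q \<le> real (card (reach E V Q x y))"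
proof -
  let ?n = "real (card V)"
  let ?T1 = "mixed_tiles E V A B (Suc j)" and ?T2 = "mixed_tiles E V A B j"
  define L1 where "L1 ys = (x # filter (\<lambda>v. v \<in> A) ys) @ filter (\<lambda>v. v \<notin> A) ys" for ys
  define L2 where "L2 ys = filter (\<lambda>v. v \<in> A) ys @ (filter (\<lambda>v. v \<notin> A) ys @ [y])" for ys
  define ps where "ps p = zip (L1 (snd p)) (L2 (fst p))" for p
  have len: "length (filter (\<lambda>v. v \<in> A) ys) = i" "length (filter (\<lambda>v. v \<notin> A) ys) = c - i" "i \<le> c"
    if "ys \<in> mixed_tiles E V A B i" for ys i
  proof -
    have d: "distinct ys" "length ys = c" "card (set ys \<inter> A) = i"
      using that by (auto simp: mixed_tiles_def tile_def)
    show 1: "length (filter (\<lambda>v. v \<in> A) ys) = i"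
      using distinct_length_filter[OF d(1), of "\<lambda>v. v \<in> A"] d(3) by (simp add: Int_commute)
    show "length (filter (\<lambda>v. v \<notin> A) ys) = c - i" "i \<le> c"
      using sum_length_filter_compl[of "\<lambda>v. v \<in> A" ys] 1 d(2) by auto
  qed
  have lenL: "length (L1 d2) = c + 1" "length (L2 d1) = c + 1" if "d1 \<in> ?T1" "d2 \<in> ?T2" for d1 d2
    using len[OF that(1)] len[OF that(2)] by (auto simp: L1_def L2_def)
  have near: "\<theta> * ?n ^ q \<le> real (card (reach E V q (fst p) (snd p)))"
    if "d1 \<in> ?T1" "d2 \<in> ?T2" "p \<in> set (zip (L1 d2) (L2 d1))" for d1 d2 p
  proof -
    have l: "length (x # filter (\<lambda>v. v \<in> A) d2) = length (filter (\<lambda>v. v \<in> A) d1)"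
      using len[OF that(1)] len[OF that(2)] by simp
    have "p \<in> set (zip (x # filter (\<lambda>v. v \<in> A) d2) (filter (\<lambda>v. v \<in> A) d1)) \<or>
      p \<in> set (zip (filter (\<lambda>v. v \<notin> A) d2) (filter (\<lambda>v. v \<notin> A) d1 @ [y]))"
      using that(3) unfolding L1_def L2_def zip_append[OF l] by simp
    then have "fst p \<in> set (x # filter (\<lambda>v. v \<in> A) d2) \<and> snd p \<in> set (filter (\<lambda>v. v \<in> A) d1) \<or>
      fst p \<in> set (filter (\<lambda>v. v \<notin> A) d2) \<and> snd p \<in> set (filter (\<lambda>v. v \<notin> A) d1 @ [y])"
      by (metis prod.collapse set_zip_leftD set_zip_rightD)
    moreover have "set d1 \<subseteq> A \<union> B" "set d2 \<subseteq> A \<union> B" using that by (auto simp: mixed_tiles_def)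
    ultimately have "fst p \<in> A \<and> snd p \<in> A \<or> fst p \<in> B \<and> snd p \<in> B" using x y by auto
    then show ?thesis by (rule R)
  qed
  have fT: "finite ?T1" "finite ?T2" using fin by (auto simp: mixed_tiles_def)
  have dT: "length d = c" if "d \<in> mixed_tiles E V A B i" for d i using that by (simp add: mixed_tiles_def tuples_def)
  let ?f = "\<lambda>(p, zs). fst p @ snd p @ zs"
  let ?Z = "?f ` (SIGMA p:?T1 \<times> ?T2. exch E V q (ps p))"
  have "\<phi> * ?n ^ c * (\<phi> * ?n ^ c) * (\<theta> * ?n ^ q) ^ (c + 1) \<le> real (card (?T1 \<times> ?T2)) * (\<theta> * ?n ^ q) ^ (c + 1)"
    unfolding card_cartesian_product of_nat_mult using T1 T2 \<phi> \<theta> by (intro mult_right_mono mult_mono) auto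
  also have "\<dots> \<le> real (card ?Z)"
  proof (rule card_Sigma_image_ge)
    fix p assume "p \<in> ?T1 \<times> ?T2"
    then obtain d1 d2 where p: "p = (d1, d2)" "d1 \<in> ?T1" "d2 \<in> ?T2" by auto
    have "finite (exch E V q (ps p))" using exch_tuples fin finite_subset by (metis finite_tuples)
    moreover have "(\<theta> * ?n ^ q) ^ length (ps p) \<le> real (card (exch E V q (ps p)))"
      using near[OF p(2,3)] \<theta> unfolding ps_def p(1) by (intro card_exch fin) auto
    moreover have "length (ps p) = c + 1" using lenL[OF p(2,3)] by (simp add: ps_def p(1))
    ultimately show "finite (exch E V q (ps p)) \<and> (\<theta> * ?n ^ q) ^ (c + 1) \<le> real (card (exch E V q (ps p)))" by simp
  next
    show "inj_on ?f (SIGMA p:?T1 \<times> ?T2. exch E V q (ps p))"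
      by (rule inj_onI) (auto simp: append_eq_append_conv dT)
  qed (use fT in auto)
  also have "\<phi> * ?n ^ c * (\<phi> * ?n ^ c) * (\<theta> * ?n ^ q) ^ (c + 1) = \<phi> * \<phi> * \<theta> ^ (c + 1) * ?n ^ Q"
  proof -
    have "(\<theta> * ?n ^ q) ^ (c + 1) = \<theta> ^ (c + 1) * ?n ^ ((c + 1) * q)"
      by (metis power_mult_distrib power_mult mult.commute)
    then show ?thesis unfolding Q power_add[of ?n "c + c"] power_add[of ?n c c] by (simp only: mult_ac)
  qed
  finally have Z: "\<phi> * \<phi> * \<theta> ^ (c + 1) * ?n ^ Q \<le> real (card ?Z)" .
  have Zsub: "?Z \<subseteq> tuples Q V"
  proof (rule image_subsetI)
    fix r assume "r \<in> (SIGMA p:?T1 \<times> ?T2. exch E V q (ps p))"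
    then obtain d1 d2 zs where r: "r = ((d1, d2), zs)" "d1 \<in> ?T1" "d2 \<in> ?T2" "zs \<in> exch E V q (ps (d1, d2))" by auto
    have "zs \<in> tuples ((c + 1) * q) V" using exch_tuples r(4) lenL[OF r(2,3)] by (fastforce simp: ps_def)
    then show "?f r \<in> tuples Q V" using r by (auto simp: Q mixed_tiles_def tuples_def)
  qed
  show ?thesis
  proof (rule card_reach_ge[OF fin Zsub Z _ n])
    show "Q > 0" using c_pos by (simp add: Q)
    fix rs assume "rs \<in> ?Z" and d: "distinct rs" "x \<notin> set rs" "y \<notin> set rs"
    then obtain d1 d2 zs where r: "rs = d1 @ d2 @ zs" "d1 \<in> ?T1" "d2 \<in> ?T2" "zs \<in> exch E V q (ps (d1, d2))" by auto
    have tiles: "tileable E (set d1)" "tileable E (set d2)" using r by (auto simp: mixed_tiles_def intro: tileable_tile)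
    have l: "length (L1 d2) = length (L2 d1)" using lenL[OF r(2,3)] by simp
    have mf: "map fst (ps (d1, d2)) = L1 d2" "map snd (ps (d1, d2)) = L2 d1"
      using l by (simp_all add: ps_def)
    then have sf: "fst ` set (ps (d1, d2)) = set (L1 d2)" "snd ` set (ps (d1, d2)) = set (L2 d1)"
      by (metis set_map)+
    have sL: "set (L1 d2) = insert x (set d2)" "set (L2 d1) = insert y (set d1)" by (auto simp: L1_def L2_def)
    have dL: "distinct (L1 d2)" "distinct (L2 d1)" using d unfolding r(1) by (auto simp: L1_def L2_def)
    have a1: "tileable E (insert x (set d2) \<union> set zs)"
      using exch_tileable_fst[OF r(4)] d dL unfolding mf sf sL r(1) by auto
    have a2: "tileable E (insert y (set d1) \<union> set zs)"
      using exch_tileable_snd[OF r(4)] d dL unfolding mf sf sL r(1) by auto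
    have "tileable E (set d1 \<union> (insert x (set d2) \<union> set zs))"
      by (rule tileable_Un[OF tiles(1) a1]) (use d in \<open>auto simp: r(1)\<close>)
    moreover have "tileable E (set d2 \<union> (insert y (set d1) \<union> set zs))"
      by (rule tileable_Un[OF tiles(2) a2]) (use d in \<open>auto simp: r(1)\<close>)
    moreover have "set d1 \<union> (insert x (set d2) \<union> set zs) = insert x (set rs)"
      "set d2 \<union> (insert y (set d1) \<union> set zs) = insert y (set rs)" unfolding r(1) by auto
    ultimately show "tileable E (insert x (set rs)) \<and> tileable E (insert y (set rs))" by simp
  qed
qed

text \<open>
  Any two vertices have many common neighbours in \<open>A\<close> or many in \<open>B\<close>, and \<open>f\<close> records which. Completing the three pairs of a triple accordingly
  gives many tiles with \<open>val\<close> vertices in \<open>A\<close>. So if tiles with \<open>j\<close> vertices in \<open>A\<close> are rare, then few triples have value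
  \<open>j\<close>. If no two consecutive values were frequent, then by \<open>consecutive_values\<close> every choice of three vertices from \<open>A\<close> and three from
  \<open>B\<close> would contain a triple with a rare value, which is impossible because there are too few of those triples.
\<close>
lemma consecutive_mixed_tiles:
  fixes E :: "'a set set"
  assumes ks: "k = 3" "s = 3" and host: "host b V E" and b: "b \<ge> 1 / 3"
    and AB: "A \<subseteq> V" "B \<subseteq> V" "A \<inter> B = {}" "real (card (V - (A \<union> B))) \<le> real (card V) / 100"
    and \<alpha>: "\<alpha> > 0" "\<alpha> * real (card V) \<le> real (card A)" "\<alpha> * real (card V) \<le> real (card B)"
    and \<phi>: "\<phi> = \<alpha> ^ 6 / 3024" and \<psi>: "\<psi> = \<phi> / 8 ^ 3"
    and n: "1 \<le> real (card V)" "72 \<le> \<psi> * real (card V)" "72 \<le> \<alpha> ^ 6 * real (card V)"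
  shows "\<exists>j. \<psi> / 2 * real (card V) ^ 6 \<le> real (card (mixed_tiles E V A B j)) \<and>
    \<psi> / 2 * real (card V) ^ 6 \<le> real (card (mixed_tiles E V A B (Suc j)))"
proof (rule ccontr)
  let ?n = "real (card V)"
  have fin: "finite V" "finite A" "finite B" using hostD(1)[OF host] AB finite_subset by auto
  have k1: "k - 1 = 2" using ks by simp
  have c6: "c = 6" unfolding c_def using ks by simp
  have \<phi>0: "\<phi> > 0" and \<psi>0: "\<psi> > 0" unfolding \<psi> \<phi> using \<alpha>(1) by simp_all
  let ?N = "\<lambda>X u v. {w \<in> X. insert w {u, v} \<in> E}"
  define f where "f u v \<longleftrightarrow> ?n / 8 \<le> real (card (?N A u v))" for u v
  define S where "S u v = ?N (if f u v then A else B) u v" for u v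
  define val where "val us = of_bool (us ! 0 \<in> A) + of_bool (us ! 1 \<in> A) + of_bool (us ! 2 \<in> A)
     + (of_bool (f (us ! 0) (us ! 1)) + of_bool (f (us ! 1) (us ! 2)) + of_bool (f (us ! 0) (us ! 2)) :: nat)" for us
  define R where "R j \<longleftrightarrow> \<psi> / 2 * ?n ^ 6 \<le> real (card (mixed_tiles E V A B j))" for j
  define U where "U j = {us \<in> tuples 3 V. distinct us \<and> set us \<subseteq> A \<union> B \<and> val us = j}" for j
  assume "\<not> ?thesis"
  then have noR: "\<not> (R j \<and> R (Suc j))" for j by (simp add: R_def)
  have S: "?n / 8 \<le> real (card (S u v))" if "u \<in> V" "v \<in> V" "u \<noteq> v" for u v
  proof (cases "f u v")
    case True
    then show ?thesis by (simp add: S_def f_def)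
  next
    case False
    have "card {u, v} = k - 1" using that k1 by simp
    then have "b * ?n \<le> real (card (?N V u v))" using hostD(3)[OF host, of "{u, v}"] that by simp
    moreover have "1 / 3 * ?n \<le> b * ?n" using b by (intro mult_right_mono) auto
    moreover have "card (?N V u v) \<le> card (?N A u v \<union> (?N B u v \<union> (V - (A \<union> B))))"
      using fin by (intro card_mono) auto
    moreover have "card (?N A u v \<union> (?N B u v \<union> (V - (A \<union> B)))) \<le> card (?N A u v) + (card (?N B u v) + card (V - (A \<union> B)))"
      by (meson add_left_mono card_Un_le order_trans)
    moreover have "real (card (?N A u v)) < ?n / 8" using False by (simp add: f_def)
    \<comment> \<open>The pair has \<open>n / 3\<close> neighbours, of which at most \<open>n / 100\<close> lie outside \<open>A \<union> B\<close> and fewer than \<open>n / 8\<close> in \<open>A\<close>.\<close>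
    ultimately have "?n / 8 \<le> real (card (?N B u v))" using AB(4) n(1) by linarith
    moreover have "S u v = ?N B u v" using False by (simp add: S_def)
    ultimately show ?thesis by simp
  qed
  have Ssub: "S u v \<subseteq> A \<union> B" "S u v \<subseteq> V" "w \<in> S u v \<Longrightarrow> insert w {u, v} \<in> E" "w \<in> S u v \<Longrightarrow> w \<in> A \<longleftrightarrow> f u v" for u v w
    using AB by (auto simp: S_def split: if_splits)
  have few: "real (card (U j)) < \<phi> * ?n ^ 3" if "\<not> R j" for j
  proof (rule ccontr)
    assume "\<not> real (card (U j)) < \<phi> * ?n ^ 3"
    then have U: "\<phi> * ?n ^ 3 \<le> real (card (U j))" by simp
    let ?F = "\<lambda>us. S (us ! 0) (us ! 1) \<times> S (us ! 1) (us ! 2) \<times> S (us ! 0) (us ! 2)"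
    let ?f = "\<lambda>(us, p1, p2, p3). [us ! 0, p1, us ! 1, p2, us ! 2, p3]"
    let ?Z = "?f ` (SIGMA us:U j. ?F us)"
    have us: "length us = 3" "us ! 0 \<in> V" "us ! 1 \<in> V" "us ! 2 \<in> V" "us ! 0 \<noteq> us ! 1" "us ! 1 \<noteq> us ! 2" "us ! 0 \<noteq> us ! 2"
      "us ! 0 \<in> A \<union> B" "us ! 1 \<in> A \<union> B" "us ! 2 \<in> A \<union> B" "us = [us ! 0, us ! 1, us ! 2]" if "us \<in> U j" for us
    proof -
      have "length us = Suc (Suc (Suc 0))" using that by (simp add: U_def tuples_def)
      then obtain x y z where "us = [x, y, z]" by (auto simp: length_Suc_conv)
      then show "length us = 3" "us ! 0 \<in> V" "us ! 1 \<in> V" "us ! 2 \<in> V" "us ! 0 \<noteq> us ! 1" "us ! 1 \<noteq> us ! 2" "us ! 0 \<noteq> us ! 2"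
        "us ! 0 \<in> A \<union> B" "us ! 1 \<in> A \<union> B" "us ! 2 \<in> A \<union> B" "us = [us ! 0, us ! 1, us ! 2]"
        using that by (auto simp: U_def tuples_def nth_Cons')
    qed
    have "\<phi> * ?n ^ 3 * (?n / 8 * (?n / 8 * (?n / 8))) \<le> real (card (U j)) * (?n / 8 * (?n / 8 * (?n / 8)))"
      using U by (intro mult_right_mono) auto
    also have "\<dots> \<le> real (card ?Z)"
    proof (rule card_Sigma_image_ge)
      show "finite (U j)" using fin by (simp add: U_def)
      fix us assume u: "us \<in> U j"
      have "finite (S x y)" for x y using Ssub(2) fin finite_subset by blast
      then show "finite (?F us) \<and> ?n / 8 * (?n / 8 * (?n / 8)) \<le> real (card (?F us))"
        unfolding card_cartesian_product of_nat_mult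
        by (intro conjI finite_cartesian_product mult_mono S us[OF u]) auto
    next
      show "inj_on ?f (SIGMA us:U j. ?F us)"
      proof (rule inj_onI)
        fix a1 a2 assume P: "a1 \<in> (SIGMA us:U j. ?F us)" "a2 \<in> (SIGMA us:U j. ?F us)" "?f a1 = ?f a2"
        obtain u1 p1 q1 r1 u2 p2 q2 r2 where a: "a1 = (u1, p1, q1, r1)" "a2 = (u2, p2, q2, r2)" by (metis prod.exhaust)
        have u: "u1 \<in> U j" "u2 \<in> U j" using P(1,2) a by simp_all
        have "u1 = [u1 ! 0, u1 ! 1, u1 ! 2]" by (rule us(11)[OF u(1)])
        also have "\<dots> = [u2 ! 0, u2 ! 1, u2 ! 2]" using P(3) a by simp
        also have "\<dots> = u2" by (rule us(11)[OF u(2), symmetric])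
        finally have "u1 = u2" .
        then show "a1 = a2" using P(3) a by simp
      qed
    qed
    finally have "\<phi> * ?n ^ 3 * (?n / 8 * (?n / 8 * (?n / 8))) \<le> real (card ?Z)" .
    moreover have "\<phi> * ?n ^ 3 * (?n / 8 * (?n / 8 * (?n / 8))) = \<psi> * ?n ^ 6"
      by (simp add: \<psi> power3_eq_cube eval_nat_numeral One_nat_def)
    ultimately have Z: "\<psi> * ?n ^ 6 \<le> real (card ?Z)" by simp
    have Zsub: "?Z \<subseteq> tuples 6 V"
    proof (rule image_subsetI)
      fix r assume "r \<in> (SIGMA us:U j. ?F us)"
      then obtain v p1 p2 p3 where r: "r = (v, p1, p2, p3)" "v \<in> U j" "p1 \<in> S (v ! 0) (v ! 1)" "p2 \<in> S (v ! 1) (v ! 2)" "p3 \<in> S (v ! 0) (v ! 2)"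
        by auto
      then show "?f r \<in> tuples 6 V" using us[OF r(2)] Ssub(2) by (auto simp: tuples_def)
    qed
    have "\<psi> / 2 * ?n ^ 6 \<le> real (card {zs \<in> ?Z. distinct zs \<and> set zs \<inter> {} = {}})"
      using n by (intro card_clean_tuples fin Zsub Z) auto
    also have "\<dots> \<le> real (card (mixed_tiles E V A B j))"
      unfolding of_nat_le_iff
    proof (intro card_mono subsetI)
      fix zs assume zs: "zs \<in> {zs \<in> ?Z. distinct zs \<and> set zs \<inter> {} = {}}"
      then have "zs \<in> ?Z" by blast
      then obtain v p1 p2 p3 where r: "zs = [v ! 0, p1, v ! 1, p2, v ! 2, p3]" "v \<in> U j"
        "p1 \<in> S (v ! 0) (v ! 1)" "p2 \<in> S (v ! 1) (v ! 2)" "p3 \<in> S (v ! 0) (v ! 2)"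
        by auto
      have d: "distinct zs" using zs by simp
      have "tile E zs" using d unfolding r(1)
        by (rule triangle_tile[OF ks]) (use Ssub(3) r in auto)
      moreover have "set zs \<subseteq> A \<union> B" using us[OF r(2)] Ssub(1) r by auto
      moreover have "zs \<in> tuples c V" using Zsub zs unfolding c6 by blast
      moreover have "card (set zs \<inter> A) = val v"
      proof -
        have "card (set zs \<inter> A) = length (filter (\<lambda>w. w \<in> A) zs)"
          using distinct_length_filter[OF d, of "\<lambda>w. w \<in> A"] by (simp add: Int_commute)
        also have "\<dots> = val v"
          unfolding r(1) val_def using Ssub(4)[OF r(3)] Ssub(4)[OF r(4)] Ssub(4)[OF r(5)] by simp
        finally show ?thesis .
      qed
      moreover have "val v = j" using r(2) by (simp add: U_def)
      ultimately show "zs \<in> mixed_tiles E V A B j" by (simp add: mixed_tiles_def)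
    qed (use fin in \<open>auto simp: mixed_tiles_def\<close>)
    finally show False using that by (simp add: R_def)
  qed
  define M where "M = (\<lambda>(a, b, c, d, e, f). [a, b, c, d, e, f]) ` (A \<times> A \<times> A \<times> B \<times> B \<times> B)"
  let ?M = "{xs \<in> M. distinct xs \<and> set xs \<inter> {} = {}}"
  have "real (card M) = real (card A) * (real (card A) * (real (card A) * (real (card B) * (real (card B) * real (card B)))))"
    unfolding M_def by (subst card_image) (auto simp: inj_on_def card_cartesian_product)
  moreover have "(\<alpha> * ?n) * ((\<alpha> * ?n) * ((\<alpha> * ?n) * ((\<alpha> * ?n) * ((\<alpha> * ?n) * (\<alpha> * ?n)))))
      \<le> real (card A) * (real (card A) * (real (card A) * (real (card B) * (real (card B) * real (card B)))))"
    using \<alpha> by (intro mult_mono) auto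
  moreover have "(\<alpha> * ?n) * ((\<alpha> * ?n) * ((\<alpha> * ?n) * ((\<alpha> * ?n) * ((\<alpha> * ?n) * (\<alpha> * ?n))))) = \<alpha> ^ 6 * ?n ^ 6"
    by (simp add: eval_nat_numeral One_nat_def)
  ultimately have cM: "\<alpha> ^ 6 * ?n ^ 6 \<le> real (card M)" by simp
  have Msub: "M \<subseteq> tuples 6 V" using AB by (auto simp: M_def tuples_def)
  have M': "\<alpha> ^ 6 / 2 * ?n ^ 6 \<le> real (card ?M)"
    using n by (intro card_clean_tuples fin Msub cM) auto
  define J where "J = {(i, j, l, v) \<in> {..<6::nat} \<times> {..<6::nat} \<times> {..<6::nat} \<times> {..<7::nat}. i < j \<and> j < l \<and> \<not> R v}"
  have J: "J \<subseteq> {..<6} \<times> {..<6} \<times> {..<6} \<times> {..<7}" by (auto simp: J_def)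
  then have fJ: "finite J" by (rule finite_subset) auto
  \<comment> \<open>There are at most \<open>6 ^ 3 * 7 = 1512\<close> combinations of three indices and a value; the definition of \<open>\<phi>\<close> doubles this number.\<close>
  have cJ: "card J \<le> 1512" using card_mono[OF _ J] by (simp add: card_cartesian_product)
  define F where "F p = (case p of (i, j, l, v) \<Rightarrow> {xs \<in> tuples 6 V. [xs ! i, xs ! j, xs ! l] \<in> U v})" for p :: "nat \<times> nat \<times> nat \<times> nat"
  have cover: "?M \<subseteq> (\<Union>p\<in>J. F p)"
  proof
    fix xs assume xs: "xs \<in> ?M"
    then have "xs \<in> M" by blast
    then obtain a1 a2 a3 b1 b2 b3 where x: "xs = [a1, a2, a3, b1, b2, b3]" "a1 \<in> A" "a2 \<in> A" "a3 \<in> A" "b1 \<in> B" "b2 \<in> B" "b3 \<in> B"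
      by (auto simp: M_def)
    have d: "distinct xs" using xs by simp
    have inA: "xs ! i \<in> A \<longleftrightarrow> i < 3" if "i < 6" for i
    proof -
      have "i \<in> {0, 1, 2, 3, 4, 5}" using that by auto
      then show ?thesis using x AB(3) by (auto simp: nth_Cons')
    qed
    have "\<exists>i j l. i < j \<and> j < l \<and> l < 6 \<and> \<not> R (val [xs ! i, xs ! j, xs ! l])"
    proof (rule ccontr)
      assume no: "\<not> ?thesis"
      have "\<exists>j. R j \<and> R (Suc j)"
      proof (rule consecutive_values[where f = "\<lambda>i j. f (xs ! i) (xs ! j)"])
        fix i j l :: nat assume ijl: "i < j" "j < l" "l < 6"
        then have "R (val [xs ! i, xs ! j, xs ! l])" using no by blast
        then show "R (of_bool (i < 3) + of_bool (j < 3) + of_bool (l < 3)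
            + (of_bool (f (xs ! i) (xs ! j)) + of_bool (f (xs ! j) (xs ! l)) + of_bool (f (xs ! i) (xs ! l))))"
          using inA[of i] inA[of j] inA[of l] ijl by (simp add: val_def nth_Cons')
      qed
      then show False using noR by blast
    qed
    then obtain i j l where ijl: "i < j" "j < l" "l < 6" "\<not> R (val [xs ! i, xs ! j, xs ! l])" by blast
    let ?us = "[xs ! i, xs ! j, xs ! l]"
    have l6: "length xs = 6" using x by simp
    have "distinct ?us" using d ijl l6 by (simp add: nth_eq_iff_index_eq)
    moreover have "set xs \<subseteq> A \<union> B" using x by auto
    then have "set ?us \<subseteq> A \<union> B" using ijl l6 by (auto simp: subset_iff)
    moreover from this have "?us \<in> tuples 3 V" using AB by (auto simp: tuples_def)
    ultimately have "?us \<in> U (val ?us)" by (simp add: U_def)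
    moreover have "val ?us < 7" by (simp add: val_def of_bool_def)
    ultimately have "(i, j, l, val ?us) \<in> J" "xs \<in> F (i, j, l, val ?us)"
      using ijl xs Msub by (auto simp: J_def F_def)
    then show "xs \<in> (\<Union>p\<in>J. F p)" by blast
  qed
  have M0: "real (card ?M) > 0"
  proof -
    have "\<alpha> ^ 6 / 2 * ?n ^ 6 > 0" using \<alpha>(1) n(1) by (intro mult_pos_pos) auto
    then show ?thesis using M' by linarith
  qed
  have "J \<noteq> {}"
  proof
    assume "J = {}"
    then have "?M = {}" using cover by blast
    then have "real (card ?M) = 0" by (simp only: card.empty of_nat_0)
    then show False using M0 by (simp only: less_irrefl)
  qed
  then obtain p where p: "p \<in> J" "real (card ?M) \<le> real (card J) * real (card (F p))"
    using pigeonhole_card[OF fJ cover] fin by (auto simp: F_def split: prod.splits)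
  obtain i j l v where pp: "p = (i, j, l, v)" by (metis prod.exhaust)
  have ijl: "i < j" "j < l" "l < 6" "\<not> R v" using p(1) unfolding pp by (auto simp: J_def)
  have "card (F p) \<le> card (U v \<times> tuples 3 V)"
  proof (rule card_inj_on_le)
    let ?rest = "filter (\<lambda>t. t \<notin> {i, j, l}) [0..<6]"
    let ?g = "\<lambda>xs. ([xs ! i, xs ! j, xs ! l], map (\<lambda>t. xs ! t) ?rest)"
    have "length ?rest = card ({t. t \<notin> {i, j, l}} \<inter> {0..<6})"
      using distinct_length_filter[of "[0..<6]" "\<lambda>t. t \<notin> {i, j, l}"] by simp
    also have "{t. t \<notin> {i, j, l}} \<inter> {0..<6} = {0..<6} - {i, j, l}" by auto
    also have "card \<dots> = 3" using ijl by (subst card_Diff_subset) auto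
    finally have lr: "length ?rest = 3" .
    show "?g ` F p \<subseteq> U v \<times> tuples 3 V"
    proof (rule image_subsetI)
      fix xs assume x: "xs \<in> F p"
      then have "set xs \<subseteq> V" "length xs = 6" "[xs ! i, xs ! j, xs ! l] \<in> U v" by (auto simp: F_def pp tuples_def)
      moreover from this have "set (map (\<lambda>t. xs ! t) ?rest) \<subseteq> V" by (auto simp: subset_iff)
      ultimately show "?g xs \<in> U v \<times> tuples 3 V" using lr unfolding tuples_def by simp
    qed
    show "inj_on ?g (F p)"
    proof (rule inj_onI)
      fix xs ys assume a: "xs \<in> F p" "ys \<in> F p" "?g xs = ?g ys"
      then have l: "length xs = 6" "length ys = 6" by (auto simp: F_def pp tuples_def)
      have "xs ! t = ys ! t" if "t < 6" for t
      proof (cases "t \<in> {i, j, l}")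
        case False
        have "map (\<lambda>t. xs ! t) ?rest = map (\<lambda>t. ys ! t) ?rest" using a(3) by blast
        then have "\<forall>t\<in>set ?rest. xs ! t = ys ! t" by (simp only: map_eq_conv)
        moreover have "t \<in> set ?rest" using False that by simp
        ultimately show ?thesis by blast
      qed (use a(3) in auto)
      then show "xs = ys" using l by (intro nth_equalityI) auto
    qed
    show "finite (U v \<times> tuples 3 V)" using fin by (simp add: U_def)
  qed
  then have "card (F p) \<le> card (U v) * card V ^ 3" using fin by (simp add: card_cartesian_product card_tuples)
  then have "real (card (F p)) \<le> real (card (U v) * card V ^ 3)" by (simp only: of_nat_le_iff)
  also have "\<dots> = real (card (U v)) * ?n ^ 3" by simp
  also have "\<dots> < \<phi> * ?n ^ 3 * ?n ^ 3" using few[OF ijl(4)] n(1) by (intro mult_strict_right_mono) auto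
  finally have Fp: "real (card (F p)) < \<phi> * ?n ^ 6" by (simp add: mult.assoc power_add[symmetric])
  have "real (card ?M) \<le> 1512 * real (card (F p))"
    using p(2) cJ mult_right_mono[of "real (card J)" 1512 "real (card (F p))"] by linarith
  then have "\<alpha> ^ 6 / 2 * ?n ^ 6 < 1512 * (\<phi> * ?n ^ 6)" using M' Fp by linarith
  then show False by (simp add: \<phi>)
qed

lemma partners_commute: "x \<in> V \<Longrightarrow> y \<in> V \<Longrightarrow> x \<in> partners E V \<epsilon> y \<longleftrightarrow> y \<in> partners E V \<epsilon> x"
  by (simp add: partners_def Int_commute)

text \<open>
  If \<open>x\<close> and \<open>y\<close> are neither partners nor have many common partners, then by \<open>three_links_meet\<close> almost every vertex is a partner of exactly one of
  them, and two vertices that are partners of the same one only are partners of each other. These are the classes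
  \<open>A\<close> and \<open>B\<close> to which \<open>consecutive_mixed_tiles\<close> and \<open>reach_by_exchange\<close> apply.
\<close>
lemma all_pairs_reachable_triangle:
  assumes ks: "k = 3" "s = 3" and b: "b > 1 / 3"
  shows "\<exists>q \<theta>. \<theta> > 0 \<and> for_large_hosts b (\<lambda>(V :: 'a set) E.
    \<forall>x\<in>V. \<forall>y\<in>V. \<theta> * real (card V) ^ q \<le> real (card (reach E V q x y)))"
proof -
  have k1: "k - 1 = 2" using ks by simp
  have c6: "c = 6" unfolding c_def using ks by simp
  have b0: "b > 0" using b by simp
  define \<eta> where "\<eta> = b - 1 / 3"
  define \<epsilon> where "\<epsilon> = min (\<eta> / 2) (b\<^sup>2 / 4)"
  define \<alpha> where "\<alpha> = b\<^sup>2 / 8"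
  define \<xi> where "\<xi> = min (b\<^sup>2 / 8) (1 / 100)"
  define r where "r = (1 / 3 + \<eta> / 2) / b"
  define \<theta>1 where "\<theta>1 = (\<epsilon> * b) ^ 2 ^ c / 2"
  define \<theta>2 where "\<theta>2 = \<xi> * (\<theta>1 * \<theta>1) / 2"
  define \<phi> where "\<phi> = \<alpha> ^ 6 / 3024"
  define \<psi> where "\<psi> = \<phi> / 8 ^ 3"
  define \<theta>3 where "\<theta>3 = \<psi> / 2 * (\<psi> / 2) * \<theta>1 ^ (c + 1) / 2"
  define Q where "Q = c + c + (c + 1) * 5"
  have \<eta>: "\<eta> > 0" using b by (simp add: \<eta>_def)
  have \<epsilon>: "\<epsilon> > 0" using \<eta> b0 by (simp add: \<epsilon>_def)
  have \<alpha>: "\<alpha> > 0" using b0 by (simp add: \<alpha>_def)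
  have \<xi>: "\<xi> > 0" using b0 by (simp add: \<xi>_def)
  have r: "0 \<le> r" "r < 1" using b \<eta> by (simp_all add: r_def \<eta>_def field_simps)
  have \<theta>1: "\<theta>1 > 0" using \<epsilon> b0 by (simp add: \<theta>1_def)
  have \<theta>2: "\<theta>2 > 0" using \<xi> \<theta>1 by (simp add: \<theta>2_def)
  have \<psi>: "\<psi> > 0" unfolding \<psi>_def \<phi>_def using \<alpha> by simp
  have \<theta>3: "\<theta>3 > 0" using \<psi> \<theta>1 by (simp add: \<theta>3_def)
  obtain \<theta>a where \<theta>a: "\<theta>a > 0" and eva: "for_large_hosts b (\<lambda>(V :: 'a set) E.
    \<forall>x\<in>V. \<forall>y\<in>V. \<theta>1 * real (card V) ^ 5 \<le> real (card (reach E V 5 x y)) \<longrightarrow>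
       \<theta>a * real (card V) ^ (5 + 7 * c) \<le> real (card (reach E V (5 + 7 * c) x y)))" (is "for_large_hosts b ?Pa")
    using reach_pad[OF b0 \<theta>1, of 5 7] by auto
  obtain \<theta>b where \<theta>b: "\<theta>b > 0" and evb: "for_large_hosts b (\<lambda>(V :: 'a set) E.
    \<forall>x\<in>V. \<forall>y\<in>V. \<theta>2 * real (card V) ^ (2 * 5 + 1) \<le> real (card (reach E V (2 * 5 + 1) x y)) \<longrightarrow>
       \<theta>b * real (card V) ^ (2 * 5 + 1 + 6 * c) \<le> real (card (reach E V (2 * 5 + 1 + 6 * c) x y)))"
    (is "for_large_hosts b ?Pb")
    using reach_pad[OF b0 \<theta>2, of "2 * 5 + 1" 6] by auto
  \<comment> \<open>One step, two steps and the exchange give lists of lengths 5, 11 and 47; copies of size 6 pad the first two to 47.\<close>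
  have Q: "5 + 7 * c = Q" "2 * 5 + 1 + 6 * c = Q" by (simp_all add: Q_def c6)
  define \<theta> where "\<theta> = min \<theta>a (min \<theta>b \<theta>3)"
  have \<theta>: "\<theta> > 0" "\<theta> \<le> \<theta>a" "\<theta> \<le> \<theta>b" "\<theta> \<le> \<theta>3" using \<theta>a \<theta>b \<theta>3 by (auto simp: \<theta>_def)
  have "eventually (\<lambda>n. 1 \<le> 1 * real n \<and> 1 \<le> (1 - r) * real n
     \<and> 2 * ((real (c - 1))\<^sup>2 + real (c - 1) * 2) \<le> (\<epsilon> * b) ^ 2 ^ c * real n
     \<and> 2 * ((real (k - 2))\<^sup>2 + real (k - 2)) \<le> 1 * real n
     \<and> 2 * ((real (2 * 5 + 1))\<^sup>2 + real (2 * 5 + 1) * 2) \<le> \<xi> * (\<theta>1 * \<theta>1) * real n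
     \<and> 72 \<le> \<psi> * real n \<and> 72 \<le> \<alpha> ^ 6 * real n
     \<and> 2 * ((real Q)\<^sup>2 + real Q * 2) \<le> \<psi> / 2 * (\<psi> / 2) * \<theta>1 ^ (c + 1) * real n) sequentially" (is "eventually ?C _")
    by (intro eventually_conj eventually_le_mult) (use r \<epsilon> b0 \<xi> \<theta>1 \<psi> \<alpha> in auto)
  with eva evb have "for_large_hosts b (\<lambda>(V :: 'a set) E.
    \<forall>x\<in>V. \<forall>y\<in>V. \<theta> * real (card V) ^ Q \<le> real (card (reach E V Q x y)))"
  proof (rule for_large_hosts_combine, intro ballI)
    fix V :: "'a set" and E x y
    assume host: "host b V E" and pa: "?Pa V E" and pb: "?Pb V E" and nC: "?C (card V)" and xy: "x \<in> V" "y \<in> V"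
    define n where "n = card V"
    note cV = n_def[symmetric]
    have n: "?C n" using nC cV by simp
    have fin: "finite V" using hostD[OF host] by simp
    let ?P = "partners E V \<epsilon>"
    have Psub: "?P z \<subseteq> V" for z by (auto simp: partners_def)
    have link: "(1 / 3 + \<epsilon>) * real (card V) ^ 2 \<le> real (card (link E V w))" if "w \<in> V" for w
    proof -
      have "r * b = 1 / 3 + \<eta> / 2" using b0 by (simp add: r_def)
      moreover have "r * b * real (card V) ^ 2 \<le> real (card (link E V w))"
        using card_link_ge_nearly[OF host that b0 ks(1) r(1)] n cV by simp
      moreover have "(1 / 3 + \<epsilon>) * real (card V) ^ 2 \<le> (1 / 3 + \<eta> / 2) * real (card V) ^ 2"
        by (intro mult_right_mono) (auto simp: \<epsilon>_def)
      ultimately show ?thesis by simp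
    qed
    note meet = three_links_meet[OF host ks(1) _ _ _ link]
    have Pcard: "b\<^sup>2 / 4 * real n \<le> real (card (?P z))" if "z \<in> V" for z
    proof -
      have "partners E V (b\<^sup>2 / 4) z \<subseteq> ?P z"
      proof
        fix w assume w: "w \<in> partners E V (b\<^sup>2 / 4) z"
        have "\<epsilon> * real (card V) ^ (k - 1) \<le> b\<^sup>2 / 4 * real (card V) ^ (k - 1)"
          by (intro mult_right_mono) (auto simp: \<epsilon>_def)
        then show "w \<in> ?P z" using w by (auto simp: partners_def)
      qed
      then have "card (partners E V (b\<^sup>2 / 4) z) \<le> card (?P z)"
        using fin Psub finite_subset by (intro card_mono) blast+
      then show ?thesis using card_partners_ge[OF host that b0] n cV by simp
    qed
    have reach1: "\<theta>1 * real (card V) ^ 5 \<le> real (card (reach E V 5 u v))" if "u \<in> V" "v \<in> ?P u" for u v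
      using reach_if_common_link[OF host that(1) _ b0 \<epsilon>, of v] that(2) n cV
      by (auto simp: partners_def \<theta>1_def c6)
    have weaken: "\<theta> * real n ^ Q \<le> real (card (reach E V Q x y))"
      if "t * real n ^ Q \<le> real (card (reach E V Q x y))" "\<theta> \<le> t" for t
      using that mult_right_mono[of \<theta> t "real n ^ Q"] by simp
    have "\<theta> * real n ^ Q \<le> real (card (reach E V Q x y))"
    proof (cases "y \<in> ?P x")
      case True
      then have "\<theta>a * real n ^ Q \<le> real (card (reach E V Q x y))"
        using pa xy reach1[OF xy(1) True] unfolding cV Q by blast
      then show ?thesis by (rule weaken) (rule \<theta>)
    next
      case far: False
      show ?thesis
      proof (cases "\<xi> * real n \<le> real (card (?P x \<inter> ?P y))")
        case True
        have "\<theta>2 * real (card V) ^ (2 * 5 + 1) \<le> real (card (reach E V (2 * 5 + 1) x y))"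
          unfolding \<theta>2_def
        proof (rule reach_two_step[OF fin, of "?P x \<inter> ?P y"])
          show "?P x \<inter> ?P y \<subseteq> V" using Psub by blast
          show "\<xi> * real (card V) \<le> real (card (?P x \<inter> ?P y))" using True cV by simp
        qed (use \<xi> \<theta>1 reach1 xy n cV in auto)
        then have "\<theta>b * real n ^ Q \<le> real (card (reach E V Q x y))"
          using pb xy unfolding cV Q by blast
        then show ?thesis by (rule weaken) (rule \<theta>)
      next
        case few: False
        define A where "A = ?P x - ?P y"
        define B where "B = ?P y - ?P x"
        have AB: "A \<subseteq> V" "B \<subseteq> V" "A \<inter> B = {}" using Psub by (auto simp: A_def B_def)
        have xy': "x \<notin> ?P y" using far partners_commute[OF xy, of E \<epsilon>] by simp
        have self: "z \<in> ?P z" if "z \<in> V" for z using meet[OF that that that] by blast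
        have "V - (A \<union> B) \<subseteq> ?P x \<inter> ?P y"
        proof
          fix z assume z: "z \<in> V - (A \<union> B)"
          then have "z \<in> ?P x \<or> z \<in> ?P y" using meet[of z x y] xy xy' by blast
          then show "z \<in> ?P x \<inter> ?P y" using z by (auto simp: A_def B_def)
        qed
        then have "card (V - (A \<union> B)) \<le> card (?P x \<inter> ?P y)"
          using fin Psub finite_subset by (intro card_mono) blast+
        moreover have "\<xi> * real n \<le> 1 / 100 * real n" by (intro mult_right_mono) (auto simp: \<xi>_def)
        ultimately have small: "real (card (V - (A \<union> B))) \<le> real (card V) / 100" using few cV by simp
        have large: "\<alpha> * real (card V) \<le> real (card (?P u - ?P v))" if "u \<in> V" "?P u \<inter> ?P v = ?P x \<inter> ?P y" for u v
        proof -
          have fP: "finite (?P u)" using Psub fin finite_subset by blast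
          then have "card (?P u) = card (?P u \<inter> ?P v) + card (?P u - ?P v)"
            by (metis Diff_Diff_Int Diff_disjoint Int_Diff_Un Int_commute card_Un_disjoint finite_Diff finite_Int inf_le1 Int_Diff_disjoint)
          moreover have "\<xi> * real n \<le> b\<^sup>2 / 8 * real n" by (intro mult_right_mono) (auto simp: \<xi>_def)
          ultimately show ?thesis using Pcard[OF that(1)] few that(2) cV unfolding \<alpha>_def by simp
        qed
        have clique: "\<theta>1 * real (card V) ^ 5 \<le> real (card (reach E V 5 u v))"
          if "u \<in> A \<and> v \<in> A \<or> u \<in> B \<and> v \<in> B" for u v
        proof -
          have uv: "u \<in> V" "v \<in> V" using that AB by auto
          have "v \<in> ?P u"
            using that meet[of v u y] meet[of v u x] uv xy by (auto simp: A_def B_def)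
          then show ?thesis using reach1 uv by blast
        qed
        obtain j where j: "\<psi> / 2 * real (card V) ^ 6 \<le> real (card (mixed_tiles E V A B j))"
          "\<psi> / 2 * real (card V) ^ 6 \<le> real (card (mixed_tiles E V A B (Suc j)))"
          using consecutive_mixed_tiles[OF ks host _ AB small \<alpha> _ _ \<phi>_def \<psi>_def] b n cV
            large[OF xy(1), of y] large[OF xy(2), of x] by (auto simp: A_def B_def Int_commute)
        have "\<theta>3 * real (card V) ^ Q \<le> real (card (reach E V Q x y))"
          unfolding \<theta>3_def
          by (rule reach_by_exchange[OF fin AB(3) _ _ \<theta>1 _ clique j(2)[folded c6] j(1)[folded c6] Q_def])
            (use self xy far xy' \<psi> n cV in \<open>auto simp: A_def B_def\<close>)
        then show ?thesis using cV \<theta>(4) by (intro weaken[of \<theta>3]) simp_all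
      qed
    qed
    then show "\<theta> * real (card V) ^ Q \<le> real (card (reach E V Q x y))" unfolding cV .
  qed
  then show ?thesis using \<theta>(1) by blast
qed

lemma cover_density_pos: "real \<tau> / real c > 0" using s c_pos by (simp add: \<tau>_def)

lemma all_pairs_reachable:
  assumes b: "b > real \<tau> / real c"
  shows "\<exists>q \<theta>. \<theta> > 0 \<and> for_large_hosts b (\<lambda>(V :: 'a set) E.
    \<forall>x\<in>V. \<forall>y\<in>V. \<theta> * real (card V) ^ q \<le> real (card (reach E V q x y)))"
proof (cases "k = 3 \<and> s = 3")
  case True
  then have "c = 6" "\<tau> = 2" unfolding c_def \<tau>_def by simp_all
  then show ?thesis using all_pairs_reachable_triangle True b by simp
next
  case False
  moreover have "b > 0" using b cover_density_pos by linarith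
  ultimately show ?thesis by (rule all_pairs_reachable_not_triangle)
qed

section \<open>Absorbers and perfect tilings\<close>

definition absorbers :: "'a set set \<Rightarrow> 'a set \<Rightarrow> nat \<Rightarrow> 'a list \<Rightarrow> 'a list set" where
  "absorbers E V Q ws = {zs \<in> tuples Q V. distinct zs \<and> set zs \<inter> set ws = {} \<and>
     tileable E (set zs) \<and> tileable E (set ws \<union> set zs)}"

text \<open>
  An absorber for \<open>ws\<close> consists of a tile \<open>T\<close> and of lists that exchange the vertices of \<open>ws\<close> for those of \<open>T\<close>. It is tiled by
  combining these lists with \<open>T\<close>. Together with \<open>ws\<close> it is tiled by combining the lists with \<open>ws\<close>, which
  leaves \<open>T\<close> as a tile of its own.
\<close>
lemma many_absorbers:
  assumes b: "b > real \<tau> / real c"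
  shows "\<exists>Q \<theta>. Q > 0 \<and> \<theta> > 0 \<and> for_large_hosts b (\<lambda>(V :: 'a set) E.
    \<forall>ws\<in>tuples c V. distinct ws \<longrightarrow> \<theta> * real (card V) ^ Q \<le> real (card (absorbers E V Q ws)))"
proof -
  have b0: "b > 0" using b cover_density_pos by linarith
  obtain q \<theta>1 where \<theta>1: "\<theta>1 > 0" and ev1: "for_large_hosts b (\<lambda>(V :: 'a set) E.
    \<forall>x\<in>V. \<forall>y\<in>V. \<theta>1 * real (card V) ^ q \<le> real (card (reach E V q x y)))" (is "for_large_hosts b ?R")
    using all_pairs_reachable[OF b] by blast
  obtain \<theta>T where \<theta>T: "\<theta>T > 0" and evT: "for_large_hosts b (\<lambda>(V :: 'a set) E.
    \<theta>T * real (card V) ^ c \<le> real (card {ys \<in> tuples c V. tile E ys}))" using many_tiles[OF b0] by blast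
  define Q where "Q = c + c * q"
  define \<theta> where "\<theta> = \<theta>T * \<theta>1 ^ c"
  have \<theta>: "\<theta> > 0" using \<theta>1 \<theta>T by (simp add: \<theta>_def)
  have "eventually (\<lambda>n. 2 * ((real Q)\<^sup>2 + real Q * real c) \<le> \<theta> * real n) sequentially"
    by (rule eventually_le_mult[OF \<theta>])
  with ev1 evT have "for_large_hosts b (\<lambda>(V :: 'a set) E.
    \<forall>ws\<in>tuples c V. distinct ws \<longrightarrow> \<theta> / 2 * real (card V) ^ Q \<le> real (card (absorbers E V Q ws)))"
  proof (rule for_large_hosts_combine, intro ballI impI)
    fix V :: "'a set" and E ws
    assume host: "host b V E" and a1: "?R V E" and aT: "\<theta>T * real (card V) ^ c \<le> real (card {ys \<in> tuples c V. tile E ys})"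
      and n: "2 * ((real Q)\<^sup>2 + real Q * real c) \<le> \<theta> * real (card V)" and ws: "ws \<in> tuples c V" "distinct ws"
    let ?n = "real (card V)"
    have fin: "finite V" using hostD[OF host] by simp
    have lws: "length ws = c" "set ws \<subseteq> V" using ws by (auto simp: tuples_def)
    let ?T = "{ys \<in> tuples c V. tile E ys}"
    let ?f = "\<lambda>(T, zs). T @ zs"
    let ?Z = "?f ` (SIGMA T:?T. exch E V q (zip ws T))"
    have lT: "length T = c" "set T \<subseteq> V" "distinct T" "tile E T" if "T \<in> ?T" for T using that by (auto simp: tuples_def tile_def)
    have "\<theta>T * ?n ^ c * (\<theta>1 * ?n ^ q) ^ c \<le> real (card ?T) * (\<theta>1 * ?n ^ q) ^ c"
      using aT \<theta>1 by (intro mult_right_mono) auto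
    also have "\<dots> \<le> real (card ?Z)"
    proof (rule card_Sigma_image_ge)
      show "finite ?T" using fin by simp
      fix T assume T: "T \<in> ?T"
      have "finite (exch E V q (zip ws T))" using exch_tuples fin finite_subset by (metis finite_tuples)
      moreover have "(\<theta>1 * ?n ^ q) ^ length (zip ws T) \<le> real (card (exch E V q (zip ws T)))"
      proof (rule card_exch[OF fin])
        show "0 \<le> \<theta>1 * ?n ^ q" using \<theta>1 by simp
        fix p assume "p \<in> set (zip ws T)"
        then have "fst p \<in> V" "snd p \<in> V" using lT(2)[OF T] lws(2) by (metis in_mono prod.collapse set_zip_leftD, metis in_mono prod.collapse set_zip_rightD)
        then show "\<theta>1 * ?n ^ q \<le> real (card (reach E V q (fst p) (snd p)))" using a1 by blast
      qed
      ultimately show "finite (exch E V q (zip ws T)) \<and> (\<theta>1 * ?n ^ q) ^ c \<le> real (card (exch E V q (zip ws T)))"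
        using lT(1)[OF T] lws by simp
    next
      show "inj_on ?f (SIGMA T:?T. exch E V q (zip ws T))"
        by (rule inj_onI) (auto simp: append_eq_append_conv tuples_def)
    qed
    also have "\<theta>T * ?n ^ c * (\<theta>1 * ?n ^ q) ^ c = \<theta> * ?n ^ Q"
    proof -
      have "(\<theta>1 * ?n ^ q) ^ c = \<theta>1 ^ c * ?n ^ (c * q)"
        by (metis power_mult_distrib power_mult mult.commute)
      then show ?thesis unfolding Q_def \<theta>_def power_add by (simp only: mult_ac)
    qed
    finally have Z: "\<theta> * ?n ^ Q \<le> real (card ?Z)" .
    have Zsub: "?Z \<subseteq> tuples Q V"
    proof (rule image_subsetI)
      fix r assume "r \<in> (SIGMA T:?T. exch E V q (zip ws T))"
      then obtain T zs where r: "r = (T, zs)" "T \<in> ?T" "zs \<in> exch E V q (zip ws T)" by auto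
      have "zs \<in> tuples (length (zip ws T) * q) V" using exch_tuples r(3) by blast
      then have "zs \<in> tuples (c * q) V" using lT(1)[OF r(2)] lws by simp
      then show "?f r \<in> tuples Q V" using r lT[OF r(2)] by (simp add: tuples_def Q_def)
    qed
    have n': "2 * ((real Q)\<^sup>2 + real Q * real (card (set ws))) \<le> \<theta> * ?n"
      using n ws lws by (simp add: distinct_card)
    have "\<theta> / 2 * ?n ^ Q \<le> real (card {zs \<in> ?Z. distinct zs \<and> set zs \<inter> set ws = {}})"
      by (rule card_clean_tuples[OF fin _ Zsub _ Z n']) (use c_pos in \<open>auto simp: Q_def\<close>)
    also have "\<dots> \<le> real (card (absorbers E V Q ws))"
      unfolding of_nat_le_iff
    proof (intro card_mono subsetI)
      fix rs assume rs: "rs \<in> {zs \<in> ?Z. distinct zs \<and> set zs \<inter> set ws = {}}"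
      then obtain T zs where r: "rs = T @ zs" "T \<in> ?T" "zs \<in> exch E V q (zip ws T)" by auto
      have d: "distinct rs" "set rs \<inter> set ws = {}" using rs by simp_all
      have Qr: "rs \<in> tuples Q V" using rs Zsub by blast
      have mf: "map fst (zip ws T) = ws" "map snd (zip ws T) = T" using lT(1)[OF r(2)] lws by simp_all
      then have sf: "fst ` set (zip ws T) = set ws" "snd ` set (zip ws T) = set T" by (metis set_map)+
      have 1: "tileable E (set ws \<union> set zs)"
        using exch_tileable_fst[OF r(3)] d ws(2) unfolding mf sf r(1) by auto
      have 2: "tileable E (set T \<union> set zs)"
        using exch_tileable_snd[OF r(3)] d lT(3)[OF r(2)] unfolding mf sf r(1) by auto
      have "tileable E (set T \<union> (set ws \<union> set zs))"
        by (rule tileable_Un[OF tileable_tile[OF lT(4)[OF r(2)]] 1]) (use d in \<open>auto simp: r(1)\<close>)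
      moreover have "set T \<union> (set ws \<union> set zs) = set ws \<union> set rs" unfolding r(1) by auto
      ultimately show "rs \<in> absorbers E V Q ws" using d Qr 2 unfolding absorbers_def r(1) by simp
    qed (use fin in \<open>simp add: absorbers_def\<close>)
    finally show "\<theta> / 2 * ?n ^ Q \<le> real (card (absorbers E V Q ws))" .
  qed
  then show ?thesis using \<theta> c_pos by (intro exI[of _ Q] exI[of _ "\<theta> / 2"]) (auto simp: Q_def)
qed

text \<open>
  Cut the leftover into \<open>t\<close> sets of size \<open>c\<close> and assign to each of them an absorber that is still unused.
\<close>
lemma absorb_leftover:
  assumes "finite F" "disjoint_family_on set F" "\<And>zs. zs \<in> F \<Longrightarrow> tileable E (set zs)"
    and "finite W" "card W = t * c" "W \<inter> \<Union> (set ` F) = {}"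
    and "\<And>ws. distinct ws \<Longrightarrow> length ws = c \<Longrightarrow> set ws \<subseteq> W \<Longrightarrow> t \<le> card {zs \<in> F. tileable E (set ws \<union> set zs)}"
  shows "tileable E (W \<union> \<Union> (set ` F))"
  using assms
proof (induction t arbitrary: F W)
  case 0
  then have "W = {}" by simp
  moreover have "tileable E (\<Union> (set ` F))" using 0 by (intro tileable_UN) auto
  ultimately show ?case by simp
next
  case (Suc t)
  have "c \<le> card W" using Suc.prems(5) by simp
  then obtain W1 where W1: "W1 \<subseteq> W" "card W1 = c" "finite W1" by (rule obtain_subset_with_card_n)
  obtain ws where ws: "set ws = W1" "distinct ws" using finite_distinct_list[OF W1(3)] by blast
  then have lws: "length ws = c" using W1 distinct_card by metis
  have "Suc t \<le> card {zs \<in> F. tileable E (set ws \<union> set zs)}" using Suc.prems(7)[OF ws(2) lws] ws W1 by simp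
  then have "{zs \<in> F. tileable E (set ws \<union> set zs)} \<noteq> {}" by (metis card.empty not_less_eq_eq le0)
  then obtain zs where zs: "zs \<in> F" "tileable E (set ws \<union> set zs)" by blast
  let ?F = "F - {zs}" and ?W = "W - W1"
  have dis: "set zs \<inter> \<Union> (set ` ?F) = {}"
    using Suc.prems(2) zs(1) unfolding disjoint_family_on_def by blast
  have "tileable E (?W \<union> \<Union> (set ` ?F))"
  proof (rule Suc.IH)
    show "disjoint_family_on set ?F" using Suc.prems(2) by (auto simp: disjoint_family_on_def)
    show "card ?W = t * c" using Suc.prems(4,5) W1 by (simp add: card_Diff_subset)
    show "?W \<inter> \<Union> (set ` ?F) = {}" using Suc.prems(6) by blast
    fix us assume us: "distinct us" "length us = c" "set us \<subseteq> ?W"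
    then have "Suc t \<le> card {zs \<in> F. tileable E (set us \<union> set zs)}" using Suc.prems(7)[of us] by blast
    also have "\<dots> \<le> card (insert zs {zs \<in> ?F. tileable E (set us \<union> set zs)})"
      using Suc.prems(1) by (intro card_mono) auto
    also have "\<dots> \<le> Suc (card {zs \<in> ?F. tileable E (set us \<union> set zs)})"
      using Suc.prems(1) by (simp add: card_insert_if)
    finally show "t \<le> card {zs \<in> ?F. tileable E (set us \<union> set zs)}" by simp
  qed (use Suc.prems in auto)
  then have "tileable E ((?W \<union> \<Union> (set ` ?F)) \<union> (set ws \<union> set zs))"
  proof (rule tileable_Un[OF _ zs(2)])
    show "(?W \<union> \<Union> (set ` ?F)) \<inter> (set ws \<union> set zs) = {}"
      using dis Suc.prems(6) ws(1) W1(1) zs(1) by blast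
  qed
  moreover have "(?W \<union> \<Union> (set ` ?F)) \<union> (set ws \<union> set zs) = W \<union> \<Union> (set ` F)"
    using ws(1) W1(1) zs(1) by blast
  ultimately show ?case by simp
qed

lemma host_after_deletion:
  assumes host: "host b V E" and A: "A \<subseteq> V" and d: "real (card A) \<le> d * real (card V)"
    and b': "b' + d \<le> b" "b' \<ge> 0"
  shows "host b' (V - A) {e \<in> E. e \<subseteq> V - A}"
  unfolding host_def
proof (intro conjI ballI allI impI)
  have fin: "finite V" using hostD[OF host] by simp
  then show "finite (V - A)" by simp
  fix e assume "e \<in> {e \<in> E. e \<subseteq> V - A}"
  then show "e \<subseteq> V - A" "card e = k" using hostD(2)[OF host] by auto
next
  have fin: "finite V" "finite A" using hostD[OF host] A finite_subset by auto
  fix S assume S: "S \<subseteq> V - A" "card S = k - 1"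
  have "b * real (card V) \<le> real (card {v \<in> V. insert v S \<in> E})" using hostD(3)[OF host, of S] S by auto
  moreover have "card {v \<in> V. insert v S \<in> E} \<le> card ({v \<in> V - A. insert v S \<in> {e \<in> E. e \<subseteq> V - A}} \<union> A)"
    using fin S by (intro card_mono) auto
  moreover have "card ({v \<in> V - A. insert v S \<in> {e \<in> E. e \<subseteq> V - A}} \<union> A)
      \<le> card {v \<in> V - A. insert v S \<in> {e \<in> E. e \<subseteq> V - A}} + card A" by (rule card_Un_le)
  ultimately have "b * real (card V) \<le> real (card {v \<in> V - A. insert v S \<in> {e \<in> E. e \<subseteq> V - A}}) + real (card A)"
    by linarith
  moreover have "(b' + d) * real (card V) \<le> b * real (card V)" using b' by (intro mult_right_mono) auto
  moreover have "b' * real (card (V - A)) \<le> b' * real (card V)"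
    using b' fin by (intro mult_left_mono) (auto intro: card_mono)
  ultimately show "b' * real (card (V - A)) \<le> real (card {v \<in> V - A. insert v S \<in> {e \<in> E. e \<subseteq> V - A}})"
    using d by (simp add: algebra_simps)
qed

text \<open>
  The reserved absorbers cover a proportion of the vertices that is small in terms of \<open>\<eta>\<close>, so the remaining host still satisfies
  the codegree condition with \<open>\<eta> / 2\<close>. It is tiled up to a leftover whose size is at most the number of reserved absorbers of any \<open>c\<close>-set and
  a multiple of \<open>c\<close>, so it can be absorbed.
\<close>
lemma perfect_tiling:
  assumes \<eta>: "\<eta> > 0"
  shows "for_large_hosts (real \<tau> / real c + \<eta>) (\<lambda>(V :: 'a set) E. c dvd card V \<longrightarrow> tileable E V)"
proof -
  define b where "b = real \<tau> / real c + \<eta>"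
  have b: "b > real \<tau> / real c" using \<eta> by (simp add: b_def)
  obtain Q \<theta> where Q: "Q > 0" and \<theta>: "\<theta> > 0" and evA: "for_large_hosts b (\<lambda>(V :: 'a set) E.
    \<forall>ws\<in>tuples c V. distinct ws \<longrightarrow> \<theta> * real (card V) ^ Q \<le> real (card (absorbers E V Q ws)))" (is "for_large_hosts b ?A")
    using many_absorbers[OF b] by blast
  have Q0: "real Q > 0" using Q by simp
  \<comment> \<open>The family has about \<open>\<mu> * n\<close> members: few enough for the greedy selection, for losing at most \<open>\<eta> / 2\<close> in the codegree, and for keeping half of the vertices.\<close>
  define \<mu> where "\<mu> = min (\<theta> / (2 * (real Q)\<^sup>2)) (min (\<eta> / (2 * real Q)) (1 / (2 * real Q)))"
  have "\<mu> \<le> \<theta> / (2 * (real Q)\<^sup>2)" "\<mu> \<le> \<eta> / (2 * real Q)" "\<mu> \<le> 1 / (2 * real Q)" by (auto simp: \<mu>_def)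
  then have \<mu>': "2 * (real Q)\<^sup>2 * \<mu> \<le> \<theta>" "real Q * \<mu> \<le> \<eta> / 2" "real Q * \<mu> \<le> 1 / 2"
    using Q0 by (simp_all add: pos_le_divide_eq mult_ac)
  have \<mu>: "\<mu> > 0" using \<theta> \<eta> Q0 by (simp add: \<mu>_def)
  define \<gamma> where "\<gamma> = \<theta> * \<mu> / 8"
  have \<gamma>: "\<gamma> > 0" using \<theta> \<mu> by (simp add: \<gamma>_def)
  have \<eta>2: "\<eta> / 2 > 0" using \<eta> by simp
  obtain N where N: "\<And>(V :: 'a set) E. host (real \<tau> / real c + \<eta> / 2) V E \<Longrightarrow> N \<le> card V \<Longrightarrow>
    \<exists>X\<subseteq>V. tileable E X \<and> real (card (V - X)) \<le> \<gamma> * real (card V)"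
    using almost_perfect_tiling[OF \<eta>2 \<gamma>] unfolding for_large_hosts_def by blast
  have "eventually (\<lambda>n. real c \<le> 1 * real n \<and> real c * ln (real n) + \<theta> / 4 \<le> \<gamma> * real n \<and> 2 * real N \<le> 1 * real n) sequentially"
    (is "eventually ?C _")
    by (intro eventually_conj eventually_le_mult eventually_ln_le \<gamma>) auto
  with evA evA show ?thesis
    unfolding b_def[symmetric]
  proof (rule for_large_hosts_combine, intro impI)
    fix V :: "'a set" and E
    assume host: "host b V E" and aA: "?A V E" and nC: "?C (card V)" and "c dvd card V"
    define n where "n = card V"
    note cV = n_def[symmetric]
    have n: "?C n" and dvd: "c dvd n" using nC \<open>c dvd card V\<close> cV by simp_all
    have fin: "finite V" using hostD[OF host] by simp
    have cn: "c \<le> n" using n by simp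
    have n0: "real n > 0" using cn c_pos by simp
    have V0: "V \<noteq> {}" using cV n0 by auto
    define m where "m = nat \<lfloor>\<mu> * real n\<rfloor>"
    have "\<mu> * real n \<ge> 0" using \<mu> by simp
    then have m: "real m \<le> \<mu> * real n" "\<mu> * real n - 1 \<le> real m" unfolding m_def by linarith+
    define W where "W = {ws \<in> tuples c V. distinct ws}"
    define G where "G = {zs \<in> tuples Q V. tileable E (set zs)}"
    have W: "finite W" "W \<noteq> {}"
    proof -
      show "finite W" using fin by (simp add: W_def)
      obtain S where "S \<subseteq> V" "card S = c" "finite S" using obtain_subset_with_card_n[of c V] cn cV by metis
      moreover from this obtain ws where "set ws = S" "distinct ws" using finite_distinct_list by blast
      ultimately have "ws \<in> W" by (auto simp: W_def tuples_def distinct_card[symmetric])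
      then show "W \<noteq> {}" by blast
    qed
    have mm: "2 * (real Q)\<^sup>2 * real m \<le> \<theta> * real (card V)"
    proof -
      have "2 * (real Q)\<^sup>2 * real m \<le> 2 * (real Q)\<^sup>2 * (\<mu> * real n)" using m by (intro mult_left_mono) auto
      also have "\<dots> = (2 * (real Q)\<^sup>2 * \<mu>) * real n" by simp
      also have "\<dots> \<le> \<theta> * real n" using \<mu>'(1) by (intro mult_right_mono) auto
      finally show ?thesis using cV by simp
    qed
    obtain F where F: "F \<subseteq> G" "finite F" "card F = m" "disjoint_family_on set F"
      and sumF: "(\<Sum>w\<in>W. (1 / 2) ^ card (F \<inter> absorbers E V Q w)) \<le> real (card W) * (1 - \<theta> / 4) ^ m"
      using select_disjoint_hitting_family[OF fin V0 Q W, of G "absorbers E V Q" \<theta> m] \<theta> aA mm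
      by (fastforce simp: W_def G_def absorbers_def)
    have hits: "\<gamma> * real n \<le> real (card (F \<inter> absorbers E V Q w))" if w: "w \<in> W" for w
    proof -
      let ?h = "card (F \<inter> absorbers E V Q w)"
      have "\<theta> * real n ^ Q \<le> real (card (absorbers E V Q w))" using aA w cV by (auto simp: W_def)
      also have "card (absorbers E V Q w) \<le> card (tuples Q V)"
        using fin by (intro card_mono) (auto simp: absorbers_def)
      also have "real (card (tuples Q V)) = 1 * real n ^ Q" using fin cV by (simp add: card_tuples)
      finally have "\<theta> * real n ^ Q \<le> 1 * real n ^ Q" by simp
      then have \<theta>1: "\<theta> \<le> 1" using n0 by (simp only: mult_le_cancel_right_pos zero_less_power)
      \<comment> \<open>One summand of the potential is at most the whole potential; comparing exponents gives a linear lower bound for the number of hits.\<close>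
      have "exp (- real ?h) = exp (- 1) ^ ?h" by (simp add: exp_of_nat_mult[symmetric])
      also have "\<dots> \<le> (1 / 2) ^ ?h"
      proof (rule power_mono)
        have "(2::real) \<le> exp 1" using exp_ge_add_one_self[of 1] by simp
        then show "exp (- 1) \<le> (1 / 2 :: real)" by (simp add: exp_minus field_simps)
      qed simp
      also have "\<dots> \<le> (\<Sum>w\<in>W. (1 / 2) ^ card (F \<inter> absorbers E V Q w))"
        using W(1) w by (intro member_le_sum) auto
      also note sumF
      also have "real (card W) * (1 - \<theta> / 4) ^ m \<le> real n ^ c * exp (- (\<theta> / 4)) ^ m"
      proof (intro mult_mono power_mono)
        have "card W \<le> card (tuples c V)" using fin by (intro card_mono) (auto simp: W_def)
        then show "real (card W) \<le> real n ^ c" using fin cV by (simp add: card_tuples flip: of_nat_power)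
        show "1 - \<theta> / 4 \<le> exp (- (\<theta> / 4))" using exp_ge_add_one_self[of "- (\<theta> / 4)"] by simp
      qed (use \<theta>1 in auto)
      also have "\<dots> = exp (real c * ln (real n) - \<theta> / 4 * real m)"
      proof -
        have "real n ^ c = exp (real c * ln (real n))" using n0 by (simp add: exp_of_nat_mult)
        moreover have "exp (- (\<theta> / 4)) ^ m = exp (real m * - (\<theta> / 4))" by (simp only: exp_of_nat_mult)
        ultimately show ?thesis by (simp add: exp_add[symmetric] mult.commute)
      qed
      finally have "- real ?h \<le> real c * ln (real n) - \<theta> / 4 * real m" by simp
      moreover have "\<theta> / 4 * (\<mu> * real n - 1) \<le> \<theta> / 4 * real m" using m(2) \<theta> by (intro mult_left_mono) auto
      ultimately show ?thesis using n unfolding \<gamma>_def by (simp add: algebra_simps)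
    qed
    define A where "A = \<Union> (set ` F)"
    have AV: "A \<subseteq> V" using F(1) by (auto simp: A_def G_def tuples_def)
    have "card A \<le> (\<Sum>zs\<in>F. card (set zs))" unfolding A_def by (rule card_UN_le[OF F(2)])
    also have "\<dots> \<le> (\<Sum>zs\<in>F. Q)"
      using F(1) by (intro sum_mono) (auto simp: G_def tuples_def intro: card_length[THEN order_trans])
    finally have "card A \<le> m * Q" using F(3) by simp
    then have "real (card A) \<le> real (m * Q)" by (simp only: of_nat_le_iff)
    also have "\<dots> = real Q * real m" by simp
    also have "\<dots> \<le> real Q * (\<mu> * real n)" using m by (intro mult_left_mono) auto
    finally have cA: "real (card A) \<le> (real Q * \<mu>) * real n" by simp
    then have cA1: "real (card A) \<le> \<eta> / 2 * real (card V)" and cA2: "real (card A) \<le> 1 / 2 * real n"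
      using \<mu>' mult_right_mono[of "real Q * \<mu>" _ "real n"] cV by fastforce+
    let ?E = "{e \<in> E. e \<subseteq> V - A}"
    have host': "host (real \<tau> / real c + \<eta> / 2) (V - A) ?E"
      using \<eta> by (intro host_after_deletion[OF host AV cA1]) (auto simp: b_def)
    have cVA: "card (V - A) = n - card A" using card_Diff_subset[OF finite_subset[OF AV fin] AV] cV by simp
    then have nN: "card (V - A) \<ge> N" using cA2 n by linarith
    obtain X where X: "X \<subseteq> V - A" "tileable ?E X" "real (card (V - A - X)) \<le> \<gamma> * real (card (V - A))"
      using N[OF host' nN] by blast
    define L where "L = V - A - X"
    have finL: "finite L" using fin by (simp add: L_def)
    have tX: "tileable E X" by (rule tileable_mono[OF X(2)]) auto
    have tF: "tileable E (set zs)" if "zs \<in> F" for zs using F(1) that by (auto simp: G_def)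
    have tA: "tileable E A" unfolding A_def using F tF by (intro tileable_UN) auto
    have "card V = card A + (card X + card L)"
    proof -
      have "V = A \<union> (X \<union> L)" using AV X(1) by (auto simp: L_def)
      moreover have "A \<inter> (X \<union> L) = {}" "X \<inter> L = {}" using X(1) by (auto simp: L_def)
      moreover have "finite A" "finite X" using tileable_card_dvd tA tX by blast+
      ultimately show ?thesis using finL by (metis card_Un_disjoint finite_UnI)
    qed
    then have "c dvd card L"
      using dvd cV tileable_card_dvd(2)[OF tA] tileable_card_dvd(2)[OF tX] by (metis dvd_add_right_iff)
    then obtain t where t: "card L = t * c" by (metis dvd_def mult.commute)
    have "tileable E (L \<union> \<Union> (set ` F))"
    proof (rule absorb_leftover[OF F(2,4) tF finL t])
      show "L \<inter> \<Union> (set ` F) = {}" by (auto simp: L_def A_def)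
      fix ws assume ws: "distinct ws" "length ws = c" "set ws \<subseteq> L"
      then have "ws \<in> W" by (auto simp: W_def tuples_def L_def)
      then have "\<gamma> * real n \<le> real (card (F \<inter> absorbers E V Q ws))" by (rule hits)
      moreover have "F \<inter> absorbers E V Q ws \<subseteq> {zs \<in> F. tileable E (set ws \<union> set zs)}" by (auto simp: absorbers_def)
      then have "card (F \<inter> absorbers E V Q ws) \<le> card {zs \<in> F. tileable E (set ws \<union> set zs)}"
        using F(2) by (intro card_mono) auto
      moreover have "real t \<le> \<gamma> * real n"
      proof -
        have "t \<le> card L" unfolding t using c_pos by simp
        then have "real t \<le> real (card L)" by simp
        also have "\<dots> \<le> \<gamma> * real (card (V - A))" using X(3) by (simp add: L_def)
        also have "\<dots> \<le> \<gamma> * real n" using \<gamma> cVA by (intro mult_left_mono) auto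
        finally show ?thesis .
      qed
      ultimately show "t \<le> card {zs \<in> F. tileable E (set ws \<union> set zs)}" by linarith
    qed
    then have "tileable E (L \<union> A)" unfolding A_def .
    then have "tileable E ((L \<union> A) \<union> X)"
      by (rule tileable_Un[OF _ tX]) (use X(1) in \<open>auto simp: L_def\<close>)
    moreover have "(L \<union> A) \<union> X = V" using AV X(1) by (auto simp: L_def)
    ultimately show "tileable E V" by simp
  qed
qed

section \<open>The packing threshold\<close>

lemma host_edges:
  assumes G: "k_graph k G" and n: "k - 1 \<le> card (verts G)"
    and d: "b * real (card (verts G)) \<le> real (min_codegree k G)"
  shows "host b (verts G) (edges G)"
  unfolding host_def
proof (intro conjI allI impI)
  have fin: "finite (verts G)" using G by (simp add: k_graph_def)
  then show "finite (verts G)" .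
  show "\<forall>e\<in>edges G. e \<subseteq> verts G \<and> card e = k" using G by (simp add: k_graph_def)
  fix S assume S: "S \<subseteq> verts G" "card S = k - 1"
  have finS: "finite S" using S(1) fin by (rule finite_subset)
  have "min_codegree k G \<le> codegree G S"
    unfolding min_codegree_def using S fin by (intro Min_le) auto
  also have "codegree G S \<le> card ((\<lambda>v. insert v S) ` {v \<in> verts G. insert v S \<in> edges G})"
    unfolding codegree_def
  proof (intro card_mono subsetI)
    fix e assume e: "e \<in> {e \<in> edges G. S \<subseteq> e}"
    then have ee: "e \<subseteq> verts G" "card e = k" "S \<subseteq> e" "e \<in> edges G" using G by (auto simp: k_graph_def)
    then have "card (e - S) = 1" using S k finS by (simp add: card_Diff_subset)
    then obtain v where "e - S = {v}" by (metis card_1_singletonE)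
    then have "e = insert v S" "v \<in> verts G" using ee by auto
    then show "e \<in> (\<lambda>v. insert v S) ` {v \<in> verts G. insert v S \<in> edges G}" using ee by blast
  qed (use fin in auto)
  also have "\<dots> \<le> card {v \<in> verts G. insert v S \<in> edges G}" using fin by (intro card_image_le) auto
  finally have "real (min_codegree k G) \<le> real (card {v \<in> verts G. insert v S \<in> edges G})" by simp
  then show "b * real (card (verts G)) \<le> real (card {v \<in> verts G. insert v S \<in> edges G})" using d by simp
qed

lemma threshold_upper:
  assumes \<eta>: "\<eta> > 0"
  shows "eventually (\<lambda>n. c dvd n \<longrightarrow>
    real (packing_threshold k (loose_cycle k s) n) \<le> (real \<tau> / real c + \<eta>) * real n + 1) sequentially"
proof -
  obtain N where N: "\<And>(V :: nat set) E. host (real \<tau> / real c + \<eta>) V E \<Longrightarrow> N \<le> card V \<Longrightarrow> c dvd card V \<Longrightarrow> tileable E V"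
    using perfect_tiling[OF \<eta>] unfolding for_large_hosts_def by blast
  show ?thesis
  proof (rule eventually_sequentiallyI[of "max N (k - 1)"], intro impI)
    fix n assume n: "max N (k - 1) \<le> n" and dvd: "c dvd n"
    let ?b = "real \<tau> / real c + \<eta>"
    have b0: "?b * real n \<ge> 0" using \<eta> by (intro mult_nonneg_nonneg) auto
    define d where "d = nat \<lceil>?b * real n\<rceil>"
    have d: "?b * real n \<le> real d" "real d \<le> ?b * real n + 1" using b0 unfolding d_def by linarith+
    have "packing_threshold k (loose_cycle k s) n \<le> d"
      unfolding packing_threshold_def
    proof (rule Least_le, intro allI impI)
      fix G :: "nat hypergraph"
      assume G: "k_graph k G \<and> card (verts G) = n \<and> d \<le> min_codegree k G"
      have "?b * real (card (verts G)) \<le> real (min_codegree k G)"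
        using G d(1) order_trans[of "?b * real n" "real d" "real (min_codegree k G)"] by simp
      then have "host ?b (verts G) (edges G)" using G n by (intro host_edges) auto
      then have "tileable (edges G) (verts G)" using N G n dvd by simp
      then show "\<exists>P. perfect_packing (loose_cycle k s) G P" using G by (intro perfect_packing_if_tileable) auto
    qed
    then show "real (packing_threshold k (loose_cycle k s) n) \<le> ?b * real n + 1" using d(2) by linarith
  qed
qed

lemma space_barrier:
  fixes G :: "nat hypergraph"
  assumes A: "\<And>e. e \<in> edges G \<Longrightarrow> e \<inter> A \<noteq> {}" and fin: "finite (verts G)"
    and P: "perfect_packing (loose_cycle k s) G P"
  shows "\<tau> * card (verts G) \<le> c * card (verts G \<inter> A)"
proof -
  have iso: "isomorphic (loose_cycle k s) K" "subgraph K G" if "K \<in> P" for K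
    using P that by (auto simp: perfect_packing_def packing_def)
  let ?T = "verts ` P"
  have un: "\<Union> ?T = verts G" using P by (simp add: perfect_packing_def)
  have finT: "finite ?T" using un fin by (metis finite_UnionD)
  have T: "finite T \<and> card T = c \<and> \<tau> \<le> card (T \<inter> A)" if "T \<in> ?T" for T
  proof -
    obtain ys where ys: "tile (edges G) ys" "set ys = T" using tile_if_isomorphic iso \<open>T \<in> ?T\<close> by blast
    have "s \<le> 2 * card (T \<inter> A)" using tile_cover_number[OF ys(1) A] ys(2) by simp
    then show ?thesis using ys card_tile by (auto simp: \<tau>_def)
  qed
  have disj: "pairwise disjnt ?T"
    using P by (auto simp: perfect_packing_def packing_def pairwise_def)
  have "card (verts G) = (\<Sum>T\<in>?T. card T)"
    unfolding un[symmetric] using T disj by (intro card_Union_disjoint) (auto simp: disjoint_def pairwise_def disjnt_def)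
  then have c1: "card (verts G) = card ?T * c" using T by simp
  have "card (\<Union>T\<in>?T. T \<inter> A) = (\<Sum>T\<in>?T. card (T \<inter> A))"
  proof (rule card_UN_disjoint[OF finT])
    show "\<forall>T\<in>?T. \<forall>T'\<in>?T. T \<noteq> T' \<longrightarrow> T \<inter> A \<inter> (T' \<inter> A) = {}"
      using disj unfolding pairwise_def disjnt_def by blast
  qed (use T in blast)
  moreover have "(\<Union>T\<in>?T. T \<inter> A) = verts G \<inter> A" unfolding un[symmetric] by blast
  moreover have "(\<Sum>T\<in>?T. \<tau>) \<le> (\<Sum>T\<in>?T. card (T \<inter> A))" using T by (intro sum_mono) blast
  ultimately have "card ?T * \<tau> \<le> card (verts G \<inter> A)" by simp
  then have "c * (card ?T * \<tau>) \<le> c * card (verts G \<inter> A)" by (rule mult_left_mono) simp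
  then show ?thesis unfolding c1 by (simp add: mult_ac)
qed

lemma two_cover_number_le: "2 * \<tau> \<le> c"
proof -
  have "2 * \<tau> \<le> s + 1" by (simp add: \<tau>_def)
  also have "\<dots> \<le> s * 2" using s by simp
  also have "\<dots> \<le> c" unfolding c_def using m2 by (intro mult_left_mono) auto
  finally show ?thesis .
qed

text \<open>
  The edges of the host are the \<open>k\<close>-sets that meet the first \<open>a\<close> vertices. A \<open>(k - 1)\<close>-set that avoids these vertices has
  exactly \<open>a\<close> neighbours, and any other one is extended to an edge by every further vertex. By \<open>space_barrier\<close> a perfect packing needs \<open>a \<ge> \<tau> * n / c\<close>.
\<close>
lemma threshold_lower:
  assumes dvd: "c dvd n" and n: "2 * k \<le> n"
  shows "real \<tau> / real c * real n \<le> real (packing_threshold k (loose_cycle k s) n)"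
proof -
  obtain t where t: "n = c * t" using dvd by auto
  have t0: "t > 0" using t n k by (cases t) auto
  have \<tau>0: "\<tau> > 0" using s by (simp add: \<tau>_def)
  define a where "a = \<tau> * t - 1"
  have a1: "a + 1 = \<tau> * t" unfolding a_def using mult_pos_pos[OF \<tau>0 t0] by linarith
  have an: "2 * (a + 1) \<le> n" unfolding a1 t using mult_le_mono1[OF two_cover_number_le, of t] by simp
  define G where "G = Hypergraph {..<n} {e. e \<subseteq> {..<n} \<and> card e = k \<and> e \<inter> {..<a} \<noteq> {}}"
  have kG: "k_graph k G" by (simp add: G_def k_graph_def)
  have vG: "verts G = {..<n}" "card (verts G) = n" by (simp_all add: G_def)
  have "a \<le> min_codegree k G"
    unfolding min_codegree_def
  proof (rule Min.boundedI)
    show "finite (codegree G ` {S. S \<subseteq> verts G \<and> card S = k - 1})" by (simp add: vG)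
    have "k - 1 \<le> card (verts G)" using vG n by simp
    then obtain S where "S \<subseteq> verts G" "card S = k - 1" "finite S" by (rule obtain_subset_with_card_n)
    then show "codegree G ` {S. S \<subseteq> verts G \<and> card S = k - 1} \<noteq> {}" by blast
    fix d assume "d \<in> codegree G ` {S. S \<subseteq> verts G \<and> card S = k - 1}"
    then obtain S where S: "d = codegree G S" "S \<subseteq> {..<n}" "card S = k - 1" using vG by auto
    have finS: "finite S" using S(2) finite_subset by blast
    define X where "X = (if S \<inter> {..<a} = {} then {..<a} else {..<n} - S)"
    have X: "X \<subseteq> {..<n} - S" using an by (auto simp: X_def)
    have "card ({..<n} - S) = n - (k - 1)" using S finS by (simp add: card_Diff_subset)
    then have cX: "a \<le> card X" using an n by (auto simp: X_def)
    have inj: "inj_on (\<lambda>v. insert v S) X"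
      by (rule inj_onI) (use X in blast)
    have "(\<lambda>v. insert v S) ` X \<subseteq> {e \<in> edges G. S \<subseteq> e}"
    proof (rule image_subsetI)
      fix v assume v: "v \<in> X"
      have "v \<notin> S" "v < n" using X v by auto
      then have "card (insert v S) = k" using S finS k by simp
      moreover have "insert v S \<inter> {..<a} \<noteq> {}" using v by (auto simp: X_def split: if_splits)
      ultimately show "insert v S \<in> {e \<in> edges G. S \<subseteq> e}" using \<open>v < n\<close> S(2) by (auto simp: G_def)
    qed
    then have "card ((\<lambda>v. insert v S) ` X) \<le> codegree G S"
      unfolding codegree_def by (intro card_mono) (auto simp: G_def)
    then show "a \<le> d" using cX inj S(1) by (simp add: card_image)
  qed
  moreover have "\<not> (\<exists>P. perfect_packing (loose_cycle k s) G P)"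
  proof
    assume "\<exists>P. perfect_packing (loose_cycle k s) G P"
    then obtain P where P: "perfect_packing (loose_cycle k s) G P" by blast
    have "\<tau> * card (verts G) \<le> c * card (verts G \<inter> {..<a})"
      by (rule space_barrier[OF _ _ P]) (auto simp: G_def)
    moreover have "verts G \<inter> {..<a} = {..<a}" using an by (auto simp: vG)
    ultimately have "\<tau> * n \<le> c * a" by (simp add: vG)
    then have "c * (\<tau> * t) \<le> c * a" by (simp add: t mult_ac)
    then show False using c_pos a1 by simp
  qed
  ultimately have "\<not> packing_threshold k (loose_cycle k s) n \<le> a"
    using packing_threshold_perfect_packing[OF kG, of "loose_cycle k s"] vG n by fastforce
  then have "a + 1 \<le> packing_threshold k (loose_cycle k s) n" by simp
  then have "real (\<tau> * t) \<le> real (packing_threshold k (loose_cycle k s) n)" unfolding a1 by (simp only: of_nat_le_iff)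
  moreover have "real \<tau> / real c * real n = real (\<tau> * t)" using c_pos by (simp add: t)
  ultimately show ?thesis by simp
qed

lemma threshold_value:
  "(if even s then real n / (2 * (real k - 1)) else (real s + 1) / (2 * real s * (real k - 1)) * real n)
    = real \<tau> / real c * real n"
proof -
  have c: "real c = real s * (real k - 1)" using k by (simp add: c_def of_nat_diff)
  show ?thesis
  proof (cases "even s")
    case True
    then have t: "real \<tau> = real s / 2" by (auto simp: \<tau>_def elim!: evenE)
    show ?thesis unfolding c t using True s by simp
  next
    case False
    then have t: "real \<tau> = (real s + 1) / 2" by (auto simp: \<tau>_def elim!: oddE)
    show ?thesis unfolding c t using False by simp
  qed
qed

end

theorem theorem1p4:
  fixes k s :: nat
  assumes "k \<ge> 3" and "s \<ge> 2"
  shows "(\<lambda>n. real (packing_threshold k (loose_cycle k s) n) -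
            (if even s then real n / (2 * (real k - 1))
             else (real s + 1) / (2 * real s * (real k - 1)) * real n))
         \<in> o[inf at_top (principal {n. s * (k - 1) dvd n})](\<lambda>n. real n)"
proof -
  interpret loose_cycle_tiling k s using assms by unfold_locales
  let ?F = "inf at_top (principal {n. s * (k - 1) dvd n})"
  show ?thesis
  proof (rule landau_o.smallI)
    fix \<epsilon> :: real assume \<epsilon>: "\<epsilon> > 0"
    then have \<epsilon>2: "\<epsilon> / 2 > 0" by simp
    have "eventually (\<lambda>n. 1 \<le> \<epsilon> / 2 * real n \<and> real (2 * k) \<le> 1 * real n) sequentially"
      by (intro eventually_conj eventually_le_mult) (use \<epsilon> in auto)
    with threshold_upper[OF \<epsilon>2]
    have "eventually (\<lambda>n. s * (k - 1) dvd n \<longrightarrow>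
      norm (real (packing_threshold k (loose_cycle k s) n) - real \<tau> / real c * real n) \<le> \<epsilon> * norm (real n)) at_top"
    proof (eventually_elim, intro impI)
      fix n
      assume u: "c dvd n \<longrightarrow> real (packing_threshold k (loose_cycle k s) n) \<le> (real \<tau> / real c + \<epsilon> / 2) * real n + 1"
        and n: "1 \<le> \<epsilon> / 2 * real n \<and> real (2 * k) \<le> 1 * real n" and "s * (k - 1) dvd n"
      then have dvd: "c dvd n" by (simp add: c_def)
      have "2 * k \<le> n" using n by linarith
      then have "real \<tau> / real c * real n \<le> real (packing_threshold k (loose_cycle k s) n)"
        by (rule threshold_lower[OF dvd])
      moreover have "real (packing_threshold k (loose_cycle k s) n) \<le> real \<tau> / real c * real n + \<epsilon> / 2 * real n + 1"
        using u dvd by (simp add: algebra_simps)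
      ultimately show "norm (real (packing_threshold k (loose_cycle k s) n) - real \<tau> / real c * real n) \<le> \<epsilon> * norm (real n)"
        using n by simp
    qed
    then show "eventually (\<lambda>n. norm (real (packing_threshold k (loose_cycle k s) n) -
            (if even s then real n / (2 * (real k - 1))
             else (real s + 1) / (2 * real s * (real k - 1)) * real n)) \<le> \<epsilon> * norm (real n)) ?F"
      unfolding threshold_value by (simp add: eventually_inf_principal)
  qed
qed

end
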